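(* Let $n=2$, $R$ a domain containing $\mathbb{Z}$ with field of fractions $K$, and $f\in R[x_1,x_2]$ a coordinate of $K[x_1,x_2]$ over $K$. Then $f$ is of one of the types I through V if and only if the following three conditions hold: (A) $H(f)\neq\{\mathrm{id}_{R[\mathbf{x}]}\}$; (B) $f$ is tamely reduced over $R$; (C) $\deg_{x_1}f\ge\deg_{x_2}f\ge1$.
   Context: $V(R)$ is the set of $\alpha/\beta\in K^\times$ with $\alpha,\beta\in R\setminus\{0\}$, $\alpha R+\beta R=R$. $\mathrm{Aff}(K,\mathbf{x})$: affine automorphisms of $K[\mathbf{x}]$ (generated by those with $\deg\phi(x_i)=1$). $\mathrm{T}(R,\mathbf{x})$: subgroup of $\mathrm{Aut}(R[\mathbf{x}]/R)$ generated by affine and elementary (fixing all variables but one) automorphisms. $H(f)=\mathrm{Aut}(R[\mathbf{x}]/R[f])\cap\mathrm{T}(R,\mathbf{x})$. $f\in R[\mathbf{x}]\setminus R$ is tamely reduced over $R$ if $\deg_{x_1}\tau(f)+\deg_{x_2}\tau(f)\ge\deg_{x_1}f+\deg_{x_2}f$ for all $\tau\in\mathrm{T}(R,\mathbf{x})$. Types for $f\in R[\mathbf{x}]$: (I) $f=ax_2+g$ with $a\in R\setminus\{0\}$, $g\in R[x_1]$, $\deg g\ge2$, leading coefficient of $g$ not in $aR$. (II) $f=a'x_1+h$ with $a'\in K^\times$, $h\in K[\mathbf{x}]$, such that there exist $\zeta\in R\setminus\{1\}$, $e\ge2$ with $\zeta^e=1$ and $a'\in R':=R[(\zeta-1)^{-1}]$,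 and there is $g\in R[x_1]$ with $\deg g\ge2$ whose leading coefficient is not in $(\zeta-1)R$, with $h\in R'[y_2^e]\setminus R'$ where $y_2=(\zeta-1)x_2+g$. (III) $f=a_1x_1+a_2x_2+b$ with $a_1,a_2\in R\setminus\{0\}$, $b\in R$, $a_1/a_2\notin V(R)$. (IV) $f=a\tau(x_1)^2+\tau(x_2)$ with $a\in R\setminus\{0\}$, $\tau\in\mathrm{Aff}(K,\mathbf{x})$, $\tau(x_1)=\alpha_1x_1+\alpha_2x_2$, $\alpha_1,\alpha_2\in K^\times$, $\alpha_1/\alpha_2\notin V(R)$. (V) $f=\tau(x_2+g')$ with $\tau\in\mathrm{Aff}(K,\mathbf{x})$, $g'\in K[x_1]$, $\deg g'\ge3$, such that (a) $g'\in x_1^{e'}K[x_1^{e'}]$ for some $e'\ge2$; (b) writing $\tau(x_1)=\alpha_1x_1+\alpha_2x_2+\alpha_0$, $\tau(x_2)=\beta_1x_1+\beta_2x_2+\beta_0$, we have $\alpha_1,\alpha_2\ne0$ and $\alpha_1/\alpha_2\notin V(R)$; (c) there is $\zeta'\in R\setminus\{1\}$ with $(\zeta')^{e'}=1$ and $(\zeta'-1)\alpha_i\beta_j/(\alpha_1\beta_2-\alpha_2\beta_1)\in R$ for $i=0,1,2$, $j=1,2$. *)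

theory Defs
  imports "HOL-Computational_Algebra.Polynomial"
begin

text \<open>Bivariate polynomials over K are encoded as 'a poly poly: the outer variable is x2,
the inner variable (of the coefficients) is x1.\<close>

definition X1 :: "'a::comm_ring_1 poly poly" where "X1 = [:[:0, 1:]:]"
definition X2 :: "'a::comm_ring_1 poly poly" where "X2 = [:0, 1:]"
definition const2 :: "'a::comm_ring_1 \<Rightarrow> 'a poly poly" where "const2 c = [:[:c:]:]"
definition lift1 :: "'a::comm_ring_1 poly \<Rightarrow> 'a poly poly" where "lift1 g = [:g:]"

definition subst2 :: "'a::comm_ring_1 poly poly \<Rightarrow> 'a poly poly \<times> 'a poly poly \<Rightarrow> 'a poly poly" where
  "subst2 p phi = poly (map_poly (\<lambda>c. poly (map_poly const2 c) (fst phi)) p) (snd phi)"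

text \<open>Endomorphisms are represented by the pair (phi(x1), phi(x2)); comp2 phi psi = phi o psi.\<close>
definition comp2 :: "'a::comm_ring_1 poly poly \<times> 'a poly poly \<Rightarrow> 'a poly poly \<times> 'a poly poly
    \<Rightarrow> 'a poly poly \<times> 'a poly poly" where
  "comp2 phi psi = (subst2 (fst psi) phi, subst2 (snd psi) phi)"

definition id2 :: "'a::comm_ring_1 poly poly \<times> 'a poly poly" where "id2 = (X1, X2)"

definition in_R :: "'a::comm_ring_1 set \<Rightarrow> 'a poly poly \<Rightarrow> bool" where
  "in_R R p \<longleftrightarrow> (\<forall>j i. coeff (coeff p j) i \<in> R)"

definition deg_x2 :: "'a::zero poly poly \<Rightarrow> nat" where "deg_x2 p = degree p"
definition deg_x1 :: "'a::zero poly poly \<Rightarrow> nat" where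
  "deg_x1 p = Max ((\<lambda>j. degree (coeff p j)) ` {..degree p})"
definition total_deg :: "'a::zero poly poly \<Rightarrow> nat" where
  "total_deg p = Max (insert 0 ((\<lambda>j. degree (coeff p j) + j) ` {j. j \<le> degree p \<and> coeff p j \<noteq> 0}))"

definition is_aut :: "'a::comm_ring_1 set \<Rightarrow> 'a poly poly \<times> 'a poly poly \<Rightarrow> bool" where
  "is_aut R phi \<longleftrightarrow> in_R R (fst phi) \<and> in_R R (snd phi) \<and>
     (\<exists>psi. in_R R (fst psi) \<and> in_R R (snd psi) \<and> comp2 phi psi = id2 \<and> comp2 psi phi = id2)"

definition is_affine :: "'a::comm_ring_1 set \<Rightarrow> 'a poly poly \<times> 'a poly poly \<Rightarrow> bool" where
  "is_affine R phi \<longleftrightarrow> is_aut R phi \<and> total_deg (fst phi) = 1 \<and> total_deg (snd phi) = 1"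

definition is_elementary :: "'a::comm_ring_1 set \<Rightarrow> 'a poly poly \<times> 'a poly poly \<Rightarrow> bool" where
  "is_elementary R phi \<longleftrightarrow> is_aut R phi \<and> (fst phi = X1 \<or> snd phi = X2)"

definition tame_gen :: "'a::comm_ring_1 set \<Rightarrow> 'a poly poly \<times> 'a poly poly \<Rightarrow> bool" where
  "tame_gen R phi \<longleftrightarrow> is_affine R phi \<or> is_elementary R phi"

inductive_set tame :: "'a::comm_ring_1 set \<Rightarrow> ('a poly poly \<times> 'a poly poly) set" for R where
  tame_id: "id2 \<in> tame R"
| tame_gen: "tau \<in> tame R \<Longrightarrow> tame_gen R sigma \<Longrightarrow> comp2 tau sigma \<in> tame R"
| tame_inv: "tau \<in> tame R \<Longrightarrow> tame_gen R sigma \<Longrightarrow> in_R R (fst sigma') \<Longrightarrow> in_R R (snd sigma')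
     \<Longrightarrow> comp2 sigma sigma' = id2 \<Longrightarrow> comp2 sigma' sigma = id2 \<Longrightarrow> comp2 tau sigma' \<in> tame R"

text \<open>H(f) = Aut(R[x]/R[f]) \<inter> T(R,x).\<close>
definition Hgrp :: "'a::comm_ring_1 set \<Rightarrow> 'a poly poly \<Rightarrow> ('a poly poly \<times> 'a poly poly) set" where
  "Hgrp R f = {tau \<in> tame R. subst2 f tau = f}"

definition tamely_reduced :: "'a::comm_ring_1 set \<Rightarrow> 'a poly poly \<Rightarrow> bool" where
  "tamely_reduced R f \<longleftrightarrow> in_R R f \<and> \<not> (\<exists>c\<in>R. f = const2 c) \<and>
     (\<forall>tau\<in>tame R. deg_x1 (subst2 f tau) + deg_x2 (subst2 f tau) \<ge> deg_x1 f + deg_x2 f)"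

definition coordinate :: "'a::field poly poly \<Rightarrow> bool" where
  "coordinate f \<longleftrightarrow> (\<exists>phi. is_aut UNIV phi \<and> fst phi = f)"

definition Vset :: "'a::field set \<Rightarrow> 'a set" where
  "Vset R = {alpha / beta | alpha beta. alpha \<in> R - {0} \<and> beta \<in> R - {0} \<and>
      (\<exists>s\<in>R. \<exists>t\<in>R. alpha * s + beta * t = 1)}"

definition loc :: "'a::field set \<Rightarrow> 'a \<Rightarrow> 'a set" where
  "loc R z = {r / (z - 1) ^ k | r k. r \<in> R}"

definition typeI :: "'a::field set \<Rightarrow> 'a poly poly \<Rightarrow> bool" where
  "typeI R f \<longleftrightarrow> (\<exists>a g. a \<in> R - {0} \<and> (\<forall>i. coeff g i \<in> R) \<and> degree g \<ge> 2 \<and>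
      lead_coeff g \<notin> {a * r | r. r \<in> R} \<and> f = const2 a * X2 + lift1 g)"

definition typeII :: "'a::field set \<Rightarrow> 'a poly poly \<Rightarrow> bool" where
  "typeII R f \<longleftrightarrow> (\<exists>a' h zeta (e::nat) g q.
      a' \<noteq> 0 \<and> zeta \<in> R \<and> zeta \<noteq> 1 \<and> e \<ge> 2 \<and> zeta ^ e = 1 \<and> a' \<in> loc R zeta \<and>
      (\<forall>i. coeff g i \<in> R) \<and> degree g \<ge> 2 \<and> lead_coeff g \<notin> {(zeta - 1) * r | r. r \<in> R} \<and>
      (\<forall>i. coeff q i \<in> loc R zeta) \<and>
      h = poly (map_poly const2 q) ((const2 (zeta - 1) * X2 + lift1 g) ^ e) \<and>
      \<not> (\<exists>c\<in>loc R zeta. h = const2 c) \<and>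
      f = const2 a' * X1 + h)"

definition typeIII :: "'a::field set \<Rightarrow> 'a poly poly \<Rightarrow> bool" where
  "typeIII R f \<longleftrightarrow> (\<exists>a1 a2 b. a1 \<in> R - {0} \<and> a2 \<in> R - {0} \<and> b \<in> R \<and> a1 / a2 \<notin> Vset R \<and>
      f = const2 a1 * X1 + const2 a2 * X2 + const2 b)"

definition typeIV :: "'a::field set \<Rightarrow> 'a poly poly \<Rightarrow> bool" where
  "typeIV R f \<longleftrightarrow> (\<exists>a tau alpha1 alpha2. a \<in> R - {0} \<and> is_affine UNIV tau \<and>
      fst tau = const2 alpha1 * X1 + const2 alpha2 * X2 \<and> alpha1 \<noteq> 0 \<and> alpha2 \<noteq> 0 \<and>
      alpha1 / alpha2 \<notin> Vset R \<and> f = const2 a * (fst tau) ^ 2 + snd tau)"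

definition typeV :: "'a::field set \<Rightarrow> 'a poly poly \<Rightarrow> bool" where
  "typeV R f \<longleftrightarrow> (\<exists>tau g' (e'::nat) alpha0 alpha1 alpha2 beta0 beta1 beta2 zeta'.
      is_affine UNIV tau \<and> degree g' \<ge> 3 \<and> e' \<ge> 2 \<and>
      (\<forall>i. coeff g' i \<noteq> 0 \<longrightarrow> e' dvd i \<and> i > 0) \<and>
      fst tau = const2 alpha1 * X1 + const2 alpha2 * X2 + const2 alpha0 \<and>
      snd tau = const2 beta1 * X1 + const2 beta2 * X2 + const2 beta0 \<and>
      alpha1 \<noteq> 0 \<and> alpha2 \<noteq> 0 \<and> alpha1 / alpha2 \<notin> Vset R \<and>
      zeta' \<in> R \<and> zeta' \<noteq> 1 \<and> zeta' ^ e' = 1 \<and>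
      (\<forall>alpha\<in>{alpha0, alpha1, alpha2}. \<forall>beta\<in>{beta1, beta2}.
         (zeta' - 1) * alpha * beta / (alpha1 * beta2 - alpha2 * beta1) \<in> R) \<and>
      f = subst2 (X2 + lift1 g') tau)"

end

(* Write J(f, h) for the Jacobian. If f is a coordinate over K, then J(f, -) is a locally nilpotent
   derivation, and so is J(F, -) for every weighted leading form F of f. The degree function of this
   derivation forces F = c (x2 + gamma x1^d)^n when deg_x1 f >= deg_x2 f >= 1, which is the part of the
   Jung-van der Kulk theorem that is needed.

   Tame automorphisms over R are alternating products of affine and triangular ones. Following the
   leading form along such a product shows that, if gamma is not in R (for d >= 2) or not in V(R)
   (for d = 1), the degree sum never drops, and that f can be fixed only by a triangular,
   respectively affine, automorphism. Conversely gamma in R or in V(R) allows a reduction.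

   In suitable coordinates over K the fixing automorphism is x1 -> u x1 + b, x2 -> v x2 + p(x1).
   Conjugated by f and a complement g of f it becomes x2 -> c x2 + q(x1), so an eigenvector with
   eigenvalue other than 1 is divisible by a suitable g. This determines f up to a polynomial in
   one variable and yields the five types. *)
theory Submission
  imports Defs
begin

subsection \<open>Bivariate polynomials\<close>

text \<open>Each type carries one arithmetic condition on the number \<gamma> of the leading form:
  \<gamma> is the leading coefficient of g divided by a in type I and by zeta - 1 in type II, it is
  a1 / a2 in type III and alpha1 / alpha2 in types IV and V. For d >= 2 a triangular letter of
  degree at most d replaces \<gamma> by (\<gamma> u^d + p_d) / v, and this can vanish over R only if
  \<gamma> lies in R. For d = 1 an invertible matrix acts by a fractional linear map, which takes a
  nonzero \<gamma> to 0 or infinity only if \<gamma> lies in V(R). The obstacle is cancellation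
  along a long word. What is followed is therefore not the pair of degrees but the pure power of a
  variable that survives in the top form: once the word has left the subgroup that can act on
  \<gamma>, an affine letter produces a power of X2, and the next triangular letter turns it into a
  power of X1 of at least twice the degree. Condition (c) of type V is the integrality of one
  matrix: the affine map that fixes tau(x2) and multiplies tau(x1) by zeta' is the identity plus a
  rank one map whose entries are the quotients listed there.\<close>

abbreviation cf :: "'a::comm_ring_1 poly poly \<Rightarrow> nat \<Rightarrow> nat \<Rightarrow> 'a" where
  "cf p i j \<equiv> coeff (coeff p j) i"

abbreviation ev :: "'a::comm_ring_1 poly \<Rightarrow> 'a poly poly \<Rightarrow> 'a poly poly" where
  "ev g P \<equiv> poly (map_poly const2 g) P"

lemma poly2_eqI: "(\<And>i j. cf p i j = cf q i j) \<Longrightarrow> p = q"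
  by (intro poly_eqI) auto

lemma cf_const2: "cf (const2 c) i j = (if i = 0 \<and> j = 0 then c else 0)"
  by (auto simp: const2_def coeff_pCons split: nat.splits)

lemma cf_X1: "cf X1 i j = (if i = 1 \<and> j = 0 then 1 else 0)"
  by (auto simp: X1_def coeff_pCons split: nat.splits)

lemma cf_X2: "cf X2 i j = (if i = 0 \<and> j = 1 then 1 else 0)"
  by (auto simp: X2_def coeff_pCons split: nat.splits)

lemma cf_lift1: "cf (lift1 g) i j = (if j = 0 then coeff g i else 0)"
  by (auto simp: lift1_def coeff_pCons split: nat.splits)

lemma const2_mult_eq_smult: "const2 c * p = smult [:c:] p"
  by (simp add: const2_def)

lemma cf_const2_mult: "cf (const2 c * p) i j = c * cf p i j"
  by (simp add: const2_mult_eq_smult)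

lemma const2_simps [simp]:
  "const2 0 = 0" "const2 1 = 1" "const2 (a + b) = const2 a + const2 b"
  "const2 (a * b) = const2 a * const2 b" "const2 (- a) = - const2 a" "const2 (a - b) = const2 a - const2 b"
  by (simp_all add: const2_def one_pCons)

lemma const2_power: "const2 (a ^ n) = const2 a ^ n"
  by (induction n) auto

lemma const2_eq_iff [simp]: "const2 a = const2 b \<longleftrightarrow> a = b"
  by (simp add: const2_def)

lemma const2_eq_0_iff [simp]: "const2 a = 0 \<longleftrightarrow> a = 0"
  by (simp add: const2_def)

lemma lift1_simps [simp]:
  "lift1 0 = 0" "lift1 1 = 1" "lift1 (p + q) = lift1 p + lift1 q" "lift1 (p * q) = lift1 p * lift1 q"
  "lift1 (- p) = - lift1 p" "lift1 (p - q) = lift1 p - lift1 q"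
  by (simp_all add: lift1_def one_pCons)

lemma lift1_const: "lift1 [:c:] = const2 c"
  by (simp add: lift1_def const2_def)

lemma lift1_pCons: "lift1 (pCons c p) = const2 c + X1 * lift1 p"
  by (simp add: lift1_def const2_def X1_def)

lemma lift1_smult: "lift1 (smult c p) = const2 c * lift1 p"
  by (simp add: lift1_def const2_def)

lemma pCons_lift: "pCons p q = lift1 p + X2 * q"
  by (simp add: lift1_def X2_def)

text \<open>Constants and the two variables generate the ring, so identities between homomorphisms
  or derivations need checking only there.\<close>

lemma poly2_induct [case_names const X1 X2 add mult]:
  assumes const: "\<And>c. P (const2 c)" and "P X1" and "P X2"
    and add: "\<And>p q. P p \<Longrightarrow> P q \<Longrightarrow> P (p + q)" and mult: "\<And>p q. P p \<Longrightarrow> P q \<Longrightarrow> P (p * q)"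
  shows "P p"
proof (induction p)
  case 0
  show ?case using const[of 0] by simp
next
  case (pCons a p)
  have "P (lift1 a)"
  proof (induction a)
    case 0
    show ?case using const[of 0] by simp
  next
    case (pCons c a)
    then show ?case unfolding lift1_pCons by (intro add mult const assms)
  qed
  then show ?case unfolding pCons_lift by (intro add mult assms pCons)
qed

lemma ev_simps [simp]:
  "ev 0 P = 0"
  "ev (pCons c p) P = const2 c + P * ev p P"
  by (simp_all add: map_poly_pCons)

lemma ev_add: "ev (p + q) P = ev p P + ev q P"
proof (induction p arbitrary: q)
  case 0 show ?case by simp
next
  case (pCons a p)
  obtain b r where "q = pCons b r" by (cases q)
  then show ?case
    by (simp add: pCons.IH algebra_simps)
qed

lemma ev_smult: "ev (smult c q) P = const2 c * ev q P"
  by (induction q) (simp_all add: algebra_simps)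

lemma ev_mult: "ev (p * q) P = ev p P * ev q P"
  by (induction p) (simp_all add: ev_add ev_smult algebra_simps)

lemma subst2_0 [simp]: "subst2 0 \<phi> = 0"
  by (simp add: subst2_def)

lemma subst2_pCons: "subst2 (pCons c p) \<phi> = ev c (fst \<phi>) + snd \<phi> * subst2 p \<phi>"
  by (simp add: subst2_def map_poly_pCons)

lemma subst2_lift1: "subst2 (lift1 g) \<phi> = ev g (fst \<phi>)"
  by (simp add: lift1_def subst2_pCons)

lemma subst2_add [simp]: "subst2 (p + q) \<phi> = subst2 p \<phi> + subst2 q \<phi>"
proof (induction p arbitrary: q)
  case 0 show ?case by simp
next
  case (pCons a p)
  obtain b r where "q = pCons b r" by (cases q)
  then show ?case
    by (simp add: subst2_pCons ev_add pCons.IH algebra_simps)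
qed

lemma subst2_smult: "subst2 (smult c q) \<phi> = subst2 (lift1 c) \<phi> * subst2 q \<phi>"
  by (induction q) (simp_all add: subst2_pCons subst2_lift1 ev_mult algebra_simps)

lemma subst2_mult [simp]: "subst2 (p * q) \<phi> = subst2 p \<phi> * subst2 q \<phi>"
  by (induction p) (simp_all add: subst2_pCons subst2_smult subst2_lift1 algebra_simps)

lemma subst2_const2 [simp]: "subst2 (const2 c) \<phi> = const2 c"
  by (simp add: const2_def subst2_pCons)

lemma subst2_X1 [simp]: "subst2 X1 \<phi> = fst \<phi>"
  by (simp add: X1_def subst2_pCons)

lemma subst2_X2 [simp]: "subst2 X2 \<phi> = snd \<phi>"
  by (simp add: X2_def subst2_pCons)

lemma subst2_1 [simp]: "subst2 1 \<phi> = 1"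
  using subst2_const2[of 1 \<phi>] by simp

lemma subst2_uminus [simp]: "subst2 (- p) \<phi> = - subst2 p \<phi>"
  using subst2_add[of p "- p" \<phi>] by (simp add: eq_neg_iff_add_eq_0 add.commute)

lemma subst2_diff [simp]: "subst2 (p - q) \<phi> = subst2 p \<phi> - subst2 q \<phi>"
  using subst2_add[of p "- q" \<phi>] by simp

lemma subst2_power [simp]: "subst2 (p ^ n) \<phi> = subst2 p \<phi> ^ n"
  by (induction n) auto

lemma subst2_sum [simp]: "subst2 (sum F A) \<phi> = (\<Sum>x\<in>A. subst2 (F x) \<phi>)"
  by (induction A rule: infinite_finite_induct) auto

lemma subst2_poly_const2 [simp]:
  "subst2 (ev g P) \<phi> = ev g (subst2 P \<phi>)"
  by (induction g) auto

text \<open>Fixes the order of action: \<open>comp2 \<phi> \<psi>\<close> is the composite of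
  endomorphisms, so in a word the rightmost letter reaches the polynomial first.\<close>

lemma subst2_subst2: "subst2 (subst2 p \<psi>) \<phi> = subst2 p (comp2 \<phi> \<psi>)"
  by (induction p rule: poly2_induct) (auto simp: comp2_def)

lemma subst2_id2 [simp]: "subst2 p id2 = p"
  by (induction p rule: poly2_induct) (auto simp: id2_def)

lemma fst_comp2 [simp]: "fst (comp2 \<phi> \<psi>) = subst2 (fst \<psi>) \<phi>"
  and snd_comp2 [simp]: "snd (comp2 \<phi> \<psi>) = subst2 (snd \<psi>) \<phi>"
  by (simp_all add: comp2_def)

lemma comp2_assoc: "comp2 (comp2 \<phi> \<psi>) \<chi> = comp2 \<phi> (comp2 \<psi> \<chi>)"
  by (simp add: prod_eq_iff subst2_subst2)

lemma fst_id2 [simp]: "fst id2 = X1" and snd_id2 [simp]: "snd id2 = X2"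
  by (simp_all add: id2_def)

lemma comp2_id2 [simp]: "comp2 id2 \<phi> = \<phi>" "comp2 \<phi> id2 = \<phi>"
  by (simp_all add: prod_eq_iff)

lemma lift1_eq_poly_X1: "lift1 g = ev g X1"
  by (induction g) (simp_all add: lift1_pCons)

lemma ev_lift1: "ev g (lift1 l) = lift1 (pcompose g l)"
  by (induction g) (simp_all add: pcompose_pCons lift1_const)

lemma cf_mult: "cf (p * q) i j = (\<Sum>l\<le>j. \<Sum>k\<le>i. cf p k l * cf q (i - k) (j - l))"
  by (simp add: coeff_mult coeff_sum)

lemma cf_X1_power_X2_power: "cf (X1 ^ k * X2 ^ l) i j = (if i = k \<and> j = l then 1 else 0)"
proof -
  have "X1 ^ k = [:monom (1::'a) k:]"
    by (induction k) (simp_all add: X1_def one_pCons monom_Suc)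
  moreover have "(X2::'a poly poly) ^ l = monom 1 l"
    by (induction l) (simp_all add: X2_def monom_Suc)
  ultimately show ?thesis by (auto simp: coeff_monom)
qed

lemma poly2_expand:
  assumes "finite S" and "\<And>i j. cf p i j \<noteq> 0 \<Longrightarrow> (i, j) \<in> S"
  shows "p = (\<Sum>(i, j)\<in>S. const2 (cf p i j) * (X1 ^ i * X2 ^ j))"
proof (rule poly2_eqI)
  fix i j
  have "cf (\<Sum>(i, j)\<in>S. const2 (cf p i j) * (X1 ^ i * X2 ^ j)) i j
      = (\<Sum>x\<in>S. if x = (i, j) then cf p i j else 0)"
    by (auto simp: coeff_sum split_def cf_const2_mult cf_X1_power_X2_power prod_eq_iff intro!: sum.cong)
  also have "\<dots> = cf p i j"
    using assms by (auto simp: sum.delta)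
  finally show "cf p i j = cf (\<Sum>(i, j)\<in>S. const2 (cf p i j) * (X1 ^ i * X2 ^ j)) i j" by simp
qed

definition supp2 :: "'a::comm_ring_1 poly poly \<Rightarrow> (nat \<times> nat) set" where
  "supp2 p = {(i, j). cf p i j \<noteq> 0}"

lemma in_supp2 [simp]: "(i, j) \<in> supp2 p \<longleftrightarrow> cf p i j \<noteq> 0"
  by (simp add: supp2_def)

lemma finite_supp2 [simp]: "finite (supp2 p)"
proof -
  have "supp2 p \<subseteq> (\<Union>j\<in>{..degree p}. (\<lambda>i. (i, j)) ` {..degree (coeff p j)})"
    by (auto simp: supp2_def image_iff) (metis coeff_0 le_degree)+
  then show ?thesis by (rule finite_subset) auto
qed

lemma supp2_expand: "p = (\<Sum>(i, j)\<in>supp2 p. const2 (cf p i j) * (X1 ^ i * X2 ^ j))"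
  by (rule poly2_expand) auto

lemma deg_x2_le_iff: "deg_x2 p \<le> N \<longleftrightarrow> (\<forall>i j. cf p i j \<noteq> 0 \<longrightarrow> j \<le> N)"
proof
  assume "\<forall>i j. cf p i j \<noteq> 0 \<longrightarrow> j \<le> N"
  then show "deg_x2 p \<le> N" unfolding deg_x2_def
    by (intro degree_le allI impI poly_eqI) (metis coeff_0 linorder_not_le)
qed (metis coeff_0 deg_x2_def le_degree order_trans)

lemma deg_x1_le_iff: "deg_x1 p \<le> N \<longleftrightarrow> (\<forall>i j. cf p i j \<noteq> 0 \<longrightarrow> i \<le> N)"
proof -
  have "deg_x1 p \<le> N \<longleftrightarrow> (\<forall>j\<le>degree p. degree (coeff p j) \<le> N)"
    by (auto simp: deg_x1_def)
  also have "\<dots> \<longleftrightarrow> (\<forall>i j. cf p i j \<noteq> 0 \<longrightarrow> i \<le> N)"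
  proof
    assume *: "\<forall>j\<le>degree p. degree (coeff p j) \<le> N"
    show "\<forall>i j. cf p i j \<noteq> 0 \<longrightarrow> i \<le> N"
      by (metis * coeff_0 le_degree order_trans)
  next
    assume *: "\<forall>i j. cf p i j \<noteq> 0 \<longrightarrow> i \<le> N"
    show "\<forall>j\<le>degree p. degree (coeff p j) \<le> N"
      using * by (metis degree_le linorder_not_le)
  qed
  finally show ?thesis .
qed

lemma total_deg_le_iff: "total_deg p \<le> N \<longleftrightarrow> (\<forall>i j. cf p i j \<noteq> 0 \<longrightarrow> i + j \<le> N)"
proof -
  have "total_deg p \<le> N \<longleftrightarrow> (\<forall>j. j \<le> degree p \<and> coeff p j \<noteq> 0 \<longrightarrow> degree (coeff p j) + j \<le> N)"
    unfolding total_deg_def by (subst Max_le_iff) auto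
  also have "\<dots> \<longleftrightarrow> (\<forall>i j. cf p i j \<noteq> 0 \<longrightarrow> i + j \<le> N)"
  proof
    assume *: "\<forall>j. j \<le> degree p \<and> coeff p j \<noteq> 0 \<longrightarrow> degree (coeff p j) + j \<le> N"
    show "\<forall>i j. cf p i j \<noteq> 0 \<longrightarrow> i + j \<le> N"
    proof (intro allI impI)
      fix i j assume "cf p i j \<noteq> 0"
      then have "i \<le> degree (coeff p j)" "coeff p j \<noteq> 0" by (auto intro: le_degree)
      then show "i + j \<le> N" using * by (metis add_le_mono1 le_degree order_trans)
    qed
  qed auto
  finally show ?thesis .
qed

lemma cf_le_deg_x1: "cf p i j \<noteq> 0 \<Longrightarrow> i \<le> deg_x1 p"
  and cf_le_deg_x2: "cf p i j \<noteq> 0 \<Longrightarrow> j \<le> deg_x2 p"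
  using deg_x1_le_iff deg_x2_le_iff by blast+

lemma deg_x1_attained: "p \<noteq> 0 \<Longrightarrow> \<exists>j. cf p (deg_x1 p) j \<noteq> 0"
proof -
  assume "p \<noteq> 0"
  have "deg_x1 p \<in> (\<lambda>j. degree (coeff p j)) ` {..degree p}"
    unfolding deg_x1_def by (rule Max_in) auto
  then obtain j where j: "deg_x1 p = degree (coeff p j)" by auto
  show ?thesis
  proof (cases "coeff p j = 0")
    case True
    then show ?thesis using j \<open>p \<noteq> 0\<close> cf_le_deg_x1[of p]
      by (metis bot_nat_0.extremum_uniqueI coeff_0 degree_0 leading_coeff_0_iff)
  next
    case False
    then show ?thesis using j by (intro exI[of _ j]) simp
  qed
qed

lemma deg_x2_attained: "p \<noteq> 0 \<Longrightarrow> \<exists>i. cf p i (deg_x2 p) \<noteq> 0"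
  unfolding deg_x2_def by (metis leading_coeff_0_iff)

subsection \<open>Weighted homogeneous components\<close>

text \<open>An upper bound instead of a degree: the zero polynomial needs no exception, and the
  component at the bound may vanish. Weights are integers because differentiation subtracts from
  them.\<close>

definition wle :: "int \<Rightarrow> int \<Rightarrow> int \<Rightarrow> 'a::comm_ring_1 poly poly \<Rightarrow> bool" where
  "wle a b N p \<longleftrightarrow> (\<forall>i j. cf p i j \<noteq> 0 \<longrightarrow> a * int i + b * int j \<le> N)"

definition wcomp :: "int \<Rightarrow> int \<Rightarrow> int \<Rightarrow> 'a::comm_ring_1 poly poly \<Rightarrow> 'a poly poly" where
  "wcomp a b N p = (\<Sum>(i, j)\<in>{(i, j) \<in> supp2 p. a * int i + b * int j = N}. const2 (cf p i j) * (X1 ^ i * X2 ^ j))"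

lemma cf_wcomp: "cf (wcomp a b N p) i j = (if a * int i + b * int j = N then cf p i j else 0)"
proof -
  let ?S = "{(i, j) \<in> supp2 p. a * int i + b * int j = N}"
  have fin: "finite ?S" by (rule finite_subset[of _ "supp2 p"]) auto
  have "cf (wcomp a b N p) i j = (\<Sum>x\<in>?S. if x = (i, j) then cf p i j else 0)"
    unfolding wcomp_def
    by (auto simp: coeff_sum split_def cf_const2_mult cf_X1_power_X2_power prod_eq_iff intro!: sum.cong)
  also have "\<dots> = (if a * int i + b * int j = N then cf p i j else 0)"
    using fin by (auto simp: sum.delta)
  finally show ?thesis .
qed

lemma wleI: "(\<And>i j. cf p i j \<noteq> 0 \<Longrightarrow> a * int i + b * int j \<le> N) \<Longrightarrow> wle a b N p"
  by (simp add: wle_def)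

lemma wleD: "wle a b N p \<Longrightarrow> cf p i j \<noteq> 0 \<Longrightarrow> a * int i + b * int j \<le> N"
  by (simp add: wle_def)

lemma wle_mono: "wle a b N p \<Longrightarrow> N \<le> M \<Longrightarrow> wle a b M p"
  by (meson order_trans wle_def)

lemma wle_add: "wle a b N p \<Longrightarrow> wle a b N q \<Longrightarrow> wle a b N (p + q)"
  by (rule wleI) (metis add_0 coeff_add wleD)

lemma wle_0 [simp]: "wle a b N 0" and wcomp_0 [simp]: "wcomp a b N 0 = 0"
  by (auto simp: wle_def cf_wcomp intro: poly2_eqI)

lemma wle_const2: "0 \<le> N \<Longrightarrow> wle a b N (const2 c)"
  by (auto simp: wle_def cf_const2)

lemma wle_sum: "(\<And>x. x \<in> A \<Longrightarrow> wle a b N (F x)) \<Longrightarrow> wle a b N (sum F A)"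
  by (induction A rule: infinite_finite_induct) (auto intro: wle_add)

lemma wcomp_add [simp]: "wcomp a b N (p + q) = wcomp a b N p + wcomp a b N q"
  and wcomp_diff [simp]: "wcomp a b N (p - q) = wcomp a b N p - wcomp a b N q"
  by (auto intro!: poly2_eqI simp: cf_wcomp)

lemma wcomp_sum: "wcomp a b N (sum F A) = (\<Sum>x\<in>A. wcomp a b N (F x))"
  by (induction A rule: infinite_finite_induct) auto

lemma wcomp_const2_mult [simp]: "wcomp a b N (const2 c * p) = const2 c * wcomp a b N p"
  by (auto intro!: poly2_eqI simp: cf_wcomp cf_const2_mult)

lemma wcomp_eq_0_of_wle: "wle a b M p \<Longrightarrow> M < N \<Longrightarrow> wcomp a b N p = 0"
  by (intro poly2_eqI) (use wleD in \<open>fastforce simp: cf_wcomp\<close>)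

lemma wcomp_const2: "wcomp a b 0 (const2 c) = const2 c"
  by (auto intro!: poly2_eqI simp: cf_wcomp cf_const2)

lemma wle_mult:
  assumes "wle a b N p" "wle a b M q"
  shows "wle a b (N + M) (p * q)"
proof (rule wleI)
  fix i j assume "cf (p * q) i j \<noteq> 0"
  then obtain k l where kl: "l \<le> j" "k \<le> i" "cf p k l * cf q (i - k) (j - l) \<noteq> 0"
    unfolding cf_mult by (meson atMost_iff sum.not_neutral_contains_not_neutral)
  then have "cf p k l \<noteq> 0" "cf q (i - k) (j - l) \<noteq> 0" by auto
  then have "a * int k + b * int l \<le> N" "a * int (i - k) + b * int (j - l) \<le> M"
    using assms by (auto dest: wleD)
  then show "a * int i + b * int j \<le> N + M" using kl by (simp add: of_nat_diff algebra_simps)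
qed

text \<open>A product of two terms reaches the weight N + M only if both factors attain their
  bounds, so everything below the top drops out, coefficient by coefficient.\<close>

lemma wcomp_mult:
  assumes "wle a b N p" "wle a b M q"
  shows "wcomp a b (N + M) (p * q) = wcomp a b N p * wcomp a b M q"
proof (rule poly2_eqI)
  fix i j
  have eq: "cf (wcomp a b N p) k l * cf (wcomp a b M q) (i - k) (j - l)
       = (if a * int i + b * int j = N + M then cf p k l * cf q (i - k) (j - l) else 0)"
    if "l \<le> j" "k \<le> i" for k l
  proof (cases "cf p k l = 0 \<or> cf q (i - k) (j - l) = 0")
    case False
    then have "a * int k + b * int l \<le> N" "a * int (i - k) + b * int (j - l) \<le> M"
      using assms by (auto dest: wleD)
    moreover have "a * int i + b * int j = (a * int k + b * int l) + (a * int (i - k) + b * int (j - l))"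
      using that by (simp add: of_nat_diff algebra_simps)
    ultimately show ?thesis by (auto simp: cf_wcomp)
  qed (auto simp: cf_wcomp)
  have "cf (wcomp a b N p * wcomp a b M q) i j
      = (\<Sum>l\<le>j. \<Sum>k\<le>i. (if a * int i + b * int j = N + M then cf p k l * cf q (i - k) (j - l) else 0))"
    unfolding cf_mult by (intro sum.cong refl eq) auto
  then show "cf (wcomp a b (N + M) (p * q)) i j = cf (wcomp a b N p * wcomp a b M q) i j"
    by (auto simp: cf_wcomp cf_mult)
qed

lemma wle_power: "wle a b N p \<Longrightarrow> wle a b (N * int k) (p ^ k)"
proof (induction k)
  case 0
  show ?case using wle_const2[of 0 a b 1] by simp
next
  case (Suc k)
  then show ?case using wle_mult[of a b N p "N * int k" "p ^ k"] by (simp add: algebra_simps)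
qed

lemma wcomp_power: "wle a b N p \<Longrightarrow> wcomp a b (N * int k) (p ^ k) = wcomp a b N p ^ k"
proof (induction k)
  case 0
  show ?case using wcomp_const2[of a b 1] by simp
next
  case (Suc k)
  then show ?case using wcomp_mult[of a b N p "N * int k" "p ^ k"] by (simp add: wle_power algebra_simps)
qed

lemma wle_monom_subst:
  assumes P: "wle a b a' P" and Q: "wle a b b' Q"
  shows "wle a b (a' * int i + b' * int j) (const2 c * (P ^ i * Q ^ j))"
    and "wcomp a b (a' * int i + b' * int j) (const2 c * (P ^ i * Q ^ j))
       = const2 c * (wcomp a b a' P ^ i * wcomp a b b' Q ^ j)"
proof -
  note w = wle_mult[OF wle_power[OF P, of i] wle_power[OF Q, of j]]
  show "wle a b (a' * int i + b' * int j) (const2 c * (P ^ i * Q ^ j))"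
    using wle_mult[OF wle_const2[of 0 a b c] w] by simp
  show "wcomp a b (a' * int i + b' * int j) (const2 c * (P ^ i * Q ^ j))
       = const2 c * (wcomp a b a' P ^ i * wcomp a b b' Q ^ j)"
    using wcomp_mult[OF wle_power[OF P, of i] wle_power[OF Q, of j]] wcomp_power[OF P] wcomp_power[OF Q] by simp
qed

lemma subst2_expand: "subst2 f (P, Q) = (\<Sum>(i, j)\<in>supp2 f. const2 (cf f i j) * (P ^ i * Q ^ j))"
  by (subst supp2_expand[of f]) (simp add: split_def)

lemma wle_subst2:
  assumes f: "wle a' b' N f" and P: "wle a b a' P" and Q: "wle a b b' Q"
  shows "wle a b N (subst2 f (P, Q))"
  unfolding subst2_expand
proof (rule wle_sum, clarify)
  fix i j assume "(i, j) \<in> supp2 f"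
  then show "wle a b N (const2 (cf f i j) * (P ^ i * Q ^ j))"
    using f by (intro wle_mono[OF wle_monom_subst(1)[OF P Q]]) (auto dest: wleD)
qed

text \<open>If the substituted polynomials respect the weights a' and b', then top forms are
  substituted into top forms. This remains true when the result is zero, so possible cancellation is
  visible in the top forms alone.\<close>

lemma wcomp_subst2:
  assumes f: "wle a' b' N f" and P: "wle a b a' P" and Q: "wle a b b' Q"
  shows "wcomp a b N (subst2 f (P, Q)) = subst2 (wcomp a' b' N f) (wcomp a b a' P, wcomp a b b' Q)"
proof -
  let ?P = "wcomp a b a' P" and ?Q = "wcomp a b b' Q"
  let ?S = "{(i, j) \<in> supp2 f. a' * int i + b' * int j = N}"
  have "wcomp a b N (subst2 f (P, Q)) = (\<Sum>(i, j)\<in>supp2 f. wcomp a b N (const2 (cf f i j) * (P ^ i * Q ^ j)))"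
    unfolding subst2_expand by (simp add: wcomp_sum split_def)
  also have "\<dots> = (\<Sum>x\<in>supp2 f. if x \<in> ?S then const2 (cf f (fst x) (snd x)) * (?P ^ fst x * ?Q ^ snd x) else 0)"
  proof (intro sum.cong refl, clarify)
    fix i j assume ij: "(i, j) \<in> supp2 f"
    note w = wle_monom_subst[OF P Q, of i j "cf f i j"]
    show "wcomp a b N (const2 (cf f i j) * (P ^ i * Q ^ j)) =
      (if (i, j) \<in> ?S then const2 (cf f (fst (i, j)) (snd (i, j))) * (?P ^ fst (i, j) * ?Q ^ snd (i, j)) else 0)"
    proof (cases "a' * int i + b' * int j = N")
      case False
      then have "a' * int i + b' * int j < N" using wleD[OF f] ij by fastforce
      then show ?thesis using wcomp_eq_0_of_wle[OF w(1)] False by auto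
    qed (use w(2) ij in auto)
  qed
  also have "\<dots> = (\<Sum>x\<in>?S. const2 (cf f (fst x) (snd x)) * (?P ^ fst x * ?Q ^ snd x))"
    by (subst sum.inter_filter[symmetric]) (auto intro!: sum.cong)
  also have "\<dots> = subst2 (wcomp a' b' N f) (?P, ?Q)"
    unfolding wcomp_def[of a' b' N f] by (simp add: split_def)
  finally show ?thesis .
qed

lemma wle_lift1: "0 \<le> a \<Longrightarrow> degree g \<le> d \<Longrightarrow> wle a b (a * int d) (lift1 g)"
  by (rule wleI) (auto simp: cf_lift1 intro!: mult_left_mono dest!: le_degree split: if_splits)

lemma wcomp_lift1:
  fixes g :: "'a::comm_ring_1 poly"
  shows "0 < a \<Longrightarrow> wcomp a b (a * int d) (lift1 g) = const2 (coeff g d) * X1 ^ d"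
  using cf_X1_power_X2_power[where ?'a = 'a, of d 0]
  by (intro poly2_eqI) (auto simp: cf_wcomp cf_lift1 cf_const2_mult)

lemma wcomp_X1: "wcomp a b a X1 = X1" and wcomp_X2: "wcomp a b b X2 = X2"
  by (auto intro!: poly2_eqI simp: cf_wcomp cf_X1 cf_X2)

lemma wle_X1: "wle a b a X1" and wle_X2: "wle a b b X2"
  by (auto simp: wle_def cf_X1 cf_X2 split: if_splits)

lemma wle_const2_mult: "wle a b N p \<Longrightarrow> wle a b N (const2 c * p)"
  by (rule wleI) (auto simp: cf_const2_mult dest!: wleD)

definition lform :: "'a::comm_ring_1 \<Rightarrow> 'a \<Rightarrow> 'a poly poly" where
  "lform a b = const2 a * X1 + const2 b * X2"

definition aff :: "'a::comm_ring_1 \<Rightarrow> 'a \<Rightarrow> 'a \<Rightarrow> 'a poly poly" where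
  "aff a b c = const2 a * X1 + const2 b * X2 + const2 c"

lemma cf_aff: "cf (aff a b c) i j = (if i = 1 \<and> j = 0 then a else if i = 0 \<and> j = 1 then b else if i = 0 \<and> j = 0 then c else 0)"
  by (auto simp: aff_def cf_const2_mult cf_X1 cf_X2 cf_const2)

lemma aff_eq_iff [simp]: "aff a b c = aff a' b' c' \<longleftrightarrow> a = a' \<and> b = b' \<and> c = c'"
proof
  assume eq: "aff a b c = aff a' b' c'"
  have "cf (aff a b c) i j = cf (aff a' b' c') i j" for i j using eq by simp
  from this[of 1 0] this[of 0 1] this[of 0 0] show "a = a' \<and> b = b' \<and> c = c'" by (simp add: cf_aff)
qed simp

lemma subst2_aff [simp]: "subst2 (aff a b c) (P, Q) = const2 a * P + const2 b * Q + const2 c"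
  by (simp add: aff_def)

lemma subst2_aff_aff: "subst2 (aff a b c) (aff a1 b1 c1, aff a2 b2 c2)
   = aff (a * a1 + b * a2) (a * b1 + b * b2) (a * c1 + b * c2 + c)"
  by (simp add: aff_def algebra_simps)

lemma wle_aff: "wle 1 1 1 (aff a b c)"
  by (auto simp: wle_def cf_aff split: if_splits)

lemma wcomp_aff: "wcomp 1 1 1 (aff a b c) = lform a b"
  by (auto intro!: poly2_eqI simp: cf_wcomp cf_aff lform_def cf_const2_mult cf_X1 cf_X2)

lemma wle_1_1_aff_0: "1 \<le> N \<Longrightarrow> wle 1 N 1 (aff a 0 c)"
  by (auto simp: wle_def cf_aff split: if_splits)

lemma wcomp_1_aff_0: "wcomp 1 N 1 (aff a 0 c) = const2 a * X1"
  by (auto intro!: poly2_eqI simp: cf_wcomp cf_aff cf_const2_mult cf_X1)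

lemma cf_lform_power:
  fixes a b :: "'a::comm_ring_1"
  shows "cf (lform a b ^ n) 0 n = b ^ n" and "cf (lform a b ^ n) n 0 = a ^ n"
proof -
  have eq: "lform a b = [:[:0, a:], [:b:]:]"
    by (simp add: lform_def const2_def X1_def X2_def)
  have "degree (lform a b ^ n) \<le> 1 * n"
    using degree_power_le[of "lform a b" n] degree_pCons_le[of "[:0, a:]" "[:[:b:]:]"] unfolding eq
    by (simp add: order_trans[OF degree_power_le] mult_le_mono1)
  have "coeff (lform a b ^ n) n = [:b:] ^ n"
  proof (induction n)
    case (Suc n)
    have "degree (lform a b ^ n) \<le> n"
      using degree_power_le[of "lform a b" n] unfolding eq
      by (metis (no_types, lifting) One_nat_def degree_pCons_0 degree_pCons_le mult_le_mono1 nat_mult_1 order_trans)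
    then have "coeff (lform a b ^ n) (Suc n) = 0" by (intro coeff_eq_0) simp
    then show ?case using Suc by (simp add: eq coeff_pCons)
  qed simp
  then show "cf (lform a b ^ n) 0 n = b ^ n"
    by (simp add: coeff_0_power)
  have "coeff (lform a b ^ n) 0 = [:0, a:] ^ n"
    by (simp add: coeff_0_power eq)
  also have "\<dots> = monom (a ^ n) n"
    by (induction n) (auto simp: monom_Suc monom_0 smult_monom)
  finally show "cf (lform a b ^ n) n 0 = a ^ n" by simp
qed

definition lead :: "nat \<Rightarrow> nat \<Rightarrow> 'a::comm_ring_1 \<Rightarrow> 'a \<Rightarrow> 'a poly poly \<Rightarrow> bool" where
  "lead d n c \<gamma> f \<longleftrightarrow> wle 1 (int d) (int (n * d)) f \<and>
     wcomp 1 (int d) (int (n * d)) f = const2 c * (X2 + const2 \<gamma> * X1 ^ d) ^ n"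

lemma cf_lead_form:
  fixes \<gamma> :: "'a::comm_ring_1"
  assumes "0 < d"
  shows "cf ((X2 + const2 \<gamma> * X1 ^ d) ^ n) 0 n = 1"
    and "cf ((X2 + const2 \<gamma> * X1 ^ d) ^ n) (n * d) 0 = \<gamma> ^ n"
proof -
  have "X1 ^ d = [:monom (1::'a) d:]"
    by (induction d) (simp_all add: X1_def one_pCons monom_Suc)
  then have eq: "X2 + const2 \<gamma> * X1 ^ d = [:monom \<gamma> d, 1:]"
    by (simp add: X2_def const2_def smult_monom)
  have "coeff ([:monom \<gamma> d, 1:] ^ n) n = 1"
  proof (induction n)
    case (Suc n)
    have "degree ([:monom \<gamma> d, 1:] ^ n) \<le> n"
      using degree_power_le[of "[:monom \<gamma> d, 1:]" n] by simp
    then have "coeff ([:monom \<gamma> d, 1:] ^ n) (Suc n) = 0" by (intro coeff_eq_0) simp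
    then show ?case using Suc by (simp add: coeff_pCons)
  qed simp
  then show "cf ((X2 + const2 \<gamma> * X1 ^ d) ^ n) 0 n = 1" unfolding eq by simp
  have "coeff ([:monom \<gamma> d, 1:] ^ n) 0 = monom (\<gamma> ^ n) (n * d)"
    by (simp add: coeff_0_power monom_power mult.commute)
  then show "cf ((X2 + const2 \<gamma> * X1 ^ d) ^ n) (n * d) 0 = \<gamma> ^ n" unfolding eq by simp
qed

lemma lead_cf:
  assumes "lead d n c \<gamma> f" "0 < d"
  shows "cf f 0 n = c" "cf f (n * d) 0 = c * \<gamma> ^ n"
proof -
  let ?h = "wcomp 1 (int d) (int (n * d)) f"
  have "cf ?h 0 n = cf f 0 n" "cf ?h (n * d) 0 = cf f (n * d) 0" by (simp_all add: cf_wcomp)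
  then show "cf f 0 n = c" "cf f (n * d) 0 = c * \<gamma> ^ n"
    using assms cf_lead_form[OF assms(2), of \<gamma> n] unfolding lead_def by (auto simp: cf_const2_mult)
qed

lemma lead_deg:
  fixes f :: "'a::idom poly poly"
  assumes l: "lead d n c \<gamma> f" and "0 < d" "c \<noteq> 0"
  shows "deg_x2 f = n" and "\<gamma> \<noteq> 0 \<Longrightarrow> deg_x1 f = n * d"
proof -
  have w: "int i + int d * int j \<le> int (n * d)" if "cf f i j \<noteq> 0" for i j
  proof -
    have "wle 1 (int d) (int (n * d)) f" using l by (simp only: lead_def)
    from wleD[OF this that] show ?thesis by simp
  qed
  have w': "i + d * j \<le> n * d" if "cf f i j \<noteq> 0" for i j
    using w[OF that] by (simp flip: of_nat_mult of_nat_add)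
  have "deg_x2 f \<le> n" unfolding deg_x2_le_iff
    using w' \<open>0 < d\<close> by (metis add_leE mult.commute mult_le_cancel1)
  moreover have "n \<le> deg_x2 f" using lead_cf[OF l \<open>0 < d\<close>] \<open>c \<noteq> 0\<close> by (intro cf_le_deg_x2) auto
  ultimately show "deg_x2 f = n" by simp
  assume "\<gamma> \<noteq> 0"
  have "deg_x1 f \<le> n * d" unfolding deg_x1_le_iff using w' add_leD1 by blast
  moreover have "n * d \<le> deg_x1 f" using lead_cf[OF l \<open>0 < d\<close>] \<open>c \<noteq> 0\<close> \<open>\<gamma> \<noteq> 0\<close> by (intro cf_le_deg_x1[of f 0]) auto
  ultimately show "deg_x1 f = n * d" by simp
qed

subsection \<open>Locally nilpotent derivations\<close>

locale derivation =
  fixes D :: "'b::{idom, ring_char_0} \<Rightarrow> 'b"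
  assumes D_add: "D (x + y) = D x + D y" and D_mult: "D (x * y) = x * D y + D x * y"
begin

lemma D_0 [simp]: "D 0 = 0"
  using D_add[of 0 0] by simp

lemma pow_add: "(D ^^ k) (x + y) = (D ^^ k) x + (D ^^ k) y"
  by (induction k) (auto simp: D_add)

lemma pow_0 [simp]: "(D ^^ k) 0 = 0"
  by (induction k) auto

lemma D_1 [simp]: "D 1 = 0"
  using D_mult[of 1 1] by simp

lemma D_of_nat [simp]: "D (of_nat n) = 0"
  by (induction n) (auto simp: D_add)

text \<open>Of the Leibniz expansion of D^(a+b)(x y) only the term with a derivatives on x and b on
  y survives. The induction peels off one derivative and adds the two contributions by Pascal's
  rule. In characteristic 0 the binomial coefficient is nonzero, which makes degrees
  additive.\<close>

lemma pow_mult_top: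
  assumes "(D ^^ Suc a) x = 0" "(D ^^ Suc b) y = 0"
  shows "(D ^^ (a + b)) (x * y) = of_nat ((a + b) choose a) * ((D ^^ a) x * (D ^^ b) y)"
  using assms
proof (induction "a + b" arbitrary: a b x y)
  case 0
  then show ?case by simp
next
  case (Suc m)
  have 1: "(D ^^ m) (D x * y) = of_nat (if a = 0 then 0 else m choose (a - 1)) * ((D ^^ a) x * (D ^^ b) y)"
  proof (cases a)
    case 0
    then show ?thesis using Suc.prems by simp
  next
    case (Suc a')
    then have "(D ^^ (a' + b)) (D x * y) = of_nat ((a' + b) choose a') * ((D ^^ a') (D x) * (D ^^ b) y)"
      using Suc.prems \<open>Suc m = a + b\<close> by (intro Suc.hyps(1)) (auto simp del: funpow.simps simp: funpow_Suc_right)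
    then show ?thesis using Suc \<open>Suc m = a + b\<close> by (simp del: funpow.simps add: funpow_Suc_right)
  qed
  have 2: "(D ^^ m) (x * D y) = of_nat (if b = 0 then 0 else m choose a) * ((D ^^ a) x * (D ^^ b) y)"
  proof (cases b)
    case 0
    then show ?thesis using Suc.prems by simp
  next
    case (Suc b')
    then have "(D ^^ (a + b')) (x * D y) = of_nat ((a + b') choose a) * ((D ^^ a) x * (D ^^ b') (D y))"
      using Suc.prems \<open>Suc m = a + b\<close> by (intro Suc.hyps(1)) (auto simp del: funpow.simps simp: funpow_Suc_right)
    then show ?thesis using Suc \<open>Suc m = a + b\<close> by (simp del: funpow.simps add: funpow_Suc_right)
  qed
  have 3: "(if a = 0 then 0 else m choose (a - 1)) + (if b = 0 then 0 else m choose a) = (Suc m choose a)"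
    using \<open>Suc m = a + b\<close> by (cases a; cases b) auto
  have "(D ^^ Suc m) (x * y) = (D ^^ m) (x * D y) + (D ^^ m) (D x * y)"
    by (simp del: funpow.simps add: funpow_Suc_right D_mult pow_add)
  also have "\<dots> = of_nat (Suc m choose a) * ((D ^^ a) x * (D ^^ b) y)"
    unfolding 1 2 3[symmetric] of_nat_add by (simp add: algebra_simps)
  finally show ?case using \<open>Suc m = a + b\<close> by simp
qed

lemma pow_mult_zero:
  assumes "(D ^^ Suc a) x = 0" "(D ^^ Suc b) y = 0"
  shows "(D ^^ Suc (a + b)) (x * y) = 0"
  using assms by (simp add: pow_mult_top[OF assms] D_mult)

lemma pow_zero_mono: "(D ^^ k) x = 0 \<Longrightarrow> k \<le> l \<Longrightarrow> (D ^^ l) x = 0"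
  by (metis funpow_add le_add_diff_inverse2 o_apply pow_0)

lemma nilpotent_mult: "\<exists>k. (D ^^ k) x = 0 \<Longrightarrow> \<exists>k. (D ^^ k) y = 0 \<Longrightarrow> \<exists>k. (D ^^ k) (x * y) = 0"
  using pow_mult_zero pow_zero_mono by (metis le_SucI order_refl)

lemma nilpotent_add: "\<exists>k. (D ^^ k) x = 0 \<Longrightarrow> \<exists>k. (D ^^ k) y = 0 \<Longrightarrow> \<exists>k. (D ^^ k) (x + y) = 0"
  using pow_zero_mono by (metis add_0 nat_le_linear pow_add)

end

locale lnd = derivation D for D :: "'b::{idom, ring_char_0} \<Rightarrow> 'b" +
  assumes nilpotent: "\<exists>k. (D ^^ k) x = 0"
begin

text \<open>The degree function of a locally nilpotent derivation, for which D behaves like d/dt on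
  polynomials in t. Zero gets the degree 0, so additivity on products is available for nonzero
  factors only.\<close>

definition dg :: "'b \<Rightarrow> nat" where "dg x = (LEAST k. (D ^^ Suc k) x = 0)"

lemma pow_Suc_dg: "(D ^^ Suc (dg x)) x = 0"
proof -
  have "\<exists>k. (D ^^ Suc k) x = 0" using nilpotent pow_zero_mono by (meson le_SucI order_refl)
  then show ?thesis unfolding dg_def by (rule LeastI_ex)
qed

lemma dg_le_iff: "dg x \<le> K \<longleftrightarrow> (D ^^ Suc K) x = 0"
  using pow_Suc_dg[of x] pow_zero_mono[of "Suc (dg x)" x "Suc K"] Least_le[of "\<lambda>k. (D ^^ Suc k) x = 0" K]
  unfolding dg_def by auto

lemma pow_dg: "x \<noteq> 0 \<Longrightarrow> (D ^^ dg x) x \<noteq> 0"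
proof (cases "dg x")
  case (Suc k)
  then show ?thesis using dg_le_iff[of x k] by auto
qed simp

lemma dg_eqI: "(D ^^ k) x \<noteq> 0 \<Longrightarrow> (D ^^ Suc k) x = 0 \<Longrightarrow> dg x = k"
  by (meson antisym dg_le_iff not_less_eq_eq pow_Suc_dg pow_zero_mono)

lemma dg_mult: "x \<noteq> 0 \<Longrightarrow> y \<noteq> 0 \<Longrightarrow> dg (x * y) = dg x + dg y"
proof (rule dg_eqI)
  assume "x \<noteq> 0" "y \<noteq> 0"
  then show "(D ^^ (dg x + dg y)) (x * y) \<noteq> 0"
    unfolding pow_mult_top[OF pow_Suc_dg pow_Suc_dg] using pow_dg[of x] pow_dg[of y] by simp
qed (rule pow_mult_zero[OF pow_Suc_dg pow_Suc_dg])

lemma dg_mult_le: "dg (x * y) \<le> dg x + dg y"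
  unfolding dg_le_iff by (rule pow_mult_zero[OF pow_Suc_dg pow_Suc_dg])

lemma dg_1 [simp]: "dg 1 = 0"
  by (rule dg_eqI) auto

lemma dg_0 [simp]: "dg 0 = 0"
  using dg_le_iff[of 0 0] by simp

lemma dg_power: "x \<noteq> 0 \<Longrightarrow> dg (x ^ n) = n * dg x"
  by (induction n) (auto simp: dg_mult)

lemma dg_add_le: "dg x \<le> K \<Longrightarrow> dg y \<le> K \<Longrightarrow> dg (x + y) \<le> K"
  unfolding dg_le_iff by (simp add: pow_add D_add)

lemma dg_sum_le: "(\<And>i. i \<in> A \<Longrightarrow> dg (F i) \<le> K) \<Longrightarrow> dg (sum F A) \<le> K"
  by (induction A rule: infinite_finite_induct) (auto intro: dg_add_le)

lemma dg_D: "D x \<noteq> 0 \<Longrightarrow> dg x = Suc (dg (D x))"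
  using pow_dg[of "D x"] pow_Suc_dg[of "D x"]
  by (intro dg_eqI) (simp_all del: funpow.simps add: funpow_Suc_right)

lemma dg_eq_0_iff: "dg x = 0 \<longleftrightarrow> D x = 0"
  using dg_le_iff[of x 0] by simp

lemma dg_uminus: "dg (- x) = dg x"
proof -
  have "dg (- 1) = 0" using D_add[of 1 "- 1"] by (simp add: dg_eq_0_iff)
  then show ?thesis using dg_mult[of "- 1" x] by (cases "x = 0") auto
qed

lemma dg_add_eq:
  assumes "dg y < dg x" shows "dg (x + y) = dg x"
proof (rule dg_eqI)
  have "(D ^^ dg x) y = 0" using assms pow_zero_mono[OF pow_Suc_dg[of y], of "dg x"] by simp
  moreover have "x \<noteq> 0" using assms by auto
  ultimately show "(D ^^ dg x) (x + y) \<noteq> 0" using pow_dg by (simp add: pow_add)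
  show "(D ^^ Suc (dg x)) (x + y) = 0"
    unfolding dg_le_iff[symmetric] using assms by (intro dg_add_le) auto
qed

text \<open>A strictly dominant summand cannot be cancelled. Applied to the monomials of a form of
  degree 0, this excludes a unique monomial of largest positive degree.\<close>

lemma dg_sum_eq:
  assumes "finite A" "a \<in> A" "\<And>b. b \<in> A \<Longrightarrow> b \<noteq> a \<Longrightarrow> dg (F b) < dg (F a)"
  shows "dg (sum F A) = dg (F a)"
proof (cases "A = {a}")
  case False
  then obtain b where "b \<in> A" "b \<noteq> a" using assms(2) by blast
  from assms(3)[OF this] have "0 < dg (F a)" by simp
  moreover have "dg (sum F (A - {a})) \<le> dg (F a) - 1"
  proof (rule dg_sum_le)
    fix b assume "b \<in> A - {a}"
    then show "dg (F b) \<le> dg (F a) - 1" using assms(3)[of b] by simp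
  qed
  ultimately show ?thesis using assms(1,2) by (subst sum.remove[of A a]) (auto intro: dg_add_eq)
qed simp

lemma dg_dvd_le: "x dvd y \<Longrightarrow> y \<noteq> 0 \<Longrightarrow> dg x \<le> dg y"
  by (auto simp: dg_mult elim!: dvdE)

end

subsection \<open>The Jacobian derivation\<close>

definition d1 :: "'a::field_char_0 poly poly \<Rightarrow> 'a poly poly" where "d1 = map_poly pderiv"
definition d2 :: "'a::field_char_0 poly poly \<Rightarrow> 'a poly poly" where "d2 = pderiv"
definition jac :: "'a::field_char_0 poly poly \<Rightarrow> 'a poly poly \<Rightarrow> 'a poly poly" where
  "jac f h = d1 f * d2 h - d2 f * d1 h"

lemma cf_d1: "cf (d1 p) i j = of_nat (Suc i) * cf p (Suc i) j"
  by (simp add: d1_def coeff_map_poly coeff_pderiv)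

lemma cf_d2: "cf (d2 p) i j = of_nat (Suc j) * cf p i (Suc j)"
  by (simp add: d2_def coeff_pderiv of_nat_poly del: of_nat_Suc)

lemma d1_pCons: "d1 (pCons a p) = pCons (pderiv a) (d1 p)"
  by (simp add: d1_def map_poly_pCons)

lemma d1_0 [simp]: "d1 0 = 0" by (simp add: d1_def)
lemma d2_0 [simp]: "d2 0 = 0" by (simp add: d2_def)

lemma d1_add [simp]: "d1 (p + q) = d1 p + d1 q"
  by (intro poly2_eqI) (simp add: cf_d1 algebra_simps)

lemma d2_add [simp]: "d2 (p + q) = d2 p + d2 q"
  by (simp add: d2_def pderiv_add)

lemma d1_smult: "d1 (smult c q) = smult (pderiv c) q + smult c (d1 q)"
  by (intro poly_eqI) (simp add: d1_def coeff_map_poly pderiv_mult algebra_simps)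

lemma d1_mult [simp]: "d1 (p * q) = p * d1 q + d1 p * q"
  by (induction p) (simp_all add: d1_pCons d1_smult algebra_simps)

lemma d2_mult [simp]: "d2 (p * q) = p * d2 q + d2 p * q"
  by (simp add: d2_def pderiv_mult algebra_simps)

lemma d1_X1 [simp]: "d1 X1 = 1" and d2_X1 [simp]: "d2 X1 = 0"
  and d1_X2 [simp]: "d1 X2 = 0" and d2_X2 [simp]: "d2 X2 = 1"
  by (simp_all add: X1_def X2_def d1_def d2_def map_poly_pCons pderiv_pCons one_pCons)

lemma d1_const2 [simp]: "d1 (const2 c) = 0" and d2_const2 [simp]: "d2 (const2 c) = 0"
  by (simp_all add: const2_def d1_def d2_def map_poly_pCons pderiv_pCons)

lemma derivation_jac: "derivation (jac f)"
  by unfold_locales (simp_all add: jac_def algebra_simps)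

lemma d1_subst2: "d1 (subst2 p (P, Q)) = subst2 (d1 p) (P, Q) * d1 P + subst2 (d2 p) (P, Q) * d1 Q"
  by (induction p rule: poly2_induct) (simp_all add: algebra_simps)

lemma d2_subst2: "d2 (subst2 p (P, Q)) = subst2 (d1 p) (P, Q) * d2 P + subst2 (d2 p) (P, Q) * d2 Q"
  by (induction p rule: poly2_induct) (simp_all add: algebra_simps)

lemma jac_subst2: "jac f (subst2 p (P, Q)) = subst2 (d1 p) (P, Q) * jac f P + subst2 (d2 p) (P, Q) * jac f Q"
  by (simp add: jac_def d1_subst2 d2_subst2 algebra_simps)

lemma jac_subst2_subst2:
  "jac (subst2 p (P, Q)) (subst2 q (P, Q)) = subst2 (jac p q) (P, Q) * jac P Q"
  by (simp add: jac_def d1_subst2 d2_subst2 algebra_simps)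

lemma dvd_1_imp_const2:
  fixes p :: "'a::field poly poly"
  assumes "p dvd 1"
  shows "\<exists>c. c \<noteq> 0 \<and> p = const2 c"
proof -
  obtain a where a: "p = [:a:]" "a dvd 1" using assms is_unit_poly_iff[of p] by auto
  then obtain c where "a = [:c:]" "c dvd 1" using is_unit_poly_iff[of a] by auto
  then show ?thesis using a by (auto simp: const2_def)
qed

definition aut :: "'a::field poly poly \<times> 'a poly poly \<Rightarrow> bool" where
  "aut \<phi> \<longleftrightarrow> (\<exists>\<psi>. comp2 \<phi> \<psi> = id2 \<and> comp2 \<psi> \<phi> = id2)"

lemma is_aut_UNIV: "is_aut UNIV \<phi> \<longleftrightarrow> aut \<phi>"
  by (simp add: is_aut_def aut_def in_R_def)

text \<open>The chain rule, applied to an inverse pair, exhibits the Jacobian as a divisor of 1, and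
  the units of the polynomial ring are the nonzero constants.\<close>

lemma jac_aut:
  fixes f g :: "'a::field_char_0 poly poly"
  assumes "aut (f, g)"
  shows "\<exists>c. c \<noteq> 0 \<and> jac f g = const2 c"
proof -
  obtain P Q where "comp2 (f, g) (P, Q) = id2" using assms by (auto simp: aut_def)
  then have "subst2 P (f, g) = X1" "subst2 Q (f, g) = X2" by (simp_all add: comp2_def id2_def)
  then have "1 = subst2 (jac P Q) (f, g) * jac f g"
    using jac_subst2_subst2[of P f g Q] by (simp add: jac_def)
  then have "jac f g dvd 1" by (metis dvd_triv_right)
  then show ?thesis by (rule dvd_1_imp_const2)
qed

text \<open>In the coordinates f, g the derivation is a constant times the partial derivative with
  respect to g, hence nilpotent on every polynomial.\<close>

lemma lnd_jac:
  fixes f g :: "'a::field_char_0 poly poly"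
  assumes "aut (f, g)"
  shows "lnd (jac f)"
proof -
  interpret derivation "jac f" by (rule derivation_jac)
  obtain c where c: "jac f g = const2 c" using jac_aut[OF assms] by auto
  obtain P Q where PQ: "comp2 (f, g) (P, Q) = id2" using assms by (auto simp: aut_def)
  have ff: "jac f f = 0" by (simp add: jac_def)
  have pow: "(jac f ^^ k) (subst2 p (f, g)) = const2 c ^ k * subst2 ((d2 ^^ k) p) (f, g)" for k p
  proof (induction k)
    case (Suc k)
    have "jac f (const2 c ^ k) = 0" unfolding const2_power[symmetric] by (simp add: jac_def)
    then show ?case using Suc by (simp add: D_mult jac_subst2 ff c algebra_simps)
  qed simp
  have deg: "degree ((d2 ^^ k) p) \<le> degree p - k" for k and p :: "'a poly poly"
    by (induction k) (auto simp: d2_def degree_pderiv)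
  have "(d2 ^^ Suc (degree p)) p = 0" for p :: "'a poly poly"
  proof -
    have "degree ((d2 ^^ degree p) p) = 0" using deg[of "degree p" p] by simp
    then show ?thesis by (simp add: d2_def pderiv_eq_0_iff)
  qed
  then have "(jac f ^^ Suc (degree p)) (subst2 p (f, g)) = 0" for p
    by (subst pow) simp
  moreover have "subst2 (subst2 p (P, Q)) (f, g) = p" for p
    using PQ by (simp add: subst2_subst2)
  ultimately show ?thesis by unfold_locales metis
qed

lemma wcomp_d1: "wcomp a b (N - a) (d1 p) = d1 (wcomp a b N p)"
  by (intro poly2_eqI) (auto simp: cf_wcomp cf_d1 algebra_simps)

lemma wcomp_d2: "wcomp a b (N - b) (d2 p) = d2 (wcomp a b N p)"
  by (intro poly2_eqI) (auto simp: cf_wcomp cf_d2 algebra_simps)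

lemma wle_d1:
  assumes "wle a b N p" shows "wle a b (N - a) (d1 p)"
proof (rule wleI)
  fix i j assume "cf (d1 p) i j \<noteq> 0"
  then have "cf p (Suc i) j \<noteq> 0" by (auto simp: cf_d1)
  from wleD[OF assms this] show "a * int i + b * int j \<le> N - a" by (simp add: algebra_simps)
qed

lemma wle_d2:
  assumes "wle a b N p" shows "wle a b (N - b) (d2 p)"
proof (rule wleI)
  fix i j assume "cf (d2 p) i j \<noteq> 0"
  then have "cf p i (Suc j) \<noteq> 0" by (auto simp: cf_d2)
  from wleD[OF assms this] show "a * int i + b * int j \<le> N - b" by (simp add: algebra_simps)
qed

lemma wle_diff: "wle a b N p \<Longrightarrow> wle a b N q \<Longrightarrow> wle a b N (p - q)"
  using wle_add[of a b N p "const2 (- 1) * q"] wle_const2_mult[of a b N q "- 1"] by simp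

lemma jac_wcomp:
  assumes "wle a b N f" "wle a b M h"
  shows "wle a b (M + (N - a - b)) (jac f h)"
    and "wcomp a b (M + (N - a - b)) (jac f h) = jac (wcomp a b N f) (wcomp a b M h)"
proof -
  have eq: "M + (N - a - b) = (N - a) + (M - b)" "M + (N - a - b) = (N - b) + (M - a)" by simp_all
  note w = wle_d1[OF assms(1)] wle_d2[OF assms(2)] wle_d2[OF assms(1)] wle_d1[OF assms(2)]
  show "wle a b (M + (N - a - b)) (jac f h)" unfolding jac_def
    using wle_mult[OF w(1,2), folded eq(1)] wle_mult[OF w(3,4), folded eq(2)] by (intro wle_diff)
  show "wcomp a b (M + (N - a - b)) (jac f h) = jac (wcomp a b N f) (wcomp a b M h)" unfolding jac_def
    using wcomp_mult[OF w(1,2), folded eq(1)] wcomp_mult[OF w(3,4), folded eq(2)]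
    by (simp add: wcomp_d1 wcomp_d2)
qed

lemma jac_pow_wcomp:
  assumes "wle a b N f" "wle a b M h"
  shows "wle a b (M + int k * (N - a - b)) ((jac f ^^ k) h)
    \<and> wcomp a b (M + int k * (N - a - b)) ((jac f ^^ k) h) = (jac (wcomp a b N f) ^^ k) (wcomp a b M h)"
proof (induction k)
  case (Suc k)
  then show ?case
    using jac_wcomp[OF assms(1), of "M + int k * (N - a - b)" "(jac f ^^ k) h"] by (simp add: algebra_simps)
qed (use assms in simp)

text \<open>Iterating the derivation of the top form on a homogeneous h gives the component at the
  expected weight of the iterates for f, and those vanish eventually. Constants and variables are
  homogeneous for any weights, and the elements killed by some iterate form a subring.\<close>

lemma lnd_jac_wcomp:
  assumes "lnd (jac f)" "wle a b N f"
  shows "lnd (jac (wcomp a b N f))"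
proof -
  interpret f: lnd "jac f" by fact
  interpret derivation "jac (wcomp a b N f)" by (rule derivation_jac)
  have nil: "\<exists>k. (jac (wcomp a b N f) ^^ k) h = 0" if "wle a b M h" "wcomp a b M h = h" for M h
  proof -
    obtain k where "(jac f ^^ k) h = 0" using f.nilpotent by blast
    then show ?thesis using jac_pow_wcomp[OF assms(2) that(1), of k] that(2) by auto
  qed
  have "\<exists>k. (jac (wcomp a b N f) ^^ k) h = 0" for h
  proof (induction h rule: poly2_induct)
    case (const c)
    show ?case by (rule nil[of 0]) (auto simp: wle_const2 wcomp_const2)
  next
    case X1
    show ?case by (rule nil[of a]) (auto simp: wle_X1 wcomp_X1)
  next
    case X2
    show ?case by (rule nil[of b]) (auto simp: wle_X2 wcomp_X2)
  qed (rule nilpotent_add nilpotent_mult; assumption)+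
  then show ?thesis by unfold_locales
qed

subsection \<open>Leading forms of coordinates\<close>

lemma X2_dvd: "(\<And>i. cf p i 0 = 0) \<Longrightarrow> X2 dvd p"
  by (metis X2_def coeff_0 poly_0_coeff_0 poly_eqI poly_eq_0_iff_dvd minus_zero)

lemma X1_power_dvd:
  fixes p :: "'a::comm_ring_1 poly poly"
  assumes "\<And>i j. cf p i j \<noteq> 0 \<Longrightarrow> k \<le> i"
  shows "X1 ^ k dvd p"
proof -
  have "X1 ^ k dvd const2 (cf p i j) * (X1 ^ i * X2 ^ j)" if "(i, j) \<in> supp2 p" for i j
    using assms[of j i] that by (intro dvd_mult dvd_mult2 le_imp_power_dvd) auto
  then show ?thesis by (subst supp2_expand[of p]) (auto intro!: dvd_sum)
qed

lemma X1_neq_0 [simp]: "X1 \<noteq> (0::'a::comm_ring_1 poly poly)" and X2_neq_0 [simp]: "X2 \<noteq> (0::'a poly poly)"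
  by (simp_all add: X1_def X2_def)

lemma ex_max_weight:
  assumes "f \<noteq> 0"
  shows "\<exists>N. wle a b N f \<and> wcomp a b N f \<noteq> 0"
proof -
  let ?W = "(\<lambda>(i, j). a * int i + b * int j) ` supp2 f"
  have "supp2 f \<noteq> {}" using assms by (metis all_not_in_conv in_supp2 poly2_eqI coeff_0 surj_pair)
  then have "Max ?W \<in> ?W" by (intro Max_in) auto
  then obtain i j where ij: "cf f i j \<noteq> 0" "Max ?W = a * int i + b * int j" by auto
  have "wle a b (Max ?W) f" by (rule wleI, rule Max_ge) force+
  moreover have "cf (wcomp a b (Max ?W) f) i j \<noteq> 0" using ij by (simp add: cf_wcomp)
  then have "wcomp a b (Max ?W) f \<noteq> 0" by (metis coeff_0)
  ultimately show ?thesis by blast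
qed

text \<open>The kernel is factorially closed, so it would contain both variables.\<close>
lemma lnd_jac_mixed:
  fixes F :: "'a::field_char_0 poly poly"
  assumes lnd: "lnd (jac F)" and "F \<noteq> 0"
    and mixed: "\<And>i j. cf F i j \<noteq> 0 \<Longrightarrow> 1 \<le> i \<and> 1 \<le> j"
  shows False
proof -
  interpret lnd "jac F" by fact
  have "X1 dvd F" using X1_power_dvd[of F 1] mixed by simp
  moreover have "X2 dvd F" using mixed by (intro X2_dvd) (metis not_one_le_zero)
  moreover have "dg F = 0" by (simp add: dg_eq_0_iff jac_def)
  ultimately have "dg X1 = 0" "dg X2 = 0" using dg_dvd_le \<open>F \<noteq> 0\<close> by (metis le_zero_eq)+
  then have "d1 F = 0" by (simp add: dg_eq_0_iff jac_def)
  moreover obtain i j where ij: "cf F i j \<noteq> 0" using \<open>F \<noteq> 0\<close> by (metis poly2_eqI coeff_0)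
  ultimately have "of_nat (Suc (i - 1)) * cf F (Suc (i - 1)) j = 0"
    using cf_d1[of F j "i - 1"] by simp
  then show False using ij mixed[OF ij] by (simp del: of_nat_Suc)
qed

text \<open>Under a triangular substitution only the two highest coefficients in X2 are ever needed:
  the top one is merely rescaled, and the next one receives n times the shift. With n as a bound for
  the degree the induction passes to \<open>pCons\<close> tails.\<close>

lemma shift_coeff:
  fixes f :: "'a::comm_ring_1 poly poly" and l q v
  assumes "degree f \<le> n"
  defines "S \<equiv> \<lambda>f. subst2 f (lift1 l, const2 v * X2 + lift1 q)"
  shows "degree (S f) \<le> n \<and> coeff (S f) n = smult (v ^ n) (pcompose (coeff f n) l) \<and>
     (0 < n \<longrightarrow> coeff (S f) (n - 1)
       = smult (v ^ (n - 1)) (pcompose (coeff f (n - 1)) l + of_nat n * (pcompose (coeff f n) l * q)))"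
  using assms(1)
proof (induction n arbitrary: f)
  case 0
  then obtain a where "f = [:a:]" using degree_eq_zeroE[of f] by auto
  then show ?case by (simp add: S_def subst2_pCons ev_lift1) (simp add: lift1_def)
next
  case (Suc n)
  obtain a g where f: "f = pCons a g" by (cases f)
  have "degree g \<le> n" using Suc.prems by (cases "g = 0") (auto simp: f)
  note IH = Suc.IH[OF this]
  have S: "S f = lift1 (pcompose a l) + [:q, [:v:]:] * S g"
    by (simp add: S_def f subst2_pCons ev_lift1) (simp add: lift1_def const2_def X2_def)
  have co: "coeff (S f) k = (if k = 0 then pcompose a l else 0) + q * coeff (S g) k
     + (if k = 0 then 0 else smult v (coeff (S g) (k - 1)))" for k
    unfolding S by (simp add: lift1_def coeff_pCons split: nat.splits)
  have 0: "coeff (S g) k = 0" if "n < k" for k using IH that by (auto intro: coeff_eq_0)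
  have "degree (S f) \<le> Suc n" by (rule degree_le) (auto simp: co 0)
  moreover have "coeff (S f) (Suc n) = smult (v ^ Suc n) (pcompose (coeff f (Suc n)) l)"
    unfolding co using IH by (simp add: 0 f)
  moreover have "coeff (S f) n = smult (v ^ n) (pcompose (coeff f n) l + of_nat (Suc n) * (pcompose (coeff f (Suc n)) l * q))"
  proof (cases n)
    case 0
    then show ?thesis unfolding co using IH by (simp add: f algebra_simps)
  next
    case (Suc k)
    then show ?thesis unfolding co using IH by (simp add: f algebra_simps smult_add_right)
  qed
  ultimately show ?case by simp
qed

lemma lift1_X: "lift1 [:0, 1:] = X1"
  by (simp add: lift1_def X1_def)

lemma lift1_monom: "lift1 (monom c n) = const2 c * X1 ^ n"
  by (induction n) (simp_all add: monom_0 lift1_const monom_Suc lift1_pCons algebra_simps)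

lemma coordinate_lead:
  fixes f :: "'a::field_char_0 poly poly"
  assumes aut: "aut (f, g)" and n: "1 \<le> deg_x2 f" and mn: "deg_x2 f \<le> deg_x1 f"
  shows "\<exists>d c \<gamma>. 0 < d \<and> c \<noteq> 0 \<and> \<gamma> \<noteq> 0 \<and> lead d (deg_x2 f) c \<gamma> f"
proof -
  define m n where "m = deg_x1 f" and "n = deg_x2 f"
  have pos: "1 \<le> n" "n \<le> m" "1 \<le> m" using assms by (auto simp: m_def n_def)
  have "f \<noteq> 0" using pos by (auto simp: n_def deg_x2_def)
  \<comment> \<open>With weight n on X1 and weight m on X2, the two corners X1^m and X2^n both have
    weight N.\<close>
  define N where "N = int (n * m)"
  have bd: "i \<le> m" "j \<le> n" if "cf f i j \<noteq> 0" for i j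
    using that cf_le_deg_x1 cf_le_deg_x2 by (auto simp: m_def n_def)
  have W: "wle n m N f"
  proof -
    obtain M where M: "wle n m M f" "wcomp n m M f \<noteq> 0" using ex_max_weight[OF \<open>f \<noteq> 0\<close>] by blast
    \<comment> \<open>Pure powers in f have exponent at most m or n and hence weight at most N, so a
      form of larger weight has only mixed monomials.\<close>
    have "M \<le> N"
    proof (rule ccontr)
      assume "\<not> M \<le> N"
      interpret lnd "jac (wcomp n m M f)" by (rule lnd_jac_wcomp[OF lnd_jac[OF aut] M(1)])
      show False
      proof (rule lnd_jac_mixed[OF _ M(2)])
        show "lnd (jac (wcomp (int n) (int m) M f))" by unfold_locales
        fix i j assume "cf (wcomp n m M f) i j \<noteq> 0"
        then have ij: "int n * int i + int m * int j = M" "cf f i j \<noteq> 0" by (auto simp: cf_wcomp split: if_splits)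
        have "n * m < n * i + m * j"
          using ij(1) \<open>\<not> M \<le> N\<close> unfolding N_def by (simp flip: of_nat_mult of_nat_add)
        moreover have "n * i \<le> n * m" "m * j \<le> n * m" using bd[OF ij(2)] by (auto simp: mult.commute)
        ultimately show "1 \<le> i \<and> 1 \<le> j" by (cases i; cases j) auto
      qed
    qed
    then show ?thesis using M(1) wle_mono by blast
  qed
  define F where "F = wcomp n m N f"
  interpret lnd "jac F" unfolding F_def by (rule lnd_jac_wcomp[OF lnd_jac[OF aut] W])
  have cfF: "n * i + m * j = n * m \<and> i \<le> m \<and> j \<le> n \<and> cf f i j \<noteq> 0" if "cf F i j \<noteq> 0" for i j
    using that bd unfolding F_def N_def
    by (auto simp: cf_wcomp simp flip: of_nat_mult of_nat_add split: if_splits)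
  have cfF_eq: "cf F i j = cf f i j" if "n * i + m * j = n * m" for i j
    using that by (simp add: F_def N_def cf_wcomp flip: of_nat_mult of_nat_add)
  have m0: "cf F m 0 \<noteq> 0"
  proof -
    obtain j where j: "cf f m j \<noteq> 0" using deg_x1_attained[OF \<open>f \<noteq> 0\<close>] by (auto simp: m_def)
    have "int n * int m + int m * int j \<le> N" using wleD[OF W j] .
    then have "n * m + m * j \<le> n * m" unfolding N_def by (simp flip: of_nat_mult of_nat_add)
    then have "j = 0" using pos by simp
    then show ?thesis using j by (simp add: cfF_eq)
  qed
  have n0: "cf F 0 n \<noteq> 0"
  proof -
    obtain i where i: "cf f i n \<noteq> 0" using deg_x2_attained[OF \<open>f \<noteq> 0\<close>] by (auto simp: n_def)
    have "int n * int i + int m * int n \<le> N" using wleD[OF W i] .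
    then have "n * i + m * n \<le> n * m" unfolding N_def by (simp flip: of_nat_mult of_nat_add)
    then have "i = 0" using pos by (simp add: mult.commute)
    then show ?thesis using i by (simp add: cfF_eq mult.commute)
  qed
  have DX1: "jac F X1 = - d2 F" and DX2: "jac F X2 = d1 F" by (simp_all add: jac_def)
  have d1F: "d1 F \<noteq> 0"
  proof
    assume "d1 F = 0"
    then show False using cf_d1[of F 0 "m - 1"] m0 pos by (simp del: of_nat_Suc)
  qed
  have d2F: "d2 F \<noteq> 0"
  proof
    assume "d2 F = 0"
    then show False using cf_d2[of F "n - 1" 0] n0 pos by (simp del: of_nat_Suc)
  qed
  \<comment> \<open>The degrees of the variables for the derivation of F; both are positive because
    both partial derivatives of F are nonzero.\<close>
  define k1 k2 where "k1 = dg X1" and "k2 = dg X2"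
  have k1: "k1 = Suc (dg (d2 F))" unfolding k1_def using dg_D[of X1] d2F DX1 by (simp add: dg_uminus)
  have k2: "k2 = Suc (dg (d1 F))" unfolding k2_def using dg_D[of X2] d1F DX2 by simp
  have dgF: "dg F = 0" by (simp add: dg_eq_0_iff jac_def)
  have const: "dg (const2 c) = 0" for c by (simp add: dg_eq_0_iff jac_def)
  have dgm: "dg (const2 c * (X1 ^ i * X2 ^ j)) = i * k1 + j * k2" if "c \<noteq> 0" for c i j
    using that by (simp add: dg_mult dg_power const k1_def k2_def)
  \<comment> \<open>F lies in the kernel of its own derivation and so has degree 0; no monomial of
    positive degree can dominate all others.\<close>
  have dom: False if ij: "cf F i0 j0 \<noteq> 0" "0 < i0 * k1 + j0 * k2"
     and *: "\<And>i j. cf F i j \<noteq> 0 \<Longrightarrow> (i, j) \<noteq> (i0, j0) \<Longrightarrow> i * k1 + j * k2 < i0 * k1 + j0 * k2" for i0 j0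
  proof -
    have "dg (\<Sum>(i, j)\<in>supp2 F. const2 (cf F i j) * (X1 ^ i * X2 ^ j))
        = dg (case (i0, j0) of (i, j) \<Rightarrow> const2 (cf F i j) * (X1 ^ i * X2 ^ j))"
    proof (rule dg_sum_eq, goal_cases)
      case (3 x)
      obtain i j where x: "x = (i, j)" by (cases x)
      show ?case using 3 *[of j i] ij(1) by (auto simp: x dgm)
    qed (use ij in auto)
    then have "dg F = i0 * k1 + j0 * k2" using ij by (simp add: dgm flip: supp2_expand)
    then show False using dgF ij(2) by linarith
  qed
  \<comment> \<open>On the segment between the corners the degree of a monomial is an affine
    function of its exponent, with end values m * k1 and n * k2. If these differed, one corner would
    dominate.\<close>
  have key: "m * (i * k1 + j * k2) + i * (n * k2) = n * (m * k2) + i * (m * k1)"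
       "n * (i * k1 + j * k2) + j * (m * k1) = n * (m * k1) + j * (n * k2)" if "cf F i j \<noteq> 0" for i j
  proof -
    have e: "n * i + m * j = n * m" using cfF[OF that] by simp
    have "m * (i * k1 + j * k2) + i * (n * k2) = (n * i + m * j) * k2 + i * (m * k1)" by algebra
    then show "m * (i * k1 + j * k2) + i * (n * k2) = n * (m * k2) + i * (m * k1)" by (simp add: e)
    have "n * (i * k1 + j * k2) + j * (m * k1) = (n * i + m * j) * k1 + j * (n * k2)" by algebra
    then show "n * (i * k1 + j * k2) + j * (m * k1) = n * (m * k1) + j * (n * k2)" by (simp add: e)
  qed
  have "\<not> m * k1 < n * k2"
  proof
    assume lt: "m * k1 < n * k2"
    show False
    proof (rule dom[OF n0])
      fix i j assume ij: "cf F i j \<noteq> 0" "(i, j) \<noteq> (0, n)"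
      have "i \<noteq> 0"
      proof
        assume "i = 0"
        then have "m * j = m * n" using cfF[OF ij(1)] by (simp add: mult.commute)
        then show False using ij(2) \<open>i = 0\<close> pos by simp
      qed
      then have "i * (m * k1) < i * (n * k2)" using lt by simp
      moreover have "n * (m * k2) = m * (n * k2)" by simp
      ultimately have "m * (i * k1 + j * k2) < m * (n * k2)" using key(1)[OF ij(1)] by linarith
      then show "i * k1 + j * k2 < 0 * k1 + n * k2" by simp
    qed (use k2 pos in auto)
  qed
  moreover have "\<not> n * k2 < m * k1"
  proof
    assume lt: "n * k2 < m * k1"
    show False
    proof (rule dom[OF m0])
      fix i j assume ij: "cf F i j \<noteq> 0" "(i, j) \<noteq> (m, 0)"
      have "j \<noteq> 0"
      proof
        assume "j = 0"
        then have "n * i = n * m" using cfF[OF ij(1)] by simp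
        then show False using ij(2) \<open>j = 0\<close> pos by simp
      qed
      then have "j * (n * k2) < j * (m * k1)" using lt by simp
      then have "n * (i * k1 + j * k2) < n * (m * k1)" using key(2)[OF ij(1)] by linarith
      then show "i * k1 + j * k2 < m * k1 + 0 * k2" by simp
    qed (use k1 pos in auto)
  qed
  ultimately have mk: "m * k1 = n * k2" by simp
  \<comment> \<open>Without a monomial linear in X2, the derivative \<open>d2 F\<close> would be
    divisible by X2, which gives k2 < k1 against m * k1 = n * k2 and n <= m. The monomial found here
    lies on the segment, and its exponents show that n divides m.\<close>
  have "\<exists>i. cf F i 1 \<noteq> 0"
  proof (rule ccontr)
    assume "\<not> ?thesis"
    then have "X2 dvd d2 F" by (intro X2_dvd) (simp add: cf_d2)
    from dg_dvd_le[OF this d2F] have "k2 < k1" using k1 by (simp add: k2_def)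
    then have "n * k2 < n * k1" using pos by simp
    also have "\<dots> \<le> m * k1" using pos by simp
    finally show False using mk by simp
  qed
  then obtain i1 where "n * i1 + m * 1 = n * m" "i1 \<le> m" using cfF by blast
  then have "m = n * (m - i1)" by (simp add: algebra_simps diff_mult_distrib2)
  then obtain d where d: "m = n * d" by blast
  have "0 < d" using d pos by (cases d) auto
  have kd: "k2 = d * k1" using mk pos unfolding d by simp
  have cfF': "i + d * j = n * d" if "cf F i j \<noteq> 0" for i j
  proof -
    have "n * (i + d * j) = n * (n * d)" using cfF[OF that] by (simp add: d algebra_simps)
    then show ?thesis using pos by simp
  qed
  have wF: "wle 1 (int d) (int (n * d)) F"
  proof (rule wleI)
    fix i j assume "cf F i j \<noteq> 0"
    from cfF'[OF this] show "1 * int i + int d * int j \<le> int (n * d)" by (simp flip: of_nat_mult of_nat_add)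
  qed
  have cF: "wcomp 1 (int d) (int (n * d)) F = F"
  proof (rule poly2_eqI)
    fix i j
    show "cf (wcomp 1 (int d) (int (n * d)) F) i j = cf F i j"
      using cfF'[of j i] by (cases "cf F i j = 0") (auto simp: cf_wcomp simp flip: of_nat_mult of_nat_add)
  qed
  \<comment> \<open>A Tschirnhaus shift: in terms of \<open>y\<close> the form has no monomial with \<open>y ^ (n - 1)\<close>.\<close>
  define c0 where "c0 = cf F 0 n"
  define \<gamma> where "\<gamma> = cf F d (n - 1) / (of_nat n * c0)"
  have c0: "c0 \<noteq> 0" using n0 by (simp add: c0_def)
  define y where "y = X2 + const2 \<gamma> * X1 ^ d"
  define G where "G = subst2 F (X1, X2 + const2 (- \<gamma>) * X1 ^ d)"
  have wQ: "wle 1 (int d) (int d) (X2 + const2 c * X1 ^ d)" for c :: 'a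
    using wle_X2[of 1 "int d"] wle_lift1[of 1 "monom c d" d "int d"]
    by (intro wle_add) (auto simp: lift1_monom degree_monom_le)
  have cQ: "wcomp 1 (int d) (int d) (X2 + const2 c * X1 ^ d) = X2 + const2 c * X1 ^ d" for c :: 'a
    using wcomp_lift1[of 1 "int d" d "monom c d"] by (simp add: wcomp_X2 lift1_monom)
  have cG: "wcomp 1 (int d) (int (n * d)) G = G"
    unfolding G_def by (subst wcomp_subst2[OF wF wle_X1 wQ]) (simp only: cF cQ wcomp_X1)
  have cfG: "i + d * j = n * d" if "cf G i j \<noteq> 0" for i j
  proof -
    have "1 * int i + int d * int j = int (n * d)" using that cf_wcomp[of 1 "int d" "int (n * d)" G j i] unfolding cG
      by (auto split: if_splits)
    then show ?thesis by (simp flip: of_nat_mult of_nat_add)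
  qed
  have "comp2 (X1, y) (X1, X2 + const2 (- \<gamma>) * X1 ^ d) = id2"
    "comp2 (X1, X2 + const2 (- \<gamma>) * X1 ^ d) (X1, y) = id2"
    by (simp_all add: prod_eq_iff y_def)
  then have FG: "F = subst2 G (X1, y)" and inv: "subst2 (subst2 p (X1, y)) (X1, X2 + const2 (- \<gamma>) * X1 ^ d) = p" for p
    by (simp_all add: G_def subst2_subst2)
  have "degree F \<le> n"
    by (rule degree_le) (use cfF in \<open>metis coeff_0 leD poly_eqI\<close>)
  note sh = shift_coeff[OF this, of "[:0, 1:]" 1 "monom (- \<gamma>) d", unfolded lift1_X lift1_monom]
  have Fn: "coeff F n = [:c0:]"
  proof (rule poly_eqI)
    fix i show "cf F i n = coeff [:c0:] i"
      using cfF[of n i] pos by (cases i) (auto simp: c0_def mult.commute)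
  qed
  have Gn: "cf G 0 n = c0" using sh by (simp add: G_def pcompose_idR Fn)
  have "coeff G (n - 1) = coeff F (n - 1) + of_nat n * ([:c0:] * monom (- \<gamma>) d)"
    using sh pos by (simp add: G_def pcompose_idR Fn)
  then have Gd: "cf G d (n - 1) = 0"
    using c0 pos by (simp add: \<gamma>_def of_nat_poly smult_monom)
  have "d2 (X1 ^ k) = (0 :: 'a poly poly)" for k
    using d2_const2[of 1] by (induction k) simp_all
  then have "jac X1 y = 1" by (simp add: jac_def y_def)
  then have Dy: "jac F y = subst2 (d1 G) (X1, y)"
    using jac_subst2_subst2[of G X1 y X2] FG by (simp add: jac_def)
  \<comment> \<open>The image of \<open>y\<close> is divisible by \<open>X1 ^ (2 * d - 1)\<close>, too much for the degree of \<open>y\<close>, which is at most \<open>d * k1\<close>.\<close>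
  have "d1 G = 0"
  proof (rule ccontr)
    assume d1G: "d1 G \<noteq> 0"
    then have ne: "subst2 (d1 G) (X1, y) \<noteq> 0" using inv[of "d1 G"] by auto
    have "X1 ^ (2 * d - 1) dvd d1 G"
    proof (rule X1_power_dvd)
      fix i j assume "cf (d1 G) i j \<noteq> 0"
      then have nz: "cf G (Suc i) j \<noteq> 0" by (auto simp: cf_d1)
      have e: "Suc i + d * j = n * d" using cfG[OF nz] .
      then have "d * j < d * n" using mult.commute[of n d] by linarith
      then have "j < n" using \<open>0 < d\<close> by simp
      moreover have "j \<noteq> n - 1"
      proof
        assume "j = n - 1"
        then have "Suc i = d" using e pos by (cases n) simp_all
        then show False using nz Gd \<open>j = n - 1\<close> by simp
      qed
      ultimately have "j + 2 \<le> n" by simp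
      then have "d * (j + 2) \<le> d * n" by (rule mult_le_mono2)
      moreover have "d * (j + 2) = d * j + 2 * d" by simp
      ultimately have "2 * d \<le> Suc i" using e mult.commute[of n d] by linarith
      then show "2 * d - 1 \<le> i" by simp
    qed
    then obtain r where "d1 G = X1 ^ (2 * d - 1) * r" by (elim dvdE)
    then have "X1 ^ (2 * d - 1) dvd subst2 (d1 G) (X1, y)" by simp
    from dg_dvd_le[OF this ne] have "(2 * d - 1) * k1 \<le> dg (jac F y)" using Dy by (simp add: dg_power k1_def)
    also have "dg (jac F y) < dg y" using dg_D[of y] ne Dy by simp
    also have "dg y \<le> d * k1" unfolding y_def
    proof (rule dg_add_le)
      show "dg (const2 \<gamma> * X1 ^ d) \<le> d * k1"
        using dg_mult_le[of "const2 \<gamma>" "X1 ^ d"] by (simp add: const dg_power k1_def)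
    qed (use kd in \<open>simp add: k2_def\<close>)
    finally have "2 * d - 1 < d" by simp
    then show False using \<open>0 < d\<close> by simp
  qed
  have G0: "i = 0 \<and> j = n" if "cf G i j \<noteq> 0" for i j
  proof -
    have "i = 0"
    proof (rule ccontr)
      assume "i \<noteq> 0"
      then show False using cf_d1[of G j "i - 1"] \<open>d1 G = 0\<close> that by (simp del: of_nat_Suc)
    qed
    then show ?thesis using cfG[OF that] \<open>0 < d\<close> by (simp add: mult.commute)
  qed
  have "G = const2 c0 * X2 ^ n"
  proof (rule poly2_eqI)
    fix i j show "cf G i j = cf (const2 c0 * X2 ^ n) i j"
      using G0[of j i] Gn cf_X1_power_X2_power[where ?'a = 'a, of 0 n j i]
      by (auto simp: cf_const2_mult split: if_splits)
  qed
  then have F: "F = const2 c0 * y ^ n" using FG by simp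
  have "wcomp 1 (int d) (int (n * d)) f = F"
  proof (rule poly2_eqI)
    fix i j
    have "i + d * j = n * d \<longleftrightarrow> n * i + m * j = n * m"
    proof -
      have "n * i + m * j = n * m \<longleftrightarrow> n * (i + d * j) = n * (n * d)" by (simp add: d algebra_simps)
      then show ?thesis using pos by simp
    qed
    then show "cf (wcomp 1 (int d) (int (n * d)) f) i j = cf F i j"
      by (simp add: cf_wcomp F_def N_def flip: of_nat_mult of_nat_add)
  qed
  moreover have "wle 1 (int d) (int (n * d)) f"
  proof (rule wleI)
    fix i j assume "cf f i j \<noteq> 0"
    from wleD[OF W this] have "n * i + m * j \<le> n * m" unfolding N_def by (simp flip: of_nat_mult of_nat_add)
    then have "n * (i + d * j) \<le> n * (n * d)" by (simp add: d algebra_simps)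
    then show "1 * int i + int d * int j \<le> int (n * d)" using pos by (simp flip: of_nat_mult of_nat_add)
  qed
  ultimately have lead: "lead d n c0 \<gamma> f" by (simp add: lead_def F y_def)
  moreover have "\<gamma> \<noteq> 0"
  proof
    assume "\<gamma> = 0"
    then have "cf f m 0 = 0" using lead_cf(2)[OF lead \<open>0 < d\<close>] pos by (simp add: d)
    then show False using m0 cfF_eq[of m 0] by simp
  qed
  ultimately show ?thesis using \<open>0 < d\<close> c0 by (auto simp: n_def)
qed

subsection \<open>Coordinates fixed by an automorphism\<close>

lemma aut_comp2: "aut \<phi> \<Longrightarrow> aut \<psi> \<Longrightarrow> aut (comp2 \<phi> \<psi>)"
  unfolding aut_def by (metis comp2_assoc comp2_id2(1))

lemma autI: "comp2 \<phi> \<psi> = id2 \<Longrightarrow> comp2 \<psi> \<phi> = id2 \<Longrightarrow> aut \<phi>"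
  unfolding aut_def by blast

lemma aut_inverse: "aut \<phi> \<Longrightarrow> \<exists>\<psi>. aut \<psi> \<and> comp2 \<phi> \<psi> = id2 \<and> comp2 \<psi> \<phi> = id2"
  unfolding aut_def by blast

lemma coordinate_iff: "coordinate f \<longleftrightarrow> (\<exists>g. aut (f, g))"
  by (auto simp: coordinate_def is_aut_UNIV)

lemma coordinate_subst2: "coordinate f \<Longrightarrow> aut \<chi> \<Longrightarrow> coordinate (subst2 f \<chi>)"
  unfolding coordinate_iff by (metis aut_comp2 comp2_def fst_conv)

lemma aut_swap: "aut (X2, X1)"
  by (rule autI[of _ "(X2, X1)"]) (simp_all add: comp2_def id2_def)

lemma aut_shear: "aut (X1, X2 + lift1 p)"
  by (rule autI[of _ "(X1, X2 - lift1 p)"]) (simp_all add: comp2_def id2_def subst2_lift1 flip: lift1_eq_poly_X1)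

lemma subst2_X1_eq_pcompose: "subst2 p (X1, r) = pcompose p r"
  by (induction p) (simp_all add: subst2_pCons pcompose_pCons lift1_def flip: lift1_eq_poly_X1)

lemma pCons_two: "[:p, [:c:]:] = const2 c * X2 + lift1 p"
  by (simp add: const2_def X2_def lift1_def)

text \<open>Maps fixing X1 compose like polynomials in X2 over K[X1]. There degrees multiply, so
  both are 1, and the product of the two leading coefficients is 1, which makes them
  constants.\<close>

lemma degree_1_lead_unit:
  fixes q r :: "'a::field poly poly"
  assumes "pcompose q r = X2"
  shows "\<exists>c c' p p'. c * c' = 1 \<and> q = const2 c * X2 + lift1 p \<and> r = const2 c' * X2 + lift1 p'"
proof -
  have "degree q * degree r = 1" using assms degree_pcompose[of q r] by (simp add: X2_def)
  then have "degree q = 1" "degree r = 1" by auto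
  then obtain p w p' w' where q: "q = [:p, w:]" and r: "r = [:p', w':]" by (metis degree1_coeffs)
  have "coeff (pcompose q r) 1 = w * w'" by (simp add: q r pcompose_pCons)
  then have "w * w' = 1" using assms by (simp add: X2_def)
  then have "w dvd 1" "w' dvd 1" by (metis dvd_triv_left dvd_triv_right)+
  then obtain c c' where "w = [:c:]" "w' = [:c':]" using is_unit_poly_iff by metis
  moreover have "c * c' = 1" using \<open>w * w' = 1\<close> calculation by (simp add: one_pCons mult.commute)
  ultimately show ?thesis using q r pCons_two by metis
qed

lemma fix_X1_inverse:
  fixes q P r :: "'a::field poly poly"
  assumes "comp2 (X1, q) (P, r) = id2" "comp2 (P, r) (X1, q) = id2"
  shows "P = X1 \<and> (\<exists>c c' p p'. c * c' = 1 \<and> q = const2 c * X2 + lift1 p \<and> r = const2 c' * X2 + lift1 p')"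
proof -
  have "P = X1" using assms(2) by (simp add: prod_eq_iff)
  moreover have "pcompose q r = X2" using assms(2) by (simp add: prod_eq_iff \<open>P = X1\<close> subst2_X1_eq_pcompose)
  ultimately show ?thesis using degree_1_lead_unit by blast
qed

lemma aut_fix_X1:
  assumes "aut (X1, q)"
  shows "\<exists>c p. c \<noteq> 0 \<and> q = const2 c * X2 + lift1 p"
proof -
  obtain P r where "comp2 (X1, q) (P, r) = id2" "comp2 (P, r) (X1, q) = id2"
    using assms by (auto simp: aut_def)
  from fix_X1_inverse[OF this] obtain c c' p where "c * c' = 1" "q = const2 c * X2 + lift1 p" by blast
  then show ?thesis by (intro exI[of _ c] exI[of _ p]) auto
qed

lemma not_aut_const: "\<not> aut (f, const2 c)" "\<not> aut (const2 c, f)"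
proof -
  have ne: "const2 c \<noteq> X2" "const2 c \<noteq> X1" by (auto simp: const2_def X2_def X1_def)
  show "\<not> aut (f, const2 c)" "\<not> aut (const2 c, f)" using ne
    by (auto simp: aut_def prod_eq_iff)
qed

lemma dvd_X1:
  fixes g :: "'a::field poly poly"
  assumes "g dvd X1"
  shows "\<exists>k. k \<noteq> 0 \<and> (g = const2 k \<or> g = const2 k * X1)"
proof -
  obtain h where gh: "X1 = g * h" using assms by (elim dvdE)
  have ne: "g \<noteq> 0" "h \<noteq> 0" using gh X1_neq_0 by (metis mult_zero_left, metis mult_zero_right)
  then have "degree g + degree h = 0" using degree_mult_eq[of g h] gh by (simp add: X1_def)
  then obtain a b where ab: "g = [:a:]" "h = [:b:]" by (metis add_is_0 degree_eq_zeroE)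
  have "a * b = [:0, 1:]" using gh by (simp add: ab X1_def)
  moreover have "a \<noteq> 0" "b \<noteq> 0" using ne ab by auto
  ultimately have "degree a + degree b = 1" by (metis degree_mult_eq degree_pCons_eq_if one_neq_zero One_nat_def pCons_eq_0_iff degree_0)
  then consider "degree a = 0" | "degree b = 0" by linarith
  then show ?thesis
  proof cases
    case 1
    then obtain k where "a = [:k:]" by (metis degree_eq_zeroE)
    then show ?thesis using ab \<open>a \<noteq> 0\<close> by (auto simp: const2_def)
  next
    case 2
    then obtain k where k: "b = [:k:]" by (metis degree_eq_zeroE)
    then have "k \<noteq> 0" using \<open>b \<noteq> 0\<close> by auto
    have "smult k a = [:0, 1:]" using \<open>a * b = [:0, 1:]\<close> k by simp
    then have "a = smult (1 / k) [:0, 1:]" using \<open>k \<noteq> 0\<close> by (metis smult_smult divide_self_if smult_1_left times_divide_eq_left mult_1)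
    then have "g = const2 (1 / k) * X1" by (simp add: ab const2_def X1_def)
    then show ?thesis using \<open>k \<noteq> 0\<close> by (intro exI[of _ "1 / k"]) simp
  qed
qed

lemma subst2_fix_X1_coeff:
  "coeff (subst2 F (lift1 l, const2 v * X2)) j = smult (v ^ j) (pcompose (coeff F j) l)"
proof (induction F arbitrary: j)
  case (pCons a F)
  have "subst2 (pCons a F) (lift1 l, const2 v * X2) = pCons (pcompose a l) (smult [:v:] (subst2 F (lift1 l, const2 v * X2)))"
    by (simp add: subst2_pCons ev_lift1) (simp add: lift1_def const2_def X2_def)
  then show ?case using pCons.IH by (cases j) (simp_all add: mult.commute)
qed simp

text \<open>Conjugating by \<open>f\<close> and a complement \<open>g\<close>, the automorphism becomes $x_2 \mapsto c x_2 + p(x_1)$.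
  If it has an eigenvector for an eigenvalue other than 1, then $p = 0$ for a suitable \<open>g\<close>,
  and \<open>g\<close> divides every such eigenvector.\<close>
lemma coordinate_fixed_X1_eigen:
  fixes f :: "'a::field_char_0 poly poly"
  assumes f: "coordinate f" and \<sigma>: "aut \<sigma>" and fixed: "subst2 f \<sigma> = f"
    and eigen: "fst \<sigma> = const2 v * X1" and v: "v \<noteq> 1"
  shows "\<exists>a h. a \<noteq> 0 \<and> f = const2 a * X2 + lift1 h"
proof -
  obtain g where "aut (f, g)" using f by (auto simp: coordinate_iff)
  then obtain \<psi> where \<psi>: "aut \<psi>" "comp2 (f, g) \<psi> = id2" "comp2 \<psi> (f, g) = id2" using aut_inverse by blast
  define \<rho> where "\<rho> = comp2 \<psi> (comp2 \<sigma> (f, g))"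
  have "fst \<rho> = X1" using \<psi>(3) fixed by (simp add: \<rho>_def prod_eq_iff subst2_subst2[symmetric])
  moreover have "aut \<rho>" unfolding \<rho>_def by (intro aut_comp2 \<psi> \<sigma> \<open>aut (f, g)\<close>)
  ultimately obtain c p where c: "c \<noteq> 0" and \<rho>: "\<rho> = (X1, const2 c * X2 + lift1 p)"
    using aut_fix_X1 by (metis prod.collapse)
  define P where "P = fst \<psi>"
  have PX1: "subst2 P (f, g) = X1" using \<psi>(2) by (simp add: prod_eq_iff P_def)
  \<comment> \<open>P is X1 expressed through f and g, so it inherits the eigenvalue v under the
    conjugated map.\<close>
  have "subst2 P \<rho> = subst2 (subst2 (subst2 P (f, g)) \<sigma>) \<psi>" by (simp add: \<rho>_def subst2_subst2)
  also have "\<dots> = const2 v * P" unfolding PX1 by (simp add: eigen P_def)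
  finally have P\<rho>: "subst2 P \<rho> = const2 v * P" .
  have "P \<noteq> 0" using PX1 by auto
  \<comment> \<open>Comparing the coefficients at the highest power of X2 gives v as a power of c,
    hence c is not 1.\<close>
  have "smult (c ^ degree P) (coeff P (degree P)) = smult v (coeff P (degree P))"
    using shift_coeff[of P "degree P" "[:0, 1:]" c p] P\<rho>
    by (simp add: \<rho> lift1_X pcompose_idR const2_mult_eq_smult)
  then have "smult (c ^ degree P - v) (coeff P (degree P)) = 0" by (simp add: smult_diff_left)
  then have "c ^ degree P = v" using \<open>P \<noteq> 0\<close> by simp
  then have c1: "c \<noteq> 1" using v by auto
  \<comment> \<open>With c not 1, X2 + p0 is an eigenvector of X2 -> c X2 + p, so conjugation by
    this shear removes p.\<close>
  define p0 where "p0 = smult (1 / (c - 1)) p"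
  have pp0: "p = smult (c - 1) p0" using c1 by (simp add: p0_def)
  define \<eta> \<eta>' :: "'a poly poly \<times> 'a poly poly" where "\<eta> = (X1, X2 + lift1 (- p0))" and "\<eta>' = (X1, X2 + lift1 p0)"
  have \<eta>: "comp2 \<eta> \<eta>' = id2" "comp2 \<eta>' \<eta> = id2"
    by (simp_all add: \<eta>_def \<eta>'_def prod_eq_iff subst2_lift1 flip: lift1_eq_poly_X1)
  have \<rho>': "comp2 \<eta> (comp2 \<rho> \<eta>') = (lift1 [:0, 1:], const2 c * X2)"
    by (simp add: \<eta>_def \<eta>'_def \<rho> prod_eq_iff subst2_lift1 lift1_X pp0 lift1_smult algebra_simps
        flip: lift1_eq_poly_X1)
  have "subst2 (subst2 P \<eta>) (comp2 \<eta> (comp2 \<rho> \<eta>')) = subst2 (subst2 (subst2 (subst2 P \<eta>) \<eta>') \<rho>) \<eta>"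
    by (simp add: subst2_subst2 comp2_assoc)
  also have "subst2 (subst2 P \<eta>) \<eta>' = P" using \<eta> by (simp add: subst2_subst2)
  also have "subst2 (subst2 P \<rho>) \<eta> = const2 v * subst2 P \<eta>" by (simp add: P\<rho>)
  \<comment> \<open>The map X2 -> c X2 leaves the part free of X2 alone, while the eigenvalue
    multiplies it by v; so this part is zero and X2 divides.\<close>
  finally have "coeff (const2 v * subst2 P \<eta>) 0 = coeff (subst2 P \<eta>) 0"
    using subst2_fix_X1_coeff[of "subst2 P \<eta>" "[:0, 1:]" c 0] by (simp add: \<rho>' pcompose_idR)
  then have "smult (v - 1) (coeff (subst2 P \<eta>) 0) = 0"
    by (simp add: const2_mult_eq_smult smult_diff_left)
  then have "X2 dvd subst2 P \<eta>" using v by (intro X2_dvd) simp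
  then obtain r where "subst2 P \<eta> = X2 * r" by (elim dvdE)
  then have "subst2 (subst2 P \<eta>) \<eta>' = snd \<eta>' * subst2 r \<eta>'" by simp
  then have "P = snd \<eta>' * subst2 r \<eta>'" using \<eta> by (simp add: subst2_subst2)
  then have "subst2 P (f, g) = subst2 (snd \<eta>' * subst2 r \<eta>') (f, g)" by simp
  then have "X1 = snd (comp2 (f, g) \<eta>') * subst2 (subst2 r \<eta>') (f, g)" by (simp add: PX1)
  then have "snd (comp2 (f, g) \<eta>') dvd X1" by (rule dvdI)
  moreover have "comp2 (f, g) \<eta>' = (f, snd (comp2 (f, g) \<eta>'))" by (simp add: prod_eq_iff \<eta>'_def)
  then have aut: "aut (f, snd (comp2 (f, g) \<eta>'))"
    using aut_comp2[OF \<open>aut (f, g)\<close> aut_shear[of p0]] by (simp add: \<eta>'_def)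
  \<comment> \<open>The new complement g + p0(f) divides the irreducible X1, and a member of a
    coordinate pair is not constant.\<close>
  ultimately obtain k where k: "k \<noteq> 0" "snd (comp2 (f, g) \<eta>') = const2 k * X1"
    using dvd_X1 not_aut_const by metis
  have "aut (const2 (1 / k) * X2, X1)"
    by (rule autI[of _ "(X2, const2 k * X1)"])
       (use k in \<open>simp_all add: comp2_def id2_def mult.assoc[symmetric] flip: const2_simps(4)\<close>)
  from aut_comp2[OF aut[unfolded k(2)] this]
  have "aut (X1, f)" using k by (simp add: comp2_def mult.assoc[symmetric] flip: const2_simps(4))
  then show ?thesis using aut_fix_X1 by blast
qed

text \<open>The inverse of \<chi> carries the eigenvector \<open>fst \<chi>\<close> to X1, which
  reduces the claim to the case where X1 itself is the eigenvector.\<close>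

lemma coordinate_fixed_eigen:
  fixes f :: "'a::field_char_0 poly poly"
  assumes f: "coordinate f" and \<sigma>: "aut \<sigma>" and fixed: "subst2 f \<sigma> = f" and \<chi>: "aut \<chi>"
    and eigen: "subst2 (fst \<chi>) \<sigma> = const2 v * fst \<chi>" and v: "v \<noteq> 1"
  shows "\<exists>a h. a \<noteq> 0 \<and> f = const2 a * snd \<chi> + ev h (fst \<chi>)"
proof -
  obtain \<chi>' where \<chi>': "aut \<chi>'" "comp2 \<chi> \<chi>' = id2" "comp2 \<chi>' \<chi> = id2" using aut_inverse \<chi> by blast
  have "\<exists>a h. a \<noteq> 0 \<and> subst2 f \<chi>' = const2 a * X2 + lift1 h"
  proof (rule coordinate_fixed_X1_eigen)
    show "coordinate (subst2 f \<chi>')" using f \<chi>' by (intro coordinate_subst2)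
    show "aut (comp2 \<chi>' (comp2 \<sigma> \<chi>))" by (intro aut_comp2 \<chi>' \<sigma> \<chi>)
    show "subst2 (subst2 f \<chi>') (comp2 \<chi>' (comp2 \<sigma> \<chi>)) = subst2 f \<chi>'"
      using \<chi>' fixed by (simp flip: subst2_subst2) (simp add: subst2_subst2)
    have "subst2 (fst \<chi>) \<chi>' = X1" using \<chi>'(3) by (simp add: prod_eq_iff)
    then show "fst (comp2 \<chi>' (comp2 \<sigma> \<chi>)) = const2 v * X1"
      by (simp add: eigen)
  qed (rule v)
  then obtain a h where "a \<noteq> 0" and e: "subst2 f \<chi>' = const2 a * X2 + lift1 h" by blast
  have "f = subst2 (subst2 f \<chi>') \<chi>" using \<chi>' by (simp add: subst2_subst2)
  then show ?thesis using \<open>a \<noteq> 0\<close> by (auto simp: e subst2_lift1)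
qed

text \<open>Such an F is a polynomial in X2 alone, so some composition F(Q) is a variable, and
  degrees multiply under composition.\<close>

lemma coordinate_const_coeffs:
  fixes F :: "'a::field poly poly"
  assumes "coordinate F" and const: "\<And>j. \<exists>c. coeff F j = [:c:]"
  shows "degree F = 1"
proof -
  have eq: "subst2 F (P, Q) = pcompose F Q" for P Q using const
  proof (induction F)
    case (pCons a F)
    have "\<exists>c. coeff F j = [:c:]" for j using pCons.prems[of "Suc j"] by simp
    then have "subst2 F (P, Q) = pcompose F Q" by (rule pCons.IH)
    moreover obtain c where "a = [:c:]" using pCons.prems[of 0] by auto
    ultimately show ?case by (simp add: subst2_pCons pcompose_pCons const2_def)
  qed simp
  obtain g where "aut (F, g)" using assms by (auto simp: coordinate_iff)
  then obtain P Q where "comp2 (P, Q) (F, g) = id2" by (auto simp: aut_def)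
  then have "subst2 (subst2 F (P, Q)) (X2, X1) = X2" by (simp add: prod_eq_iff)
  then have "subst2 F (comp2 (X2, X1) (P, Q)) = X2" by (simp add: subst2_subst2)
  then have "pcompose F (subst2 Q (X2, X1)) = X2" by (simp add: comp2_def eq)
  then have "degree F * degree (subst2 Q (X2, X1)) = 1"
    using degree_pcompose[of F "subst2 Q (X2, X1)"] by (simp add: X2_def)
  then show ?thesis by simp
qed

text \<open>The leading coefficient forces w = 1; then q takes the same value at all multiples of b,
  and these are infinitely many in characteristic 0.\<close>

lemma shift_invariant_const:
  fixes q :: "'a::field_char_0 poly"
  assumes inv: "smult w (pcompose q [:b, 1:]) = q" and "b \<noteq> 0"
  shows "\<exists>c. q = [:c:]"
proof (cases "q = 0")
  case False
  have "w * lead_coeff (pcompose q [:b, 1:]) = lead_coeff q" by (metis inv lead_coeff_smult)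
  moreover have "lead_coeff (pcompose q [:b, 1:]) = lead_coeff q" by (subst lead_coeff_comp) auto
  ultimately have "w = 1" using False by simp
  have step: "poly q (b + x) = poly q x" for x
    using arg_cong[OF inv, of "\<lambda>q. poly q x"] by (simp add: poly_pcompose \<open>w = 1\<close>)
  have val: "poly q (of_nat n * b) = poly q 0" for n
  proof (induction n)
    case (Suc n)
    have "of_nat (Suc n) * b = b + of_nat n * b" by (simp add: algebra_simps)
    then show ?case using step Suc by simp
  qed simp
  have "inj (\<lambda>n. of_nat n * b)" using \<open>b \<noteq> 0\<close> by (intro injI) simp
  then have "infinite (range (\<lambda>n. of_nat n * b))" using finite_imageD by blast
  moreover have "range (\<lambda>n. of_nat n * b) \<subseteq> {x. poly (q - [:poly q 0:]) x = 0}" using val by auto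
  ultimately have "q - [:poly q 0:] = 0" using poly_roots_finite finite_subset by blast
  then show ?thesis by (metis eq_iff_diff_eq_0)
qed (intro exI[of _ 0], simp)

lemma lift1_linear: "lift1 [:b, u:] = aff u 0 b"
  by (simp add: lift1_def aff_def const2_def X1_def)

text \<open>The translation X1 -> X1 + b offers no eigenvector on the X1 side. Instead a shear
  removes the second highest coefficient of f; it turns the fixing map into (X1 + b, v X2), which
  forces all coefficients in X2 to be constants.\<close>

lemma coordinate_fixed_translation:
  fixes f :: "'a::field_char_0 poly poly"
  assumes f: "coordinate f" and fixed: "subst2 f (aff 1 0 b, const2 v * X2 + lift1 p) = f" and b: "b \<noteq> 0"
  shows "\<exists>a h. a \<noteq> 0 \<and> f = const2 a * X2 + lift1 h"
proof -
  define N where "N = degree f"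
  note sh = shift_coeff[of f N "[:b, 1:]" v p, unfolded lift1_linear fixed, OF eq_refl[OF N_def[symmetric]]]
  have "f \<noteq> 0" using f not_aut_const(2)[of 0] by (auto simp: coordinate_iff)
  have top: "smult (v ^ N) (pcompose (coeff f N) [:b, 1:]) = coeff f N" using sh by simp
  then obtain c where c: "coeff f N = [:c:]" using shift_invariant_const b by blast
  have "c \<noteq> 0" using c \<open>f \<noteq> 0\<close> by (auto simp: N_def)
  then have vN: "v ^ N = 1" using top by (simp add: c)
  have "N \<noteq> 0"
  proof
    assume "N = 0"
    then have "f = [:coeff f 0:]" by (metis N_def degree_eq_zeroE coeff_pCons_0)
    then have "f = const2 c" using c \<open>N = 0\<close> by (simp add: const2_def)
    then show False using f not_aut_const(2) by (auto simp: coordinate_iff)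
  qed
  \<comment> \<open>The Tschirnhaus shift of f. The identity \<open>vs\<close> below says precisely
    that conjugation by this shear removes p from the automorphism.\<close>
  define s where "s = smult (1 / (of_nat N * c)) (coeff f (N - 1))"
  have low: "coeff f (N - 1) = smult (v ^ (N - 1)) (pcompose (coeff f (N - 1)) [:b, 1:] + smult (of_nat N * c) p)"
    using sh \<open>N \<noteq> 0\<close> by (simp add: c of_nat_poly mult.commute)
  have "smult v (coeff f (N - 1)) = smult (v ^ N) (pcompose (coeff f (N - 1)) [:b, 1:] + smult (of_nat N * c) p)"
    by (subst low) (use \<open>N \<noteq> 0\<close> in \<open>simp flip: power_Suc\<close>)
  then have vf: "smult v (coeff f (N - 1)) = pcompose (coeff f (N - 1)) [:b, 1:] + smult (of_nat N * c) p"
    by (simp add: vN)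
  have Ns: "coeff f (N - 1) = smult (of_nat N * c) s" using \<open>N \<noteq> 0\<close> \<open>c \<noteq> 0\<close> by (simp add: s_def)
  have "smult (of_nat N * c) (smult v s) = smult (of_nat N * c) (pcompose s [:b, 1:] + p)"
    using vf unfolding Ns by (simp add: pcompose_smult smult_add_right mult.commute)
  then have "smult (of_nat N * c) (smult v s - (pcompose s [:b, 1:] + p)) = 0"
    by (simp only: smult_diff_right right_minus_eq)
  then have vs: "smult v s = pcompose s [:b, 1:] + p"
    using \<open>N \<noteq> 0\<close> \<open>c \<noteq> 0\<close> by simp
  define F where "F = subst2 f (X1, X2 + lift1 (- s))"
  have fF: "f = subst2 F (X1, X2 + lift1 s)"
    unfolding F_def subst2_subst2 by (simp add: comp2_def subst2_lift1 flip: lift1_eq_poly_X1 id2_def)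
  have c1: "comp2 (aff 1 0 b, const2 v * X2 + lift1 p) (X1, X2 + lift1 s)
      = comp2 (X1, X2 + lift1 s) (lift1 [:b, 1:], const2 v * X2)"
  proof -
    have "lift1 p + lift1 (pcompose s [:b, 1:]) = const2 v * lift1 s"
      using arg_cong[OF vs, of lift1] by (simp add: lift1_smult add.commute)
    then show ?thesis
      by (simp add: comp2_def subst2_lift1 ev_lift1 algebra_simps flip: lift1_linear lift1_eq_poly_X1)
  qed
  have "subst2 (subst2 F (lift1 [:b, 1:], const2 v * X2)) (X1, X2 + lift1 s) = subst2 F (X1, X2 + lift1 s)"
    unfolding subst2_subst2 c1[symmetric] using fixed fF by (simp flip: subst2_subst2)
  then have "subst2 (subst2 (subst2 F (lift1 [:b, 1:], const2 v * X2)) (X1, X2 + lift1 s)) (X1, X2 + lift1 (- s))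
     = subst2 (subst2 F (X1, X2 + lift1 s)) (X1, X2 + lift1 (- s))" by simp
  then have Finv: "subst2 F (lift1 [:b, 1:], const2 v * X2) = F"
    by (simp add: subst2_subst2 comp2_def subst2_lift1 flip: lift1_eq_poly_X1 id2_def)
  have "coordinate F" unfolding F_def by (intro coordinate_subst2 f aut_shear)
  moreover have "\<exists>c. coeff F j = [:c:]" for j
    using subst2_fix_X1_coeff[of F "[:b, 1:]" v j] shift_invariant_const b unfolding Finv by metis
  ultimately have "degree F = 1" by (rule coordinate_const_coeffs)
  then have "N \<le> 1" using shift_coeff[of F 1 "[:0, 1:]" 1 s] fF unfolding N_def by (simp add: lift1_X)
  then have "N = 1" using \<open>N \<noteq> 0\<close> by simp
  then obtain h w where "f = [:h, w:]" by (metis N_def degree1_coeffs)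
  then have "f = const2 c * X2 + lift1 h" using c \<open>N = 1\<close> pCons_two by auto
  then show ?thesis using \<open>c \<noteq> 0\<close> by blast
qed

lemma aut_triangular:
  fixes u :: "'a::field"
  assumes "u \<noteq> 0" "v \<noteq> 0"
  shows "aut (aff u 0 b, const2 v * X2 + lift1 p)"
proof -
  have "aut (aff u 0 b, X2)"
    by (rule autI[of _ "(aff (1 / u) 0 (- b / u), X2)"])
       (use assms in \<open>simp_all add: comp2_def id2_def subst2_lift1 ev_lift1 pcompose_pCons
          flip: lift1_linear lift1_X\<close>)
  moreover have "aut (X1, const2 v * X2)"
    by (rule autI[of _ "(X1, const2 (1 / v) * X2)"])
       (use assms in \<open>simp_all add: comp2_def id2_def mult.assoc[symmetric] flip: const2_simps(4)\<close>)
  ultimately have "aut (comp2 (aff u 0 b, X2) (comp2 (X1, const2 v * X2) (X1, X2 + lift1 (pcompose p [:- b / u, 1 / u:]))))"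
    by (intro aut_comp2 aut_shear)
  also have "comp2 (aff u 0 b, X2) (comp2 (X1, const2 v * X2) (X1, X2 + lift1 (pcompose p [:- b / u, 1 / u:])))
     = (aff u 0 b, const2 v * X2 + lift1 p)"
  proof -
    have "ev (pcompose p [:- b / u, 1 / u:]) (aff u 0 b) = lift1 (pcompose p (pcompose [:- b / u, 1 / u:] [:b, u:]))"
      by (simp add: ev_lift1 pcompose_assoc flip: lift1_linear)
    also have "pcompose [:- b / u, 1 / u:] [:b, u:] = [:0, 1:]" using assms by (simp add: pcompose_pCons)
    finally show ?thesis by (simp add: comp2_def subst2_lift1 pcompose_idR)
  qed
  finally show ?thesis .
qed

text \<open>The cases follow the eigenvalues u and v of the linear part: an eigenvalue other than 1
  yields an eigenvector that is a coordinate, a translation in X1 is treated by a shear, and a pure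
  shear in X2 leaves only polynomials in X1.\<close>

lemma coordinate_fixed_triangular:
  fixes f :: "'a::field_char_0 poly poly"
  assumes f: "coordinate f" and u: "u \<noteq> 0" and v: "v \<noteq> 0"
    and fixed: "subst2 f (aff u 0 b, const2 v * X2 + lift1 p) = f"
    and nid: "(aff u 0 b, const2 v * X2 + lift1 p) \<noteq> id2"
  shows "(\<exists>a h. a \<noteq> 0 \<and> f = const2 a * X2 + lift1 h)
     \<or> (u = 1 \<and> b = 0 \<and> v \<noteq> 1 \<and> (\<exists>a h. a \<noteq> 0 \<and>
           f = const2 a * X1 + ev h (X2 + lift1 (smult (1 / (v - 1)) p))))
     \<or> (\<exists>a c. a \<noteq> 0 \<and> f = const2 a * X1 + const2 c)"
proof -
  let ?\<sigma> = "(aff u 0 b, const2 v * X2 + lift1 p)"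
  have \<sigma>: "aut ?\<sigma>" using u v by (rule aut_triangular)
  consider "u \<noteq> 1" | "u = 1" "b \<noteq> 0" | "u = 1" "b = 0" "v \<noteq> 1" | "u = 1" "b = 0" "v = 1" by blast
  then show ?thesis
  proof cases
    case 1
    \<comment> \<open>Chosen so that X1 + \<beta> is an eigenvector for u.\<close>
    define \<beta> where "\<beta> = b / (u - 1)"
    have \<beta>: "u * \<beta> = b + \<beta>" using 1 by (simp add: \<beta>_def field_simps)
    have \<chi>: "aut (aff 1 0 \<beta>, X2)" using aut_triangular[of 1 1 \<beta> 0] by simp
    have "aff (1 * u) 0 (b + \<beta>) = const2 u * aff 1 0 \<beta>" unfolding \<beta>[symmetric] by (simp add: aff_def algebra_simps)
    then have "subst2 (aff 1 0 \<beta>) ?\<sigma> = const2 u * aff 1 0 \<beta>"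
      by (simp add: aff_def algebra_simps)
    with coordinate_fixed_eigen[OF f \<sigma> fixed \<chi>, of u] 1
    have "\<exists>a h. a \<noteq> 0 \<and> f = const2 a * X2 + ev h (aff 1 0 \<beta>)" by simp
    then show ?thesis by (auto simp: ev_lift1 simp flip: lift1_linear)
  next
    case 2
    then show ?thesis using coordinate_fixed_translation[OF f fixed[unfolded 2]] by blast
  next
    case 3
    \<comment> \<open>Chosen so that X2 + p0 is an eigenvector for v.\<close>
    define p0 where "p0 = smult (1 / (v - 1)) p"
    have p0: "p = smult (v - 1) p0" using 3 by (simp add: p0_def)
    have \<chi>: "aut (X2 + lift1 p0, X1)"
      using aut_comp2[OF aut_shear[of p0] aut_swap] by (simp add: comp2_def)
    have "subst2 (X2 + lift1 p0) ?\<sigma> = const2 v * (X2 + lift1 p0)"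
      using 3 by (simp add: p0 subst2_lift1 aff_def lift1_smult algebra_simps flip: lift1_eq_poly_X1)
    with coordinate_fixed_eigen[OF f \<sigma> fixed \<chi>, of v] 3
    have "\<exists>a h. a \<noteq> 0 \<and> f = const2 a * X1 + ev h (X2 + lift1 p0)" by simp
    then show ?thesis using 3 by (simp add: p0_def)
  next
    case 4
    have aff1: "aff 1 0 0 = (X1 :: 'a poly poly)" by (simp add: aff_def)
    have "p \<noteq> 0" using nid 4 by (auto simp: id2_def aff1)
    \<comment> \<open>For a pure shear the second highest coefficient of f changes by the degree
      times the top coefficient times p, which must be 0 although p is not.\<close>
    have "degree f = 0"
    proof (rule ccontr)
      assume N: "degree f \<noteq> 0"
      have "of_nat (degree f) * (coeff f (degree f) * p) = 0"
        using shift_coeff[of f "degree f" "[:0, 1:]" 1 p] N fixed by (simp add: 4 lift1_X aff1 pcompose_idR)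
      then show False using N \<open>p \<noteq> 0\<close> by auto
    qed
    then obtain h where h: "f = [:h:]" by (metis degree_eq_zeroE)
    define F where "F = subst2 f (X2, X1)"
    have F: "F = map_poly (\<lambda>c. [:c:]) h"
      unfolding F_def h by (induction h) (simp_all add: subst2_pCons map_poly_pCons X2_def const2_def)
    have "degree F = 1"
      unfolding F_def using coordinate_subst2[OF f aut_swap]
    proof (rule coordinate_const_coeffs)
      show "\<exists>c. coeff (subst2 f (X2, X1)) j = [:c:]" for j
        using F by (simp add: F_def coeff_map_poly)
    qed
    then have "degree h = 1" unfolding F by (simp add: degree_map_poly)
    then obtain c a where "h = [:c, a:]" "a \<noteq> 0" by (metis degree1_coeffs)
    then have "f = const2 a * X1 + const2 c" using h by (simp add: const2_def X1_def)
    then show ?thesis using \<open>a \<noteq> 0\<close> by blast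
  qed
qed

subsection \<open>The tame group\<close>

text \<open>Instantiated not only with R but also with the whole field, to get matrix forms of the
  affine maps in types IV and V, and with the localisation \<open>loc R z\<close> that occurs in
  type II.\<close>

locale base_ring =
  fixes R :: "'a::field_char_0 set"
  assumes R_0 [simp, intro]: "0 \<in> R" and R_1 [simp, intro]: "1 \<in> R"
    and R_add [intro]: "x \<in> R \<Longrightarrow> y \<in> R \<Longrightarrow> x + y \<in> R"
    and R_uminus [intro]: "x \<in> R \<Longrightarrow> - x \<in> R"
    and R_mult [intro]: "x \<in> R \<Longrightarrow> y \<in> R \<Longrightarrow> x * y \<in> R"
begin

lemma R_diff [intro]: "x \<in> R \<Longrightarrow> y \<in> R \<Longrightarrow> x - y \<in> R"
  using R_add[OF _ R_uminus] by fastforce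

lemma R_power [intro]: "x \<in> R \<Longrightarrow> x ^ n \<in> R"
  by (induction n) auto

lemma R_of_nat [simp, intro]: "of_nat n \<in> R"
  by (induction n) auto

lemma R_sum [intro]: "(\<And>x. x \<in> A \<Longrightarrow> F x \<in> R) \<Longrightarrow> sum F A \<in> R"
  by (induction A rule: infinite_finite_induct) auto

definition polyR :: "'a poly \<Rightarrow> bool" where "polyR p \<longleftrightarrow> (\<forall>i. coeff p i \<in> R)"

lemma polyR_add [intro]: "polyR p \<Longrightarrow> polyR q \<Longrightarrow> polyR (p + q)"
  and polyR_uminus [intro]: "polyR p \<Longrightarrow> polyR (- p)"
  and polyR_smult [intro]: "c \<in> R \<Longrightarrow> polyR p \<Longrightarrow> polyR (smult c p)"
  and polyR_0 [simp, intro]: "polyR 0"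
  by (auto simp: polyR_def)

lemma polyR_mult [intro]: "polyR p \<Longrightarrow> polyR q \<Longrightarrow> polyR (p * q)"
  by (auto simp: polyR_def coeff_mult)

lemma polyR_pCons [simp]: "polyR (pCons a p) \<longleftrightarrow> a \<in> R \<and> polyR p"
  unfolding polyR_def by (metis coeff_pCons_0 coeff_pCons_Suc not0_implies_Suc)

lemma polyR_pcompose [intro]: "polyR p \<Longrightarrow> polyR q \<Longrightarrow> polyR (pcompose p q)"
  by (induction p) (auto simp: pcompose_pCons)

lemma in_R_add [intro]: "in_R R p \<Longrightarrow> in_R R q \<Longrightarrow> in_R R (p + q)"
  and in_R_diff [intro]: "in_R R p \<Longrightarrow> in_R R q \<Longrightarrow> in_R R (p - q)"
  by (auto simp: in_R_def)

lemma in_R_mult [intro]: "in_R R p \<Longrightarrow> in_R R q \<Longrightarrow> in_R R (p * q)"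
  unfolding in_R_def cf_mult by (intro allI R_sum R_mult) auto

lemma in_R_const2 [simp]: "in_R R (const2 c) \<longleftrightarrow> c \<in> R"
proof
  assume "in_R R (const2 c)"
  then have "cf (const2 c) 0 0 \<in> R" unfolding in_R_def by blast
  then show "c \<in> R" by (simp add: cf_const2)
qed (auto simp: in_R_def cf_const2)

lemma in_R_X1 [simp, intro]: "in_R R X1" and in_R_X2 [simp, intro]: "in_R R X2"
  by (auto simp: in_R_def cf_X1 cf_X2)

lemma in_R_power [intro]: "in_R R p \<Longrightarrow> in_R R (p ^ n)"
  by (induction n) (auto simp flip: const2_simps(2))

lemma in_R_sum [intro]: "(\<And>x. x \<in> A \<Longrightarrow> in_R R (F x)) \<Longrightarrow> in_R R (sum F A)"
  by (induction A rule: infinite_finite_induct) (auto simp flip: const2_simps(1))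

lemma in_R_lift1 [simp]: "in_R R (lift1 p) \<longleftrightarrow> polyR p"
proof
  assume "in_R R (lift1 p)"
  then have "cf (lift1 p) i 0 \<in> R" for i unfolding in_R_def by blast
  then show "polyR p" by (simp add: cf_lift1 polyR_def)
qed (auto simp: in_R_def cf_lift1 polyR_def)

lemma in_R_aff [simp]: "in_R R (aff a b c) \<longleftrightarrow> a \<in> R \<and> b \<in> R \<and> c \<in> R"
proof
  assume "in_R R (aff a b c)"
  then have "cf (aff a b c) i j \<in> R" for i j unfolding in_R_def by blast
  from this[of 1 0] this[of 0 1] this[of 0 0] show "a \<in> R \<and> b \<in> R \<and> c \<in> R" by (simp add: cf_aff)
qed (auto simp: in_R_def cf_aff)

lemma in_R_subst2 [intro]: "in_R R p \<Longrightarrow> in_R R P \<Longrightarrow> in_R R Q \<Longrightarrow> in_R R (subst2 p (P, Q))"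
  unfolding subst2_expand by (rule in_R_sum) (auto simp: in_R_def[of R p] intro!: in_R_mult in_R_power)

lemma in_R_jac: "in_R R p \<Longrightarrow> in_R R q \<Longrightarrow> in_R R (jac p q)"
  unfolding jac_def
  by (intro in_R_diff in_R_mult) (auto simp: in_R_def cf_d1 cf_d2 simp del: of_nat_Suc)

text \<open>Matrix forms over R for the abstract generators. As R is a subset of the field, where
  every nonzero element is invertible, units are described by explicit inverses in R.\<close>

definition affs :: "('a poly poly \<times> 'a poly poly) set" where
  "affs = {(aff a b c, aff a' b' c') | a b c a' b' c'. a \<in> R \<and> b \<in> R \<and> c \<in> R \<and> a' \<in> R \<and> b' \<in> R \<and> c' \<in> R \<and>
     (\<exists>r\<in>R. r * (a * b' - b * a') = 1)}"

definition tris :: "('a poly poly \<times> 'a poly poly) set" where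
  "tris = {(aff u 0 b, const2 v * X2 + lift1 p) | u b v p. u \<in> R \<and> b \<in> R \<and> v \<in> R \<and> polyR p \<and>
     (\<exists>u'\<in>R. u * u' = 1) \<and> (\<exists>v'\<in>R. v * v' = 1)}"

lemma affsI:
  assumes "a \<in> R" "b \<in> R" "c \<in> R" "a' \<in> R" "b' \<in> R" "c' \<in> R" "r \<in> R" "r * (a * b' - b * a') = 1"
  shows "(aff a b c, aff a' b' c') \<in> affs"
  unfolding affs_def using assms by blast

lemma trisI:
  assumes "u \<in> R" "b \<in> R" "v \<in> R" "polyR p" "u' \<in> R" "u * u' = 1" "v' \<in> R" "v * v' = 1"
  shows "(aff u 0 b, const2 v * X2 + lift1 p) \<in> tris"
  unfolding tris_def using assms by blast

lemma affsE:
  assumes "\<phi> \<in> affs"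
  obtains a b c a' b' c' r where "\<phi> = (aff a b c, aff a' b' c')"
    "a \<in> R" "b \<in> R" "c \<in> R" "a' \<in> R" "b' \<in> R" "c' \<in> R" "r \<in> R" "r * (a * b' - b * a') = 1"
  using assms unfolding affs_def by blast

lemma trisE:
  assumes "\<phi> \<in> tris"
  obtains u b v p u' v' where "\<phi> = (aff u 0 b, const2 v * X2 + lift1 p)"
    "u \<in> R" "b \<in> R" "v \<in> R" "polyR p" "u' \<in> R" "u * u' = 1" "v' \<in> R" "v * v' = 1"
  using assms unfolding tris_def by blast

lemma comp2_affs:
  assumes "\<phi> \<in> affs" "\<psi> \<in> affs"
  shows "comp2 \<phi> \<psi> \<in> affs"
proof -
  obtain a b c a' b' c' r where \<phi>: "\<phi> = (aff a b c, aff a' b' c')"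
    "a \<in> R" "b \<in> R" "c \<in> R" "a' \<in> R" "b' \<in> R" "c' \<in> R" "r \<in> R" "r * (a * b' - b * a') = 1"
    using assms(1) by (rule affsE)
  obtain a1 b1 c1 a1' b1' c1' r1 where \<psi>: "\<psi> = (aff a1 b1 c1, aff a1' b1' c1')"
    "a1 \<in> R" "b1 \<in> R" "c1 \<in> R" "a1' \<in> R" "b1' \<in> R" "c1' \<in> R" "r1 \<in> R" "r1 * (a1 * b1' - b1 * a1') = 1"
    using assms(2) by (rule affsE)
  have "(r * r1) * ((a1 * a + b1 * a') * (a1' * b + b1' * b') - (a1 * b + b1 * b') * (a1' * a + b1' * a'))
     = (r * (a * b' - b * a')) * (r1 * (a1 * b1' - b1 * a1'))" by algebra
  then have "(r * r1) * ((a1 * a + b1 * a') * (a1' * b + b1' * b') - (a1 * b + b1 * b') * (a1' * a + b1' * a')) = 1"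
    using \<phi> \<psi> by simp
  then show ?thesis unfolding comp2_def \<phi>(1) \<psi>(1) fst_conv snd_conv subst2_aff_aff
    using \<phi> \<psi> by (intro affsI[where r = "r * r1"]) auto
qed

lemma id2_eq_aff: "id2 = (aff 1 0 0, aff 0 1 0)"
  by (simp add: id2_def aff_def)

lemma affs_inverse:
  assumes "\<phi> \<in> affs"
  shows "\<exists>\<psi>\<in>affs. comp2 \<phi> \<psi> = id2 \<and> comp2 \<psi> \<phi> = id2"
proof -
  obtain a b c a' b' c' r where \<phi>: "\<phi> = (aff a b c, aff a' b' c')"
    "a \<in> R" "b \<in> R" "c \<in> R" "a' \<in> R" "b' \<in> R" "c' \<in> R" "r \<in> R" "r * (a * b' - b * a') = 1"
    using assms by (rule affsE)
  let ?\<psi> = "(aff (r * b') (- (r * b)) (r * (b * c' - b' * c)), aff (- (r * a')) (r * a) (r * (a' * c - a * c')))"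
  have "(a * b' - b * a') * (r * b' * (r * a) - - (r * b) * - (r * a')) = 1" using \<phi>(9) by algebra
  then have "?\<psi> \<in> affs" using \<phi> by (intro affsI[where r = "a * b' - b * a'"]) auto
  moreover have "comp2 \<phi> ?\<psi> = id2" "comp2 ?\<psi> \<phi> = id2"
    unfolding comp2_def \<phi>(1) fst_conv snd_conv subst2_aff_aff id2_eq_aff prod.inject aff_eq_iff
    using \<phi>(9) by - ((intro conjI; (algebra | (simp add: algebra_simps; fail)))+)
  ultimately show ?thesis by blast
qed

lemma subst2_tri:
  "subst2 (const2 v * X2 + lift1 p) (aff u 0 b, Q) = const2 v * Q + lift1 (pcompose p [:b, u:])"
  by (simp add: subst2_lift1 ev_lift1 flip: lift1_linear)

lemma comp2_tris:
  assumes "\<phi> \<in> tris" "\<psi> \<in> tris"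
  shows "comp2 \<phi> \<psi> \<in> tris"
proof -
  obtain u b v p u' v' where \<phi>: "\<phi> = (aff u 0 b, const2 v * X2 + lift1 p)"
    "u \<in> R" "b \<in> R" "v \<in> R" "polyR p" "u' \<in> R" "u * u' = 1" "v' \<in> R" "v * v' = 1"
    using assms(1) by (rule trisE)
  obtain u1 b1 v1 p1 u1' v1' where \<psi>: "\<psi> = (aff u1 0 b1, const2 v1 * X2 + lift1 p1)"
    "u1 \<in> R" "b1 \<in> R" "v1 \<in> R" "polyR p1" "u1' \<in> R" "u1 * u1' = 1" "v1' \<in> R" "v1 * v1' = 1"
    using assms(2) by (rule trisE)
  have "comp2 \<phi> \<psi> = (aff (u1 * u) 0 (u1 * b + b1), const2 (v1 * v) * X2 + lift1 (smult v1 p + pcompose p1 [:b, u:]))"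
    unfolding comp2_def \<phi>(1) \<psi>(1) fst_conv snd_conv subst2_tri
    by (simp add: lift1_smult algebra_simps) (simp add: aff_def algebra_simps)
  moreover have "u1 * u * (u1' * u') = 1" "v1 * v * (v1' * v') = 1" using \<phi>(7,9) \<psi>(7,9) by algebra+
  moreover have "polyR (smult v1 p + pcompose p1 [:b, u:])"
    using \<phi> \<psi> by (intro polyR_add polyR_smult polyR_pcompose) auto
  ultimately show ?thesis using \<phi> \<psi> by (metis trisI R_mult R_add)
qed

lemma X1_eq_aff: "X1 = aff 1 0 0" and X2_eq_aff: "X2 = aff 0 1 0"
  by (simp_all add: aff_def)

lemma tris_inverse:
  assumes "\<phi> \<in> tris"
  shows "\<exists>\<psi>\<in>tris. comp2 \<phi> \<psi> = id2 \<and> comp2 \<psi> \<phi> = id2"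
proof -
  obtain u b v p u' v' where \<phi>: "\<phi> = (aff u 0 b, const2 v * X2 + lift1 p)"
    "u \<in> R" "b \<in> R" "v \<in> R" "polyR p" "u' \<in> R" "u * u' = 1" "v' \<in> R" "v * v' = 1"
    using assms by (rule trisE)
  let ?q = "smult (- v') (pcompose p [:- (u' * b), u':])"
  let ?\<psi> = "(aff u' 0 (- (u' * b)), const2 v' * X2 + lift1 ?q)"
  have "?\<psi> \<in> tris" using \<phi>
    by (intro trisI[of _ _ _ _ u v]) (auto simp: mult.commute intro!: polyR_uminus polyR_smult polyR_pcompose R_uminus)
  moreover have "comp2 \<phi> ?\<psi> = id2"
  proof -
    have "pcompose ?q [:b, u:] = smult (- v') (pcompose p (pcompose [:- (u' * b), u':] [:b, u:]))"
      by (simp add: pcompose_smult pcompose_uminus pcompose_assoc)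
    also have "pcompose [:- (u' * b), u':] [:b, u:] = [:0, 1:]" using \<phi>(7)
      by (simp add: pcompose_pCons mult.commute)
    finally have q: "pcompose ?q [:b, u:] = smult (- v') p" by (simp add: pcompose_idR)
    have v1: "const2 v' * const2 v = (1 :: 'a poly poly)" using \<phi>(9) by (simp add: mult.commute flip: const2_simps(4))
    then have vv: "const2 v' * (const2 v * Z) = Z" for Z :: "'a poly poly" by (simp add: mult.assoc[symmetric])
    have u1: "const2 u' * const2 u = (1 :: 'a poly poly)" using \<phi>(7) by (simp add: mult.commute flip: const2_simps(4))
    then have uu: "const2 u' * (const2 u * Z) = Z" for Z :: "'a poly poly" by (simp add: mult.assoc[symmetric])
    show ?thesis
      unfolding comp2_def \<phi>(1) fst_conv snd_conv subst2_tri q id2_def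
      by (simp add: lift1_smult aff_def algebra_simps vv uu u1 v1)
  qed
  moreover have "comp2 ?\<psi> \<phi> = id2"
  proof -
    have v1: "const2 v * const2 v' = (1 :: 'a poly poly)" using \<phi>(9) by (simp flip: const2_simps(4))
    then have vv: "const2 v * (const2 v' * Z) = Z" for Z :: "'a poly poly" by (simp add: mult.assoc[symmetric])
    have u1: "const2 u * const2 u' = (1 :: 'a poly poly)" using \<phi>(7) by (simp flip: const2_simps(4))
    then have uu: "const2 u * (const2 u' * Z) = Z" for Z :: "'a poly poly" by (simp add: mult.assoc[symmetric])
    have vv': "const2 v' * (const2 v * Z) = Z" and uu': "const2 u' * (const2 u * Z) = Z" for Z :: "'a poly poly"
      using vv uu by (simp_all only: mult.left_commute)
    show ?thesis
      unfolding comp2_def \<phi>(1) fst_conv snd_conv subst2_tri id2_def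
      by (simp add: lift1_smult aff_def algebra_simps vv uu vv' uu' u1 v1 u1[unfolded mult.commute[of "const2 u"]]
        v1[unfolded mult.commute[of "const2 v"]])
  qed
  ultimately show ?thesis by blast
qed

lemma id2_affs: "id2 \<in> affs" and id2_tris: "id2 \<in> tris"
proof -
  show "id2 \<in> affs" unfolding id2_eq_aff by (rule affsI[where r = 1]) auto
  have "id2 = (aff 1 0 0, const2 1 * X2 + lift1 0)" by (simp add: id2_def aff_def)
  also have "\<dots> \<in> tris" by (rule trisI[where u' = 1 and v' = 1]) auto
  finally show "id2 \<in> tris" .
qed

lemma inverse_unique2: "comp2 \<phi> \<psi> = id2 \<Longrightarrow> comp2 \<psi>' \<phi> = id2 \<Longrightarrow> \<psi>' = \<psi>"
  by (metis comp2_assoc comp2_id2)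

section \<open>Tame automorphisms as words in affine and triangular maps\<close>

inductive_set gp :: "('a poly poly \<times> 'a poly poly) set" where
  gp_id: "id2 \<in> gp"
| gp_step: "\<sigma> \<in> affs \<union> tris \<Longrightarrow> \<tau> \<in> gp \<Longrightarrow> comp2 \<sigma> \<tau> \<in> gp"

lemma gp_gen: "\<sigma> \<in> affs \<union> tris \<Longrightarrow> \<sigma> \<in> gp"
  using gp_step[OF _ gp_id, of \<sigma>] by simp

lemma gp_comp2: "\<tau> \<in> gp \<Longrightarrow> \<tau>' \<in> gp \<Longrightarrow> comp2 \<tau> \<tau>' \<in> gp"
  by (induction rule: gp.induct) (auto simp: comp2_assoc intro: gp_step)

lemma swap_affs: "(X2, X1) \<in> affs"
  unfolding X1_eq_aff X2_eq_aff by (rule affsI[where r = "- 1"]) auto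

lemma elementary_X1:
  assumes "is_aut R (X1, q)"
  shows "(X1, q) \<in> tris"
proof -
  obtain P r where "comp2 (X1, q) (P, r) = id2" "comp2 (P, r) (X1, q) = id2"
    and in_R: "in_R R r" "in_R R q"
    using assms by (auto simp: is_aut_def)
  from fix_X1_inverse[OF this(1,2)] obtain c c' p p' where
    c: "c * c' = 1" "q = const2 c * X2 + lift1 p" "r = const2 c' * X2 + lift1 p'" by blast
  \<comment> \<open>The inverse is also defined over R, so both c and its inverse c' appear as
    coefficients in R.\<close>
  have "cf q 0 1 \<in> R" "cf r 0 1 \<in> R" "\<And>i. cf q i 0 \<in> R" using in_R unfolding in_R_def by blast+
  then have "c \<in> R" "c' \<in> R" "polyR p"
    unfolding c(2,3) by (simp_all add: cf_const2_mult cf_X2 cf_lift1 polyR_def)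
  then show ?thesis unfolding c(2) X1_eq_aff using c(1)
    by (intro trisI[where u' = 1 and v' = c']) auto
qed

lemma is_aut_comp2:
  assumes "is_aut R \<phi>" "is_aut R \<psi>" shows "is_aut R (comp2 \<phi> \<psi>)"
proof -
  obtain \<phi>' \<psi>' where inv: "in_R R (fst \<phi>')" "in_R R (snd \<phi>')" "comp2 \<phi> \<phi>' = id2" "comp2 \<phi>' \<phi> = id2"
    "in_R R (fst \<psi>')" "in_R R (snd \<psi>')" "comp2 \<psi> \<psi>' = id2" "comp2 \<psi>' \<psi> = id2"
    using assms unfolding is_aut_def by blast
  have in_R: "in_R R (fst (comp2 \<alpha> \<beta>)) \<and> in_R R (snd (comp2 \<alpha> \<beta>))"
    if "in_R R (fst \<alpha>)" "in_R R (snd \<alpha>)" "in_R R (fst \<beta>)" "in_R R (snd \<beta>)" for \<alpha> \<beta>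
    using that by (cases \<alpha>; cases \<beta>) auto
  have "comp2 (comp2 \<phi> \<psi>) (comp2 \<psi>' \<phi>') = id2" "comp2 (comp2 \<psi>' \<phi>') (comp2 \<phi> \<psi>) = id2"
    using inv by (metis comp2_assoc comp2_id2(1))+
  then show ?thesis unfolding is_aut_def using in_R inv assms[unfolded is_aut_def] by blast
qed

lemma affs_is_aut: "\<phi> \<in> affs \<Longrightarrow> is_aut R \<phi>"
proof -
  have *: "in_R R (fst \<phi>) \<and> in_R R (snd \<phi>)" if "\<phi> \<in> affs" for \<phi> using that by (auto elim!: affsE)
  assume "\<phi> \<in> affs"
  then show ?thesis unfolding is_aut_def using affs_inverse[of \<phi>] * by blast
qed

lemma tris_is_aut: "\<phi> \<in> tris \<Longrightarrow> is_aut R \<phi>"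
proof -
  have *: "in_R R (fst \<phi>) \<and> in_R R (snd \<phi>)" if "\<phi> \<in> tris" for \<phi> using that by (auto elim!: trisE intro!: in_R_add in_R_mult)
  assume "\<phi> \<in> tris"
  then show ?thesis unfolding is_aut_def using tris_inverse[of \<phi>] * by blast
qed

text \<open>Exchanging the variables conjugates an elementary map fixing X2 into one fixing X1, and
  the exchange is itself affine.\<close>

lemma elementary_gp:
  assumes "is_elementary R \<sigma>"
  shows "\<sigma> \<in> gp"
proof (cases "fst \<sigma> = X1")
  case True
  then show ?thesis using elementary_X1[of "snd \<sigma>"] assms gp_gen
    by (metis UnI2 is_elementary_def prod.collapse)
next
  case False
  then obtain q where \<sigma>: "\<sigma> = (q, X2)" using assms by (metis is_elementary_def prod.collapse)
  let ?S = "(X2, X1) :: 'a poly poly \<times> 'a poly poly"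
  have "comp2 ?S (comp2 \<sigma> ?S) = (X1, subst2 q ?S)" by (simp add: \<sigma> comp2_def)
  moreover have "is_aut R (comp2 ?S (comp2 \<sigma> ?S))"
    using assms affs_is_aut[OF swap_affs] by (intro is_aut_comp2) (simp_all add: is_elementary_def)
  ultimately have "comp2 ?S (comp2 \<sigma> ?S) \<in> tris" using elementary_X1 by simp
  then have "comp2 ?S (comp2 (comp2 ?S (comp2 \<sigma> ?S)) ?S) \<in> gp"
    by (intro gp_comp2 gp_gen) (use swap_affs in auto)
  moreover have "comp2 ?S ?S = id2" by (simp add: comp2_def id2_def)
  then have "comp2 ?S (comp2 (comp2 ?S (comp2 \<sigma> ?S)) ?S) = \<sigma>" by (metis comp2_assoc comp2_id2)
  ultimately show ?thesis by simp
qed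

lemma total_deg_1_aff:
  assumes "total_deg p = 1" "in_R R p"
  shows "\<exists>a\<in>R. \<exists>b\<in>R. \<exists>c\<in>R. p = aff a b c"
proof -
  have "p = aff (cf p 1 0) (cf p 0 1) (cf p 0 0)"
  proof (rule poly2_eqI)
    fix i j
    have "cf p i j \<noteq> 0 \<longrightarrow> i + j \<le> 1" using total_deg_le_iff[of p 1] assms by simp
    then show "cf p i j = cf (aff (cf p 1 0) (cf p 0 1) (cf p 0 0)) i j"
      by (cases "i = 0"; cases "j = 0"; cases "i = 1"; cases "j = 1") (auto simp: cf_aff)
  qed
  moreover have "cf p i j \<in> R" for i j using assms by (auto simp: in_R_def)
  ultimately show ?thesis by blast
qed

text \<open>The determinant is the Jacobian, and by the chain rule its inverse is the constant term
  of the Jacobian of the inverse map. That map is defined over R, so the determinant is a unit of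
  R.\<close>

lemma affine_affs:
  assumes "is_affine R \<sigma>"
  shows "\<sigma> \<in> affs"
proof -
  have "is_aut R \<sigma>" using assms by (simp add: is_affine_def)
  then obtain P Q where PQ: "in_R R P" "in_R R Q" "comp2 \<sigma> (P, Q) = id2" and in_R: "in_R R (fst \<sigma>)" "in_R R (snd \<sigma>)"
    by (auto simp: is_aut_def)
  obtain a b c where 1: "a \<in> R" "b \<in> R" "c \<in> R" "fst \<sigma> = aff a b c"
    using total_deg_1_aff[of "fst \<sigma>"] assms in_R by (auto simp: is_affine_def)
  obtain a' b' c' where 2: "a' \<in> R" "b' \<in> R" "c' \<in> R" "snd \<sigma> = aff a' b' c'"
    using total_deg_1_aff[of "snd \<sigma>"] assms in_R by (auto simp: is_affine_def)
  have \<sigma>: "\<sigma> = (aff a b c, aff a' b' c')" using 1 2 by (simp add: prod_eq_iff)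
  have "subst2 P \<sigma> = X1" "subst2 Q \<sigma> = X2" using PQ by (simp_all add: comp2_def id2_def)
  then have eq: "1 = subst2 (jac P Q) \<sigma> * jac (aff a b c) (aff a' b' c')"
    using jac_subst2_subst2[of P "aff a b c" "aff a' b' c'" Q] by (simp add: \<sigma> jac_def)
  have "jac (aff a b c) (aff a' b' c') = const2 (a * b' - b * a')"
    by (simp add: jac_def aff_def)
  then have "const2 (a * b' - b * a') * subst2 (jac P Q) \<sigma> = 1" using eq by (simp add: mult.commute)
  then have "cf (const2 (a * b' - b * a') * subst2 (jac P Q) \<sigma>) 0 0 = cf 1 0 0" by simp
  then have "(a * b' - b * a') * cf (subst2 (jac P Q) \<sigma>) 0 0 = 1" by (simp only: cf_const2_mult) simp
  then have "cf (subst2 (jac P Q) \<sigma>) 0 0 * (a * b' - b * a') = 1" by (simp add: mult.commute)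
  moreover have "in_R R (subst2 (jac P Q) \<sigma>)"
    unfolding \<sigma> using 1 2 PQ in_R_jac by (intro in_R_subst2) auto
  then have "cf (subst2 (jac P Q) \<sigma>) 0 0 \<in> R" unfolding in_R_def by blast
  ultimately show ?thesis unfolding \<sigma> by (intro affsI[OF 1(1-3) 2(1-3)])
qed

text \<open>Inverses of affine and of elementary maps are again of these kinds, so words without
  inverses suffice.\<close>

lemma tame_subset_gp: "\<tau> \<in> tame R \<Longrightarrow> \<tau> \<in> gp"
proof (induction rule: tame.induct)
  case tame_id
  show ?case by (rule gp_id)
next
  case (tame_gen \<tau> \<sigma>)
  then show ?case using affine_affs elementary_gp gp_gen gp_comp2 by (metis UnI1 tame_gen_def)
next
  case (tame_inv \<tau> \<sigma> \<sigma>')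
  have "\<sigma>' \<in> gp"
  proof (cases "is_affine R \<sigma>")
    case True
    then obtain \<psi> where "\<psi> \<in> affs" "comp2 \<sigma> \<psi> = id2" using affine_affs affs_inverse by blast
    then have "\<sigma>' = \<psi>" using tame_inv inverse_unique2 by blast
    then show ?thesis using \<open>\<psi> \<in> affs\<close> gp_gen by simp
  next
    case False
    then have el: "is_elementary R \<sigma>" using tame_inv by (simp add: tame_gen_def)
    have "is_aut R \<sigma>'"
      unfolding is_aut_def using tame_inv el[unfolded is_elementary_def is_aut_def] by blast
    moreover have "fst \<sigma> = X1 \<Longrightarrow> fst \<sigma>' = X1" "snd \<sigma> = X2 \<Longrightarrow> snd \<sigma>' = X2"
      using \<open>comp2 \<sigma>' \<sigma> = id2\<close> by (simp_all add: prod_eq_iff)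
    ultimately show ?thesis using el by (intro elementary_gp) (auto simp: is_elementary_def)
  qed
  then show ?case using tame_inv gp_comp2 by blast
qed

text \<open>Alternating words, named after the kind of their leftmost letter, with every letter
  outside the intersection of the two subgroups. The leftmost letter acts last, so rule induction
  follows a polynomial through the word.\<close>

inductive redA redT :: "'a poly poly \<times> 'a poly poly \<Rightarrow> bool" where
  "\<sigma> \<in> affs \<Longrightarrow> \<sigma> \<notin> tris \<Longrightarrow> redA \<sigma>"
| "\<sigma> \<in> affs \<Longrightarrow> \<sigma> \<notin> tris \<Longrightarrow> redT \<tau> \<Longrightarrow> redA (comp2 \<sigma> \<tau>)"
| "\<sigma> \<in> tris \<Longrightarrow> \<sigma> \<notin> affs \<Longrightarrow> redT \<sigma>"
| "\<sigma> \<in> tris \<Longrightarrow> \<sigma> \<notin> affs \<Longrightarrow> redA \<tau> \<Longrightarrow> redT (comp2 \<sigma> \<tau>)"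

lemma left_mult_mem:
  assumes "\<beta> \<in> affs" "\<beta> \<in> tris"
  shows "comp2 \<beta> \<sigma> \<in> affs \<longleftrightarrow> \<sigma> \<in> affs" and "comp2 \<beta> \<sigma> \<in> tris \<longleftrightarrow> \<sigma> \<in> tris"
proof -
  obtain \<psi> where "\<psi> \<in> affs" "comp2 \<psi> \<beta> = id2" using affs_inverse assms by blast
  then show "comp2 \<beta> \<sigma> \<in> affs \<longleftrightarrow> \<sigma> \<in> affs" using comp2_affs assms by (metis comp2_assoc comp2_id2(1))
  obtain \<psi> where "\<psi> \<in> tris" "comp2 \<psi> \<beta> = id2" using tris_inverse assms by blast
  then show "comp2 \<beta> \<sigma> \<in> tris \<longleftrightarrow> \<sigma> \<in> tris" using comp2_tris assms by (metis comp2_assoc comp2_id2(1))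
qed

lemma red_left_mult:
  assumes "\<beta> \<in> affs" "\<beta> \<in> tris"
  shows "redA \<tau> \<Longrightarrow> redA (comp2 \<beta> \<tau>)" and "redT \<tau> \<Longrightarrow> redT (comp2 \<beta> \<tau>)"
proof -
  note m = left_mult_mem[OF assms]
  assume "redA \<tau>"
  then show "redA (comp2 \<beta> \<tau>)"
    by cases (auto simp: comp2_assoc[symmetric] m intro: redA_redT.intros)
next
  note m = left_mult_mem[OF assms]
  assume "redT \<tau>"
  then show "redT (comp2 \<beta> \<tau>)"
    by cases (auto simp: comp2_assoc[symmetric] m intro: redA_redT.intros)
qed

text \<open>A new letter of the same kind as the leftmost one merges with it. If the merged letter
  falls into the intersection of both subgroups, it is absorbed by the next letter, which keeps its
  kind.\<close>

lemma gp_reduced: "\<tau> \<in> gp \<Longrightarrow> (\<tau> \<in> affs \<and> \<tau> \<in> tris) \<or> redA \<tau> \<or> redT \<tau>"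
proof (induction rule: gp.induct)
  case gp_id
  then show ?case using id2_affs id2_tris by blast
next
  case (gp_step \<sigma> \<tau>)
  consider (both) "\<sigma> \<in> affs" "\<sigma> \<in> tris" | (A) "\<sigma> \<in> affs" "\<sigma> \<notin> tris" | (T) "\<sigma> \<in> tris" "\<sigma> \<notin> affs"
    using gp_step by blast
  then show ?case
  proof cases
    case both
    then show ?thesis using gp_step.IH red_left_mult left_mult_mem by blast
  next
    case A
    from gp_step.IH consider "\<tau> \<in> affs" "\<tau> \<in> tris" | "redA \<tau>" | "redT \<tau>" by blast
    then show ?thesis
    proof cases
      case 1
      then show ?thesis using comp2_affs[OF A(1)] redA_redT.intros(1) by blast
    next
      case 2
      then show ?thesis
      proof cases
        case 1
        then show ?thesis using comp2_affs[OF A(1)] redA_redT.intros(1) by blast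
      next
        case (2 \<sigma>1 \<tau>1)
        then have "comp2 \<sigma> \<sigma>1 \<in> affs" using comp2_affs[OF A(1)] by blast
        then show ?thesis using 2 red_left_mult(2)[of "comp2 \<sigma> \<sigma>1" \<tau>1] redA_redT.intros(2)[of "comp2 \<sigma> \<sigma>1" \<tau>1]
          by (auto simp: comp2_assoc)
      qed
    next
      case 3
      then show ?thesis using A redA_redT.intros(2) by blast
    qed
  next
    case T
    from gp_step.IH consider "\<tau> \<in> affs" "\<tau> \<in> tris" | "redA \<tau>" | "redT \<tau>" by blast
    then show ?thesis
    proof cases
      case 1
      then show ?thesis using comp2_tris[OF T(1)] redA_redT.intros(3) by blast
    next
      case 2
      then show ?thesis using T redA_redT.intros(4) by blast
    next
      case 3
      then show ?thesis
      proof cases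
        case 1
        then show ?thesis using comp2_tris[OF T(1)] redA_redT.intros(3) by blast
      next
        case (2 \<sigma>1 \<tau>1)
        then have "comp2 \<sigma> \<sigma>1 \<in> tris" using comp2_tris[OF T(1)] by blast
        then show ?thesis using 2 red_left_mult(1)[of "comp2 \<sigma> \<sigma>1" \<tau>1] redA_redT.intros(4)[of "comp2 \<sigma> \<sigma>1" \<tau>1]
          by (auto simp: comp2_assoc)
      qed
    qed
  qed
qed

end

subsection \<open>Degrees along the tame orbit\<close>

text \<open>The two states, in ordinary degree, that alternate along a reduced word:
  \<open>top_X1\<close> after a triangular letter and \<open>top_has_X2\<close> after an affine
  one.\<close>

definition top_X1 :: "nat \<Rightarrow> 'a::field_char_0 poly poly \<Rightarrow> bool" where
  "top_X1 M g \<longleftrightarrow> wle 1 1 (int M) g \<and> (\<exists>c. c \<noteq> 0 \<and> wcomp 1 1 (int M) g = const2 c * X1 ^ M)"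

definition top_has_X2 :: "nat \<Rightarrow> 'a::field_char_0 poly poly \<Rightarrow> bool" where
  "top_has_X2 M g \<longleftrightarrow> wle 1 1 (int M) g \<and> cf g 0 M \<noteq> 0"

lemma top_X1_deg: "top_X1 M g \<Longrightarrow> M \<le> deg_x1 g"
proof -
  assume "top_X1 M g"
  then obtain c where c: "c \<noteq> 0" "wcomp 1 1 (int M) g = const2 c * X1 ^ M" by (auto simp: top_X1_def)
  have "cf g M 0 = cf (wcomp 1 1 (int M) g) M 0" by (simp add: cf_wcomp)
  also have "\<dots> = c" using cf_X1_power_X2_power[where ?'a = 'a, of M 0 0 M] by (simp add: c cf_const2_mult)
  finally show ?thesis using c by (intro cf_le_deg_x1[of g 0]) simp
qed

lemma top_has_X2_deg: "top_has_X2 M g \<Longrightarrow> M \<le> deg_x2 g"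
  by (auto simp: top_has_X2_def intro: cf_le_deg_x2)

lemma lead_weight: "lead d n c \<gamma> g \<Longrightarrow> cf g i j \<noteq> 0 \<Longrightarrow> i + d * j \<le> n * d"
proof -
  assume "lead d n c \<gamma> g" and nz: "cf g i j \<noteq> 0"
  then have "wle 1 (int d) (int (n * d)) g" by (simp only: lead_def)
  from wleD[OF this nz] show "i + d * j \<le> n * d" by (simp flip: of_nat_mult of_nat_add)
qed

lemma X2_power_eq: "wcomp 1 (int D) (int (n * D)) g = const2 c * X2 ^ n"
  if "0 < D" "cf g 0 n = c" "\<And>i j. cf g i j \<noteq> 0 \<Longrightarrow> i + D * j = n * D \<Longrightarrow> j = n"
proof (rule poly2_eqI)
  fix i j
  have "i = 0 \<and> j = n" if "i + D * j = n * D" "cf g i j \<noteq> 0"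
    using \<open>\<And>i j. cf g i j \<noteq> 0 \<Longrightarrow> i + D * j = n * D \<Longrightarrow> j = n\<close>[OF that(2,1)] that(1) by (simp add: mult.commute)
  then show "cf (wcomp 1 (int D) (int (n * D)) g) i j = cf (const2 c * X2 ^ n) i j"
    using that(1,2) cf_X1_power_X2_power[where ?'a = 'a, of 0 n j i]
    by (auto simp: cf_wcomp cf_const2_mult simp flip: of_nat_mult of_nat_add)
qed

text \<open>Once X2 becomes heavier than d, every monomial other than X2^n falls below the top
  weight. This prepares a triangular letter whose degree exceeds d.\<close>

lemma lead_raise:
  assumes l: "lead d n c \<gamma> g" and "0 < d" "d < D"
  shows "lead D n c 0 g"
proof -
  have w: "i + d * j \<le> n * d" "j \<le> n" if "cf g i j \<noteq> 0" for i j
  proof -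
    show 1: "i + d * j \<le> n * d" using lead_weight[OF l that] .
    then have "d * j \<le> d * n" using mult.commute[of n d] by linarith
    then show "j \<le> n" using \<open>0 < d\<close> by simp
  qed
  have b: "i + D * j \<le> n * D \<and> (i + D * j = n * D \<longrightarrow> j = n)" if nz: "cf g i j \<noteq> 0" for i j
  proof -
    obtain k where k: "n = j + k" using w(2)[OF nz] le_Suc_ex by blast
    have "i \<le> k * d" using w(1)[OF nz] by (simp add: k algebra_simps)
    moreover have "k * d < k * D" if "k \<noteq> 0" using \<open>d < D\<close> that by simp
    moreover have "(j + k) * D = D * j + k * D" by (simp add: algebra_simps)
    ultimately show ?thesis unfolding k by (cases "k = 0") (simp, linarith)
  qed
  have "wle 1 (int D) (int (n * D)) g"
    by (rule wleI) (use b in \<open>force simp flip: of_nat_mult of_nat_add\<close>)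
  moreover have "wcomp 1 (int D) (int (n * D)) g = const2 c * X2 ^ n"
    using b lead_cf[OF l \<open>0 < d\<close>] \<open>0 < d\<close> \<open>d < D\<close> by (intro X2_power_eq) auto
  ultimately show ?thesis by (simp add: lead_def)
qed

lemma top_has_X2_lead:
  assumes "top_has_X2 M g" "2 \<le> D"
  shows "\<exists>c. c \<noteq> 0 \<and> lead D M c 0 g"
proof -
  have w: "i + j \<le> M" if "cf g i j \<noteq> 0" for i j
  proof -
    have "wle 1 1 (int M) g" using assms(1) by (simp only: top_has_X2_def)
    from wleD[OF this that] show ?thesis by simp
  qed
  have b: "i + D * j \<le> M * D \<and> (i + D * j = M * D \<longrightarrow> j = M)" if nz: "cf g i j \<noteq> 0" for i j
  proof -
    obtain k where k: "M = j + k" using w[OF nz] le_Suc_ex add_leD2 by metis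
    have "i \<le> k" using w[OF nz] by (simp add: k)
    moreover have "k * 2 \<le> k * D" using \<open>2 \<le> D\<close> by (rule mult_le_mono2)
    moreover have "(j + k) * D = D * j + k * D" by (simp add: algebra_simps)
    ultimately show ?thesis unfolding k by linarith
  qed
  have "wle 1 (int D) (int (M * D)) g"
    by (rule wleI) (use b in \<open>force simp flip: of_nat_mult of_nat_add\<close>)
  moreover have "wcomp 1 (int D) (int (M * D)) g = const2 (cf g 0 M) * X2 ^ M"
    using b \<open>2 \<le> D\<close> by (intro X2_power_eq) auto
  ultimately have "lead D M (cf g 0 M) 0 g" by (simp add: lead_def)
  then show ?thesis using assms(1) by (auto simp: top_has_X2_def)
qed

text \<open>A triangular letter maps X2 + \<gamma> X1^D to v X2 + (\<gamma> u^D + p_D) X1^D up to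
  terms of lower weight; factoring out v gives the new parameter.\<close>

lemma lead_tri:
  fixes g :: "'a::field_char_0 poly poly"
  assumes l: "lead D n c \<gamma> g" and "0 < D" and v: "v \<noteq> 0" and p: "degree p \<le> D"
  shows "lead D n (c * v ^ n) ((\<gamma> * u ^ D + coeff p D) / v) (subst2 g (aff u 0 b, const2 v * X2 + lift1 p))"
proof -
  have w: "wle 1 (int D) (int (n * D)) g"
    and c: "wcomp 1 (int D) (int (n * D)) g = const2 c * (X2 + const2 \<gamma> * X1 ^ D) ^ n"
    using l by (simp_all only: lead_def)
  have P: "wle 1 (int D) 1 (aff u 0 b)" using \<open>0 < D\<close> by (intro wle_1_1_aff_0) auto
  have Q: "wle 1 (int D) (int D) (const2 v * X2 + lift1 p)"
    using wle_lift1[of 1 p D "int D"] p by (intro wle_add wle_const2_mult wle_X2) simp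
  have cQ: "wcomp 1 (int D) (int D) (const2 v * X2 + lift1 p) = const2 v * X2 + const2 (coeff p D) * X1 ^ D"
    using wcomp_lift1[of 1 "int D" D p] by (simp add: wcomp_X2)
  have e: "const2 v * const2 ((\<gamma> * u ^ D + coeff p D) / v) = const2 (\<gamma> * u ^ D + coeff p D)"
    using v by (simp flip: const2_simps(4))
  have "wcomp 1 (int D) (int (n * D)) (subst2 g (aff u 0 b, const2 v * X2 + lift1 p))
      = const2 c * (const2 v * X2 + const2 (coeff p D) * X1 ^ D + const2 \<gamma> * (const2 u * X1) ^ D) ^ n"
    by (simp only: wcomp_subst2[OF w P Q] c cQ wcomp_1_aff_0) simp
  also have "const2 v * X2 + const2 (coeff p D) * X1 ^ D + const2 \<gamma> * (const2 u * X1) ^ D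
     = const2 v * X2 + const2 (\<gamma> * u ^ D + coeff p D) * X1 ^ D"
    by (simp add: power_mult_distrib const2_power algebra_simps)
  also have "\<dots> = const2 v * (X2 + const2 ((\<gamma> * u ^ D + coeff p D) / v) * X1 ^ D)"
    unfolding distrib_left mult.assoc[symmetric] e ..
  finally show ?thesis using wle_subst2[OF w P Q]
    by (simp add: lead_def power_mult_distrib const2_power mult.assoc)
qed

text \<open>For D >= 2 the power X1^D exceeds X2 in ordinary degree, so only the corner X1^(n*D)
  stays at the top.\<close>

lemma lead_top_X1:
  fixes g :: "'a::field_char_0 poly poly"
  assumes l: "lead D n c \<gamma> g" and "2 \<le> D" "c \<noteq> 0" "\<gamma> \<noteq> 0"
  shows "top_X1 (n * D) g"
proof -
  have w: "i + j \<le> n * D \<and> (i + j = n * D \<longrightarrow> j = 0)" if "cf g i j \<noteq> 0" for i j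
  proof -
    have "2 * j \<le> D * j" using \<open>2 \<le> D\<close> by simp
    then show ?thesis using lead_weight[OF l that] by linarith
  qed
  have "wle 1 1 (int (n * D)) g" by (rule wleI) (use w in \<open>force simp flip: of_nat_mult of_nat_add\<close>)
  moreover have "wcomp 1 1 (int (n * D)) g = const2 (c * \<gamma> ^ n) * X1 ^ (n * D)"
  proof (rule poly2_eqI)
    fix i j
    have "cf g (n * D) 0 = c * \<gamma> ^ n" using lead_cf[OF l] \<open>2 \<le> D\<close> by simp
    then show "cf (wcomp 1 1 (int (n * D)) g) i j = cf (const2 (c * \<gamma> ^ n) * X1 ^ (n * D)) i j"
      using w[of j i] cf_X1_power_X2_power[where ?'a = 'a, of "n * D" 0 j i] assms(3,4)
      unfolding cf_wcomp cf_const2_mult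
      by (cases "j = 0"; cases "cf g i j = 0") (auto simp flip: of_nat_mult of_nat_add)
  qed
  ultimately show ?thesis unfolding top_X1_def using assms(3,4)
    by (intro conjI exI[of _ "c * \<gamma> ^ n"]) simp_all
qed

lemma top_X1_aff:
  fixes g :: "'a::field_char_0 poly poly"
  assumes "top_X1 M g" and "b \<noteq> 0"
  shows "top_has_X2 M (subst2 g (aff a b c, aff a' b' c'))"
    and "a \<noteq> 0 \<Longrightarrow> M \<le> deg_x1 (subst2 g (aff a b c, aff a' b' c'))"
proof -
  obtain k where w: "wle 1 1 (int M) g" and k: "k \<noteq> 0" "wcomp 1 1 (int M) g = const2 k * X1 ^ M"
    using assms(1) by (auto simp: top_X1_def)
  let ?h = "subst2 g (aff a b c, aff a' b' c')"
  have h: "wcomp 1 1 (int M) ?h = const2 k * lform a b ^ M"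
    by (simp add: wcomp_subst2[OF w wle_aff wle_aff] k wcomp_aff)
  have "cf ?h i j = cf (wcomp 1 1 (int M) ?h) i j" if "i + j = M" for i j
    using that by (auto simp: cf_wcomp)
  then have "cf ?h 0 M = k * b ^ M" "cf ?h M 0 = k * a ^ M"
    unfolding h by (simp_all add: cf_const2_mult cf_lform_power)
  then show "top_has_X2 M ?h" "a \<noteq> 0 \<Longrightarrow> M \<le> deg_x1 ?h"
    using wle_subst2[OF w wle_aff wle_aff] k \<open>b \<noteq> 0\<close>
    by (auto simp: top_has_X2_def intro: cf_le_deg_x1[of ?h 0])
qed

lemma cf_swap: "cf (subst2 g (X2, X1)) i j = cf g j i"
proof -
  have "cf (subst2 g (X2, X1)) i j = (\<Sum>x\<in>supp2 g. if x = (j, i) then cf g j i else 0)"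
    unfolding subst2_expand coeff_sum
    by (auto simp: split_def cf_const2_mult mult.commute[of "X2 ^ _"] cf_X1_power_X2_power prod_eq_iff intro!: sum.cong)
  also have "\<dots> = cf g j i" by (auto simp: sum.delta)
  finally show ?thesis .
qed

lemma deg_swap: "deg_x1 (subst2 g (X2, X1)) = deg_x2 g" "deg_x2 (subst2 g (X2, X1)) = deg_x1 g"
proof -
  have "deg_x1 (subst2 g (X2, X1)) \<le> N \<longleftrightarrow> deg_x2 g \<le> N" "deg_x2 (subst2 g (X2, X1)) \<le> N \<longleftrightarrow> deg_x1 g \<le> N" for N
    unfolding deg_x1_le_iff deg_x2_le_iff cf_swap by blast+
  then show "deg_x1 (subst2 g (X2, X1)) = deg_x2 g" "deg_x2 (subst2 g (X2, X1)) = deg_x1 g"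
    by (metis order_antisym order_refl)+
qed

section \<open>Words acting on a leading form, first with d at least 2 and then with d = 1\<close>

context base_ring
begin

lemma tris_not_affs_degree:
  assumes "(aff u 0 b, const2 v * X2 + lift1 p) \<in> tris - affs"
  shows "2 \<le> degree p"
proof (rule ccontr)
  assume "\<not> ?thesis"
  then obtain c w where p: "p = [:c, w:]"
    by (metis One_nat_def degree_eq_zeroE degree1_coeffs less_2_cases linorder_not_le pCons_0_0)
  obtain u1 b1 v1 p1 u' v' where \<phi>: "(aff u 0 b, const2 v * X2 + lift1 p) = (aff u1 0 b1, const2 v1 * X2 + lift1 p1)"
    "u1 \<in> R" "b1 \<in> R" "v1 \<in> R" "polyR p1" "u' \<in> R" "u1 * u' = 1" "v' \<in> R" "v1 * v' = 1"
    using assms by (auto elim: trisE)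
  have e: "v = v1" "p = p1" "u = u1" "b = b1" using \<phi>(1) by (simp_all add: pCons_two[symmetric])
  have "const2 v * X2 + lift1 p = aff w v c" unfolding p lift1_linear by (simp add: aff_def)
  then have "(aff u 0 b, const2 v * X2 + lift1 p) = (aff u1 0 b1, aff w v1 c)" using e by simp
  moreover have "c \<in> R" "w \<in> R" using \<phi>(5) e(2) p by auto
  moreover have "u' * v' * (u1 * v1 - 0 * w) = 1" using \<phi>(7,9) by algebra
  then have "(aff u1 0 b1, aff w v1 c) \<in> affs" using \<phi> calculation(2,3) by (intro affsI[where r = "u' * v'"]) auto
  ultimately show False using assms by simp
qed

lemma affs_not_tris:
  assumes "(aff a b c, aff a' b' c') \<in> affs - tris"
  shows "b \<noteq> 0"
proof
  assume "b = 0"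
  obtain r where r: "a \<in> R" "c \<in> R" "a' \<in> R" "b' \<in> R" "c' \<in> R" "r \<in> R" "r * (a * b' - b * a') = 1"
    using assms by (auto elim!: affsE)
  have "(aff a 0 c, const2 b' * X2 + lift1 [:c', a':]) \<in> tris"
    using r \<open>b = 0\<close> by (intro trisI[where u' = "r * b'" and v' = "r * a"]) (auto simp: algebra_simps)
  also have "const2 b' * X2 + lift1 [:c', a':] = aff a' b' c'"
    by (simp add: lift1_linear) (simp add: aff_def)
  finally show False using assms \<open>b = 0\<close> by simp
qed

text \<open>If \<gamma> u^d + p_d were 0, then \<gamma> = - p_d u'^d would lie in R. A letter of
  degree above d overrides \<gamma> by its own leading coefficient, and d grows to its
  degree.\<close>

lemma lead_tris:
  assumes l: "lead d n c \<gamma> f" and d: "2 \<le> d" and c: "c \<noteq> 0" and \<gamma>: "\<gamma> \<notin> R" and \<tau>: "\<tau> \<in> tris"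
  shows "\<exists>d' c' \<gamma>'. d \<le> d' \<and> c' \<noteq> 0 \<and> \<gamma>' \<noteq> 0 \<and> lead d' n c' \<gamma>' (subst2 f \<tau>)"
proof -
  obtain u b v p u' v' where \<phi>: "\<tau> = (aff u 0 b, const2 v * X2 + lift1 p)"
    "u \<in> R" "b \<in> R" "v \<in> R" "polyR p" "u' \<in> R" "u * u' = 1" "v' \<in> R" "v * v' = 1"
    using \<tau> by (rule trisE)
  have nz: "u \<noteq> 0" "v \<noteq> 0" using \<phi>(7,9) by auto
  show ?thesis
  proof (cases "degree p \<le> d")
    case True
    have "\<gamma> * u ^ d + coeff p d \<noteq> 0"
    proof
      assume "\<gamma> * u ^ d + coeff p d = 0"
      moreover have "u ^ d * u' ^ d = 1" using \<phi>(7) by (simp flip: power_mult_distrib)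
      ultimately have "\<gamma> = - (coeff p d) * u' ^ d"
        by (metis mult.assoc mult.right_neutral eq_neg_iff_add_eq_0)
      then show False using \<gamma> \<phi> by (auto simp: polyR_def)
    qed
    then show ?thesis using lead_tri[OF l _ nz(2) True, of u b] d c nz \<phi>(1)
      by (intro exI[of _ d] exI[of _ "c * v ^ n"] exI[of _ "(\<gamma> * u ^ d + coeff p d) / v"]) auto
  next
    case False
    let ?D = "degree p"
    have "lead ?D n c 0 f" using lead_raise[OF l] False d by simp
    from lead_tri[OF this _ nz(2) order_refl, of u b]
    have "lead ?D n (c * v ^ n) (coeff p ?D / v) (subst2 f \<tau>)" using False \<phi>(1) by simp
    then show ?thesis using False c nz
      by (intro exI[of _ ?D] exI[of _ "c * v ^ n"] exI[of _ "coeff p ?D / v"]) auto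
  qed
qed

text \<open>A triangular letter outside the affine group has some degree D >= 2, and it turns X2^M
  into a multiple of X1^(M*D) at the top.\<close>

lemma top_has_X2_tris:
  assumes "top_has_X2 M g" and \<tau>: "\<tau> \<in> tris - affs"
  shows "\<exists>N\<ge>2 * M. top_X1 N (subst2 g \<tau>)"
proof -
  obtain u b v p u' v' where \<phi>: "\<tau> = (aff u 0 b, const2 v * X2 + lift1 p)"
    "u \<in> R" "b \<in> R" "v \<in> R" "polyR p" "u' \<in> R" "u * u' = 1" "v' \<in> R" "v * v' = 1"
    using \<tau> by (blast elim: trisE)
  have nz: "v \<noteq> 0" using \<phi>(9) by auto
  let ?D = "degree p"
  have D: "2 \<le> ?D" using tris_not_affs_degree \<tau> \<phi>(1) by simp
  obtain c where c: "c \<noteq> 0" "lead ?D M c 0 g" using top_has_X2_lead[OF assms(1) D] by blast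
  from lead_tri[OF c(2) _ nz order_refl, of u b]
  have "lead ?D M (c * v ^ M) (coeff p ?D / v) (subst2 g \<tau>)" using D \<phi>(1) by simp
  note L = this
  have "p \<noteq> 0" using D by auto
  have "top_X1 (M * ?D) (subst2 g \<tau>)" by (rule lead_top_X1[OF L D]) (use c nz \<open>p \<noteq> 0\<close> in auto)
  moreover have "2 * M \<le> M * ?D" using D by simp
  ultimately show ?thesis by blast
qed

lemma subst2_comp2: "subst2 f (comp2 \<sigma> \<tau>) = subst2 (subst2 f \<tau>) \<sigma>"
  by (simp add: subst2_subst2)

lemma lead_affs:
  assumes l: "lead d n c \<gamma> f" and d: "2 \<le> d" and c: "c \<noteq> 0" and \<gamma>: "\<gamma> \<notin> R"
    and T: "T \<in> tris" and \<sigma>: "\<sigma> \<in> affs - tris"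
  shows "\<exists>M\<ge>n * d. top_has_X2 M (subst2 f (comp2 \<sigma> T))"
    and "n * d + n \<le> deg_x1 (subst2 f (comp2 \<sigma> T)) + deg_x2 (subst2 f (comp2 \<sigma> T))"
proof -
  obtain A1 B1 C1 A2 B2 C2 r where s: "\<sigma> = (aff A1 B1 C1, aff A2 B2 C2)"
    "A1 \<in> R" "B1 \<in> R" "C1 \<in> R" "A2 \<in> R" "B2 \<in> R" "C2 \<in> R" "r \<in> R" "r * (A1 * B2 - B1 * A2) = 1"
    using \<sigma> by (blast elim: affsE)
  have B1: "B1 \<noteq> 0" using affs_not_tris \<sigma> s(1) by simp
  obtain d' c' \<gamma>' where T': "d \<le> d'" "c' \<noteq> 0" "\<gamma>' \<noteq> 0" "lead d' n c' \<gamma>' (subst2 f T)"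
    using lead_tris[OF l d c \<gamma> T] by blast
  have nd: "n * d \<le> n * d'" using T' by simp
  have J: "top_X1 (n * d') (subst2 f T)" using lead_top_X1[OF T'(4)] T' d by simp
  note J' = top_X1_aff[OF J B1, of A1 C1 A2 B2 C2, folded s(1), folded subst2_comp2]
  show "\<exists>M\<ge>n * d. top_has_X2 M (subst2 f (comp2 \<sigma> T))" using J'(1) nd by blast
  show "n * d + n \<le> deg_x1 (subst2 f (comp2 \<sigma> T)) + deg_x2 (subst2 f (comp2 \<sigma> T))"
  proof (cases "A1 = 0")
    case False
    have "n * d \<le> deg_x1 (subst2 f (comp2 \<sigma> T))" using J'(2)[OF False] nd by linarith
    moreover have "n * d \<le> deg_x2 (subst2 f (comp2 \<sigma> T))" using top_has_X2_deg[OF J'(1)] nd by linarith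
    moreover have "n \<le> n * d" using d by simp
    ultimately show ?thesis by linarith
  next
    \<comment> \<open>The top form now says nothing about the degree in X1. But \<sigma> is the
      exchange of the variables composed with a triangular map, so the two degrees of a triangular
      image of f are swapped, and the bound holds again.\<close>
    case True
    let ?T = "(aff B1 0 C1, const2 A2 * X2 + lift1 [:C2, B2:])"
    have "?T \<in> tris" using s True
      by (intro trisI[where u' = "- (r * A2)" and v' = "- (r * B1)"]) (auto simp: algebra_simps)
    then have "comp2 ?T T \<in> tris" using T comp2_tris by blast
    then obtain d'' c'' \<gamma>'' where T'': "d \<le> d''" "c'' \<noteq> 0" "\<gamma>'' \<noteq> 0" "lead d'' n c'' \<gamma>'' (subst2 f (comp2 ?T T))"
      using lead_tris[OF l d c \<gamma>] by blast
    have "comp2 (X2, X1) ?T = \<sigma>" unfolding s(1) True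
      by (simp add: comp2_def lift1_linear) (simp add: aff_def)
    then have "subst2 f (comp2 \<sigma> T) = subst2 (subst2 f (comp2 ?T T)) (X2, X1)"
      by (simp add: subst2_subst2 flip: comp2_assoc)
    then have "deg_x1 (subst2 f (comp2 \<sigma> T)) = n" "deg_x2 (subst2 f (comp2 \<sigma> T)) = n * d''"
      using lead_deg[OF T''(4)] T'' d by (simp_all add: deg_swap)
    moreover have "n * d \<le> n * d''" using T'' by simp
    ultimately show ?thesis by simp
  qed
qed

text \<open>Only the triangular letter that acts first, if there is one, meets \<gamma> itself.
  After the first affine letter outside \<open>tris\<close> the power of X2 is at least nd, and
  every later triangular letter doubles it.\<close>

lemma lead_red:
  assumes l: "lead d n c \<gamma> f" and d: "2 \<le> d" and c: "c \<noteq> 0" and \<gamma>: "\<gamma> \<notin> R"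
  shows "redA \<tau> \<Longrightarrow> (\<exists>M\<ge>n * d. top_has_X2 M (subst2 f \<tau>)) \<and> n * d + n \<le> deg_x1 (subst2 f \<tau>) + deg_x2 (subst2 f \<tau>)"
    and "redT \<tau> \<Longrightarrow> \<tau> \<in> tris \<or> (\<exists>M\<ge>2 * (n * d). top_X1 M (subst2 f \<tau>))"
proof (induction rule: redA_redT.inducts)
  case (1 \<sigma>)
  then show ?case using lead_affs[OF l d c \<gamma> id2_tris, of \<sigma>] by simp
next
  case (2 \<sigma> \<tau>)
  then consider "\<tau> \<in> tris" | M where "M \<ge> 2 * (n * d)" "top_X1 M (subst2 f \<tau>)" by blast
  then show ?case
  proof cases
    case 1
    then show ?thesis using lead_affs[OF l d c \<gamma> 1, of \<sigma>] 2 by simp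
  next
    case (2 M)
    obtain A1 B1 C1 A2 B2 C2 r where s: "\<sigma> = (aff A1 B1 C1, aff A2 B2 C2)"
      using \<open>\<sigma> \<in> affs\<close> by (blast elim: affsE)
    have "B1 \<noteq> 0" using affs_not_tris \<open>\<sigma> \<in> affs\<close> \<open>\<sigma> \<notin> tris\<close> s(1) by simp
    then have C: "top_has_X2 M (subst2 f (comp2 \<sigma> \<tau>))"
      using top_X1_aff(1)[OF 2(2)] by (simp add: s subst2_comp2)
    have "n \<le> n * d" using d by simp
    then have "n * d \<le> M" "n * d + n \<le> deg_x2 (subst2 f (comp2 \<sigma> \<tau>))"
      using top_has_X2_deg[OF C] 2(1) by linarith+
    then show ?thesis using C trans_le_add2 by blast
  qed
next
  case (3 \<sigma>)
  then show ?case by blast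
next
  case (4 \<sigma> \<tau>)
  then obtain M where M: "M \<ge> n * d" "top_has_X2 M (subst2 f \<tau>)" by blast
  obtain N where "N \<ge> 2 * M" "top_X1 N (subst2 f (comp2 \<sigma> \<tau>))"
    using top_has_X2_tris[OF M(2), of \<sigma>] 4 by (auto simp: subst2_comp2)
  moreover have "2 * (n * d) \<le> 2 * M" using M(1) by simp
  ultimately show ?case by (meson order_trans)
qed

text \<open>A word that leaves the triangular group has degree in X2 at least nd > n, or degree in
  X1 at least 2nd > nd, so it cannot fix f.\<close>

lemma lead_tame:
  assumes l: "lead d n c \<gamma> f" and d: "2 \<le> d" and c: "c \<noteq> 0" and \<gamma>: "\<gamma> \<notin> R" and n: "1 \<le> n"
    and \<tau>: "\<tau> \<in> tame R"
  shows "deg_x1 f + deg_x2 f \<le> deg_x1 (subst2 f \<tau>) + deg_x2 (subst2 f \<tau>)"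
    and "subst2 f \<tau> = f \<Longrightarrow> \<tau> \<in> tris"
proof -
  have "\<gamma> \<noteq> 0" using \<gamma> by auto
  then have df: "deg_x1 f = n * d" "deg_x2 f = n" using lead_deg[OF l] d c by auto
  have nd: "2 * n \<le> n * d" using d by simp
  consider (T) "\<tau> \<in> tris" | (A) "redA \<tau>" | (R) "redT \<tau>" "\<tau> \<notin> tris"
    using gp_reduced[OF tame_subset_gp[OF \<tau>]] by blast
  then have "deg_x1 f + deg_x2 f \<le> deg_x1 (subst2 f \<tau>) + deg_x2 (subst2 f \<tau>) \<and> (subst2 f \<tau> = f \<longrightarrow> \<tau> \<in> tris)"
  proof cases
    case T
    obtain d' c' \<gamma>' where T': "d \<le> d'" "c' \<noteq> 0" "\<gamma>' \<noteq> 0" "lead d' n c' \<gamma>' (subst2 f \<tau>)"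
      using lead_tris[OF l d c \<gamma> T] by blast
    have "deg_x1 (subst2 f \<tau>) = n * d'" "deg_x2 (subst2 f \<tau>) = n"
      using lead_deg[OF T'(4)] T' d by auto
    moreover have "n * d \<le> n * d'" using T' by simp
    ultimately show ?thesis using df T by simp
  next
    case A
    obtain M where M: "n * d \<le> M" "top_has_X2 M (subst2 f \<tau>)"
      and le: "n * d + n \<le> deg_x1 (subst2 f \<tau>) + deg_x2 (subst2 f \<tau>)"
      using lead_red(1)[OF l d c \<gamma> A] by blast
    have "deg_x2 (subst2 f \<tau>) \<noteq> deg_x2 f" using top_has_X2_deg[OF M(2)] M(1) nd df n by linarith
    then have "subst2 f \<tau> \<noteq> f" by auto
    then show ?thesis using le df by simp
  next
    case R
    obtain M where M: "2 * (n * d) \<le> M" "top_X1 M (subst2 f \<tau>)" using lead_red(2)[OF l d c \<gamma> R(1)] R(2) by blast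
    have "2 * (n * d) \<le> deg_x1 (subst2 f \<tau>)" using top_X1_deg[OF M(2)] M(1) by simp
    moreover from this have "deg_x1 (subst2 f \<tau>) \<noteq> deg_x1 f" using nd df n by linarith
    then have "subst2 f \<tau> \<noteq> f" by auto
    ultimately show ?thesis using df nd by (intro conjI) (linarith, blast)
  qed
  then show "deg_x1 f + deg_x2 f \<le> deg_x1 (subst2 f \<tau>) + deg_x2 (subst2 f \<tau>)"
    and "subst2 f \<tau> = f \<Longrightarrow> \<tau> \<in> tris" by blast+
qed

lemma lead1_affs:
  assumes l: "lead 1 n c \<gamma> f" and c: "c \<noteq> 0" and \<gamma>: "\<gamma> \<noteq> 0" "\<gamma> \<notin> Vset R" and \<sigma>: "\<sigma> \<in> affs"
  shows "top_has_X2 n (subst2 f \<sigma>)" and "n \<le> deg_x1 (subst2 f \<sigma>)"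
proof -
  obtain A1 B1 C1 A2 B2 C2 r where s: "\<sigma> = (aff A1 B1 C1, aff A2 B2 C2)"
    "A1 \<in> R" "B1 \<in> R" "C1 \<in> R" "A2 \<in> R" "B2 \<in> R" "C2 \<in> R" "r \<in> R" "r * (A1 * B2 - B1 * A2) = 1"
    using \<sigma> by (blast elim: affsE)
  have w: "wle 1 1 (int n) f" and cf: "wcomp 1 1 (int n) f = const2 c * (X2 + const2 \<gamma> * X1) ^ n"
    using l by (simp_all add: lead_def)
  \<comment> \<open>The new coefficients of X1 and X2 in the linear form are A2 + \<gamma> A1 and B2
    + \<gamma> B1. Since the determinant is a unit, either pair is coprime, so a vanishing
    coefficient would exhibit \<gamma> as an element of V(R).\<close>
  have V: "False" if "x \<in> R" "y \<in> R" "x + \<gamma> * y = 0" "x * s + y * t = 1" "s \<in> R" "t \<in> R" for x y s t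
  proof -
    have "y \<noteq> 0" using that by auto
    then have "x \<noteq> 0" using that \<gamma> by auto
    have "- x \<in> R - {0}" "y \<in> R - {0}" using that \<open>x \<noteq> 0\<close> \<open>y \<noteq> 0\<close> by auto
    moreover have "\<gamma> = (- x) / y" using that(3) \<open>y \<noteq> 0\<close> by (simp add: field_simps add_eq_0_iff)
    moreover have "(- x) * (- s) + y * t = 1" "- s \<in> R" "t \<in> R" using that by auto
    ultimately have "\<gamma> \<in> Vset R" unfolding Vset_def by blast
    then show False using \<gamma> by simp
  qed
  have 1: "A2 + \<gamma> * A1 \<noteq> 0"
    using V[of A2 A1 "- (r * B1)" "r * B2"] s by (auto simp: algebra_simps)
  have 2: "B2 + \<gamma> * B1 \<noteq> 0"
    using V[of B2 B1 "r * A1" "- (r * A2)"] s by (auto simp: algebra_simps)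
  let ?h = "subst2 f \<sigma>"
  have "wcomp 1 1 (int n) ?h = subst2 (const2 c * (X2 + const2 \<gamma> * X1) ^ n) (lform A1 B1, lform A2 B2)"
    unfolding s(1) by (simp only: wcomp_subst2[OF w wle_aff wle_aff] cf wcomp_aff)
  also have "\<dots> = const2 c * lform (A2 + \<gamma> * A1) (B2 + \<gamma> * B1) ^ n"
    by (simp add: lform_def algebra_simps)
  finally have h: "wcomp 1 1 (int n) ?h = const2 c * lform (A2 + \<gamma> * A1) (B2 + \<gamma> * B1) ^ n" .
  have "cf ?h i j = cf (wcomp 1 1 (int n) ?h) i j" if "i + j = n" for i j
    using that by (auto simp: cf_wcomp)
  then have "cf ?h 0 n = c * (B2 + \<gamma> * B1) ^ n" "cf ?h n 0 = c * (A2 + \<gamma> * A1) ^ n"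
    unfolding h by (simp_all add: cf_const2_mult cf_lform_power)
  then have nz: "cf ?h 0 n \<noteq> 0" "cf ?h n 0 \<noteq> 0" using 1 2 c by simp_all
  show "n \<le> deg_x1 ?h" using nz(2) by (rule cf_le_deg_x1)
  show "top_has_X2 n ?h"
    using wle_subst2[OF w wle_aff wle_aff] nz(1) by (simp add: top_has_X2_def s(1))
qed

text \<open>The same growth with the roles of the subgroups exchanged: an affine letter acting first
  preserves the power X2^n, and the first triangular letter already doubles the degree.\<close>

lemma lead1_red:
  assumes l: "lead 1 n c \<gamma> f" and c: "c \<noteq> 0" and \<gamma>: "\<gamma> \<noteq> 0" "\<gamma> \<notin> Vset R"
  shows "redA \<tau> \<Longrightarrow> \<tau> \<in> affs \<or> (\<exists>M\<ge>2 * n. top_has_X2 M (subst2 f \<tau>))"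
    and "redT \<tau> \<Longrightarrow> \<exists>M\<ge>2 * n. top_X1 M (subst2 f \<tau>)"
proof (induction rule: redA_redT.inducts)
  case (1 \<sigma>)
  then show ?case by blast
next
  case (2 \<sigma> \<tau>)
  then obtain M where M: "M \<ge> 2 * n" "top_X1 M (subst2 f \<tau>)" by blast
  obtain A1 B1 C1 A2 B2 C2 r where s: "\<sigma> = (aff A1 B1 C1, aff A2 B2 C2)"
    using \<open>\<sigma> \<in> affs\<close> by (blast elim: affsE)
  have "B1 \<noteq> 0" using affs_not_tris \<open>\<sigma> \<in> affs\<close> \<open>\<sigma> \<notin> tris\<close> s(1) by simp
  then have "top_has_X2 M (subst2 f (comp2 \<sigma> \<tau>))"
    using top_X1_aff(1)[OF M(2)] by (simp add: s subst2_comp2)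
  then show ?case using M(1) by blast
next
  case (3 \<sigma>)
  then show ?case
    using top_has_X2_tris[OF lead1_affs(1)[OF l c \<gamma> id2_affs], of \<sigma>] by simp
next
  case (4 \<sigma> \<tau>)
  obtain M where M: "M \<ge> n" "top_has_X2 M (subst2 f \<tau>)"
  proof (cases "\<tau> \<in> affs")
    case True
    then show ?thesis using that[of n] lead1_affs(1)[OF l c \<gamma>] by blast
  next
    case False
    then obtain M where "2 * n \<le> M" "top_has_X2 M (subst2 f \<tau>)" using 4 by blast
    then show ?thesis using that[of M] by simp
  qed
  obtain N where "N \<ge> 2 * M" "top_X1 N (subst2 f (comp2 \<sigma> \<tau>))"
    using top_has_X2_tris[OF M(2), of \<sigma>] 4 by (auto simp: subst2_comp2)
  moreover have "2 * n \<le> 2 * M" using M(1) by simp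
  ultimately show ?case by (meson order_trans)
qed

lemma lead1_tame:
  assumes l: "lead 1 n c \<gamma> f" and c: "c \<noteq> 0" and \<gamma>: "\<gamma> \<noteq> 0" "\<gamma> \<notin> Vset R" and n: "1 \<le> n"
    and \<tau>: "\<tau> \<in> tame R"
  shows "deg_x1 f + deg_x2 f \<le> deg_x1 (subst2 f \<tau>) + deg_x2 (subst2 f \<tau>)"
    and "subst2 f \<tau> = f \<Longrightarrow> \<tau> \<in> affs"
proof -
  have df: "deg_x1 f = n" "deg_x2 f = n" using lead_deg[OF l] \<gamma> c by auto
  consider (A) "\<tau> \<in> affs" | (B) "redA \<tau>" "\<tau> \<notin> affs" | (T) "redT \<tau>"
    using gp_reduced[OF tame_subset_gp[OF \<tau>]] by blast
  then have "deg_x1 f + deg_x2 f \<le> deg_x1 (subst2 f \<tau>) + deg_x2 (subst2 f \<tau>) \<and> (subst2 f \<tau> = f \<longrightarrow> \<tau> \<in> affs)"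
  proof cases
    case A
    then show ?thesis using lead1_affs(2)[OF l c \<gamma> A] top_has_X2_deg[OF lead1_affs(1)[OF l c \<gamma> A]] df by simp
  next
    case B
    obtain M where M: "2 * n \<le> M" "top_has_X2 M (subst2 f \<tau>)" using lead1_red(1)[OF l c \<gamma> B(1)] B(2) by blast
    have "2 * n \<le> deg_x2 (subst2 f \<tau>)" using top_has_X2_deg[OF M(2)] M(1) by simp
    moreover from this have "subst2 f \<tau> \<noteq> f" using df n by auto
    ultimately show ?thesis using df by simp
  next
    case T
    obtain M where M: "2 * n \<le> M" "top_X1 M (subst2 f \<tau>)" using lead1_red(2)[OF l c \<gamma> T] by blast
    have "2 * n \<le> deg_x1 (subst2 f \<tau>)" using top_X1_deg[OF M(2)] M(1) by simp
    moreover from this have "subst2 f \<tau> \<noteq> f" using df n by auto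
    ultimately show ?thesis using df by simp
  qed
  then show "deg_x1 f + deg_x2 f \<le> deg_x1 (subst2 f \<tau>) + deg_x2 (subst2 f \<tau>)"
    and "subst2 f \<tau> = f \<Longrightarrow> \<tau> \<in> affs" by blast+
qed

end

subsection \<open>The five types satisfy the conditions\<close>

lemma total_deg_aff: "a \<noteq> 0 \<or> b \<noteq> 0 \<Longrightarrow> total_deg (aff a b c) = 1"
proof -
  assume ab: "a \<noteq> 0 \<or> b \<noteq> 0"
  have "total_deg (aff a b c) \<le> 1" unfolding total_deg_le_iff by (auto simp: cf_aff split: if_splits)
  moreover have "\<not> total_deg (aff a b c) \<le> 0"
  proof
    assume "total_deg (aff a b c) \<le> 0"
    then have "cf (aff a b c) 1 0 = 0" "cf (aff a b c) 0 1 = 0"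
      unfolding total_deg_le_iff by fastforce+
    then show False using ab by (simp add: cf_aff)
  qed
  ultimately show ?thesis by simp
qed

lemma wle_poly_const2:
  assumes "wle a b w P" "0 \<le> w" "degree q \<le> k"
  shows "wle a b (w * int k) (ev q P)"
proof -
  have "wle w 0 (w * int k) (lift1 q)" by (rule wle_lift1[OF assms(2,3)])
  from wle_subst2[OF this assms(1), of 0] show ?thesis by (simp add: subst2_lift1)
qed

lemma wcomp_poly_const2:
  assumes "wle a b w P" "0 < w" "degree q \<le> k"
  shows "wcomp a b (w * int k) (ev q P) = const2 (coeff q k) * wcomp a b w P ^ k"
proof -
  have "wle w 0 (w * int k) (lift1 q)" using assms by (intro wle_lift1) auto
  from wcomp_subst2[OF this assms(1), of 0] show ?thesis
    by (simp add: subst2_lift1 wcomp_lift1[OF assms(2)])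
qed

text \<open>The top form comes from the argument of q alone, since X1 has weight 1, below deg g *
  deg q. With q = X and a = 0 this covers type I, in general type II.\<close>

lemma lead_poly_shear:
  fixes q g :: "'a::field_char_0 poly"
  assumes s: "s \<noteq> 0" and d: "2 \<le> degree g" and k: "1 \<le> degree q"
  shows "lead (degree g) (degree q) (lead_coeff q * s ^ degree q) (lead_coeff g / s)
     (const2 a * X1 + ev q (const2 s * X2 + lift1 g))"
proof -
  let ?d = "degree g" and ?k = "degree q" and ?y = "const2 s * X2 + lift1 g"
  have wy: "wle 1 (int ?d) (int ?d) ?y"
    using wle_lift1[of 1 g ?d "int ?d"] by (intro wle_add wle_const2_mult wle_X2) simp
  have e: "const2 s * const2 (lead_coeff g / s) = const2 (lead_coeff g)"
    using s by (simp flip: const2_simps(4))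
  have cy: "wcomp 1 (int ?d) (int ?d) ?y = const2 s * (X2 + const2 (lead_coeff g / s) * X1 ^ ?d)"
    using wcomp_lift1[of 1 "int ?d" ?d g] by (simp add: wcomp_X2 distrib_left mult.assoc[symmetric] e)
  have N: "int (?k * ?d) = int ?d * int ?k" by simp
  have "1 < ?k * ?d" using d k by (metis less_le_trans mult_le_mono mult_1 numeral_2_eq_2 lessI One_nat_def)
  then have 1: "1 < int ?d * int ?k" by (simp flip: of_nat_mult add: mult.commute)
  have w: "wle 1 (int ?d) 1 (const2 a * X1)" by (intro wle_const2_mult wle_X1)
  have "wle 1 (int ?d) (int ?d * int ?k) (const2 a * X1)" "wcomp 1 (int ?d) (int ?d * int ?k) (const2 a * X1) = 0"
    using 1 wle_mono[OF w] wcomp_eq_0_of_wle[OF w 1] by auto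
  moreover have "wle 1 (int ?d) (int ?d * int ?k) (ev q ?y)"
    using wle_poly_const2[OF wy] by simp
  moreover have "wcomp 1 (int ?d) (int ?d * int ?k) (ev q ?y)
     = const2 (lead_coeff q) * (const2 s * (X2 + const2 (lead_coeff g / s) * X1 ^ ?d)) ^ ?k"
    using wcomp_poly_const2[OF wy, of q ?k, unfolded cy] d by simp
  ultimately show ?thesis unfolding lead_def N
    by (simp only: wle_add wcomp_add) (simp add: power_mult_distrib const2_power mult.assoc)
qed

lemma lform_eq: "t \<noteq> 0 \<Longrightarrow> lform s t = const2 t * (X2 + const2 (s / t) * X1)"
  for s t :: "'a::field"
  by (simp add: lform_def distrib_left mult.assoc[symmetric] flip: const2_simps(4))

lemma wcomp_aff_shear:
  fixes g :: "'a::field_char_0 poly"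
  assumes "2 \<le> degree g"
  defines "k \<equiv> degree g"
  shows "wle 1 1 (int k) (subst2 (X2 + lift1 g) (aff s t c, aff s' t' c'))"
    and "wcomp 1 1 (int k) (subst2 (X2 + lift1 g) (aff s t c, aff s' t' c')) = const2 (lead_coeff g) * lform s t ^ k"
proof -
  have w: "wle 1 1 1 (X2 :: 'a poly poly)" by (rule wle_X2)
  have f: "wle 1 1 (int k) (X2 + lift1 g)"
    using wle_lift1[of 1 g k 1] wle_mono[OF w, of "int k"] assms by (intro wle_add) auto
  have c: "wcomp 1 1 (int k) (X2 + lift1 g) = const2 (lead_coeff g) * X1 ^ k"
    using wcomp_lift1[of 1 1 k g] wcomp_eq_0_of_wle[OF w, of "int k"] assms by simp
  show "wle 1 1 (int k) (subst2 (X2 + lift1 g) (aff s t c, aff s' t' c'))"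
    by (rule wle_subst2[OF f wle_aff wle_aff])
  show "wcomp 1 1 (int k) (subst2 (X2 + lift1 g) (aff s t c, aff s' t' c')) = const2 (lead_coeff g) * lform s t ^ k"
    unfolding wcomp_subst2[OF f wle_aff wle_aff] c by (simp add: wcomp_aff)
qed

text \<open>The counterpart for types IV and V: the term of top degree is a power of the linear form
  s X1 + t X2, and \<gamma> is its slope.\<close>

lemma lead_aff_shear:
  fixes g :: "'a::field_char_0 poly"
  assumes "2 \<le> degree g" "t \<noteq> 0"
  shows "lead 1 (degree g) (lead_coeff g * t ^ degree g) (s / t) (subst2 (X2 + lift1 g) (aff s t c, aff s' t' c'))"
  using wcomp_aff_shear[OF assms(1), of s t c s' t' c'] lform_eq[OF assms(2), of s]
  unfolding lead_def by (simp add: power_mult_distrib const2_power mult.assoc)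

lemma root_of_unity_inverse: "z ^ e = 1 \<Longrightarrow> 0 < e \<Longrightarrow> z * z ^ (e - 1) = (1 :: 'a::comm_ring_1)"
  by (simp flip: power_Suc)

context base_ring
begin

lemma affs_is_affine: "\<phi> \<in> affs \<Longrightarrow> is_affine R \<phi>"
proof -
  assume \<phi>: "\<phi> \<in> affs"
  then obtain a b c a' b' c' r where "\<phi> = (aff a b c, aff a' b' c')" "r * (a * b' - b * a') = 1"
    by (blast elim: affsE)
  moreover from this have "a \<noteq> 0 \<or> b \<noteq> 0" "a' \<noteq> 0 \<or> b' \<noteq> 0" by auto
  ultimately show ?thesis using affs_is_aut[OF \<phi>] by (simp add: is_affine_def total_deg_aff)
qed

end

lemma affine_UNIV:
  fixes \<tau> :: "'a::field_char_0 poly poly \<times> 'a poly poly"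
  assumes "is_affine UNIV \<tau>"
  obtains a b c a' b' c' where "\<tau> = (aff a b c, aff a' b' c')" "a * b' - b * a' \<noteq> 0"
proof -
  interpret U: base_ring "UNIV :: 'a set" by unfold_locales auto
  obtain a b c a' b' c' r where "\<tau> = (aff a b c, aff a' b' c')" "r * (a * b' - b * a') = 1"
    using U.affine_affs[OF assms] by (blast elim: U.affsE)
  then show thesis using that[of a b c a' b' c'] by fastforce
qed

lemma affine_UNIV_I:
  fixes a :: "'a::field_char_0"
  shows "a * b' - b * a' \<noteq> 0 \<Longrightarrow> is_affine UNIV (aff a b c, aff a' b' c')"
proof -
  interpret U: base_ring "UNIV :: 'a set" by unfold_locales auto
  assume "a * b' - b * a' \<noteq> 0"
  then show ?thesis by (intro U.affs_is_affine U.affsI[where r = "1 / (a * b' - b * a')"]) auto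
qed

context base_ring
begin

lemma affs_tame: "\<phi> \<in> affs \<Longrightarrow> \<phi> \<in> tame R"
  using tame.tame_gen[OF tame_id, of R \<phi>] affs_is_affine by (simp add: tame_gen_def)

lemma tris_tame:
  assumes "\<phi> \<in> tris"
  shows "\<phi> \<in> tame R"
proof -
  obtain u b v p u' v' where \<phi>: "\<phi> = (aff u 0 b, const2 v * X2 + lift1 p)"
    "u \<in> R" "b \<in> R" "v \<in> R" "polyR p" "u' \<in> R" "u * u' = 1" "v' \<in> R" "v * v' = 1"
    using assms by (rule trisE)
  let ?l = "[:- (u' * b), u':]"
  let ?A = "(aff u 0 b, const2 1 * X2 + lift1 0)"
  let ?B = "(aff 1 0 0, const2 v * X2 + lift1 (pcompose p ?l))"
  have A: "?A \<in> tris" using \<phi> by (intro trisI[where u' = u' and v' = 1]) auto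
  have B: "?B \<in> tris" using \<phi> by (intro trisI[where u' = 1 and v' = v']) (auto intro!: polyR_pcompose R_uminus)
  have "is_elementary R ?A" using tris_is_aut[OF A] by (simp add: is_elementary_def)
  moreover have "is_elementary R ?B" using tris_is_aut[OF B] by (simp add: is_elementary_def X1_eq_aff)
  ultimately have "comp2 (comp2 id2 ?A) ?B \<in> tame R"
    by (intro tame.tame_gen tame_id) (simp_all add: tame_gen_def)
  moreover have "pcompose (pcompose p ?l) [:b, u:] = p"
  proof -
    have "pcompose ?l [:b, u:] = [:0, 1:]" using \<phi>(7) by (simp add: pcompose_pCons mult.commute)
    then show ?thesis by (simp add: pcompose_idR flip: pcompose_assoc)
  qed
  then have "comp2 ?A ?B = \<phi>" unfolding comp2_def \<phi>(1) fst_conv snd_conv subst2_tri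
    by (simp add: aff_def)
  ultimately show ?thesis by simp
qed

lemma Hgrp_nontrivial: "\<sigma> \<in> tame R \<Longrightarrow> subst2 f \<sigma> = f \<Longrightarrow> \<sigma> \<noteq> id2 \<Longrightarrow> Hgrp R f \<noteq> {id2}"
  by (auto simp: Hgrp_def)

lemma lead_conditions:
  assumes fR: "in_R R f" and l: "lead d n c \<gamma> f" and c: "c \<noteq> 0" and n: "1 \<le> n" and d: "1 \<le> d" and g0: "\<gamma> \<noteq> 0"
    and red: "\<And>\<tau>. \<tau> \<in> tame R \<Longrightarrow> deg_x1 f + deg_x2 f \<le> deg_x1 (subst2 f \<tau>) + deg_x2 (subst2 f \<tau>)"
  shows "tamely_reduced R f \<and> deg_x1 f \<ge> deg_x2 f \<and> deg_x2 f \<ge> 1"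
proof -
  have df: "deg_x1 f = n * d" "deg_x2 f = n" using lead_deg[OF l] d c g0 by auto
  moreover have "f \<noteq> const2 k" for k using df n by (auto simp: deg_x2_def const2_def)
  ultimately show ?thesis using fR red n d by (auto simp: tamely_reduced_def)
qed

lemma lead_conditions_ge2:
  assumes "in_R R f" "lead d n c \<gamma> f" "c \<noteq> 0" "1 \<le> n" "2 \<le> d" "\<gamma> \<notin> R"
  shows "tamely_reduced R f \<and> deg_x1 f \<ge> deg_x2 f \<and> deg_x2 f \<ge> 1"
  using assms by (intro lead_conditions[OF assms(1,2,3,4)] lead_tame(1)[of d n c \<gamma>]) auto

lemma lead_conditions_1:
  assumes "in_R R f" "lead 1 n c \<gamma> f" "c \<noteq> 0" "1 \<le> n" "\<gamma> \<noteq> 0" "\<gamma> \<notin> Vset R"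
  shows "tamely_reduced R f \<and> deg_x1 f \<ge> deg_x2 f \<and> deg_x2 f \<ge> 1"
  using assms by (intro lead_conditions[OF assms(1,2,3,4)] lead1_tame(1)[of n c \<gamma>]) auto

text \<open>Modulo a the argument does not change, so g(x + a) - g(x) is divisible by a, with
  quotient over R.\<close>

lemma shift_difference:
  assumes "polyR g" "a \<in> R"
  shows "\<exists>q. polyR q \<and> pcompose g [:a, 1:] = g + smult a q"
  using assms(1)
proof (induction g)
  case 0
  show ?case by (rule exI[of _ 0]) simp
next
  case (pCons c g)
  then obtain q where q: "polyR q" "pcompose g [:a, 1:] = g + smult a q" by auto
  have "pcompose (pCons c g) [:a, 1:] = pCons c g + smult a (g + [:0, 1:] * q + smult a q)"
    by (simp add: pcompose_pCons q(2) algebra_simps smult_add_right)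
  moreover have "polyR (g + [:0, 1:] * q + smult a q)"
    using pCons.prems q assms(2) by (intro polyR_add polyR_mult polyR_smult) auto
  ultimately show ?case by blast
qed

lemma typeI_conditions:
  assumes fR: "in_R R f" and "typeI R f"
  shows "Hgrp R f \<noteq> {id2} \<and> tamely_reduced R f \<and> deg_x1 f \<ge> deg_x2 f \<and> deg_x2 f \<ge> 1"
proof -
  obtain a g where a: "a \<in> R" "a \<noteq> 0" and g: "polyR g" "2 \<le> degree g" "lead_coeff g \<notin> {a * r | r. r \<in> R}"
    and f: "f = const2 a * X2 + lift1 g" using assms(2) by (auto simp: typeI_def polyR_def)
  have "lead (degree g) (degree [:0, 1 :: 'a:]) (lead_coeff [:0, 1:] * a ^ degree [:0, 1 :: 'a:]) (lead_coeff g / a) f"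
    using lead_poly_shear[OF a(2) g(2), of "[:0, 1:]" 0] by (simp add: f)
  then have l: "lead (degree g) 1 a (lead_coeff g / a) f" by simp
  have "lead_coeff g = a * (lead_coeff g / a)" using a by simp
  then have "lead_coeff g / a \<notin> R" using g(3) by blast
  note cond = lead_conditions_ge2[OF fR l a(2) _ g(2) this]
  obtain q where q: "polyR q" "pcompose g [:a, 1:] = g + smult a q" using shift_difference[OF g(1) a(1)] by blast
  \<comment> \<open>Moving X1 by a changes g by a * q, and moving X2 by - q changes a * X2 by the
    opposite amount.\<close>
  let ?\<sigma> = "(aff 1 0 a, const2 1 * X2 + lift1 (- q))"
  have "Hgrp R f \<noteq> {id2}"
  proof (rule Hgrp_nontrivial)
    show "?\<sigma> \<in> tame R" using a q by (intro tris_tame trisI[where u' = 1 and v' = 1]) auto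
    show "subst2 f ?\<sigma> = f" unfolding f subst2_tri q(2) by (simp add: lift1_smult algebra_simps)
    show "?\<sigma> \<noteq> id2" using a by (simp add: id2_eq_aff)
  qed
  then show ?thesis using cond by simp
qed

lemma ev_pcompose:
  "ev (pcompose q m) P = ev q (ev m P)"
  by (induction q) (simp_all add: pcompose_pCons ev_add ev_mult)

lemma ev_monom: "ev (monom c e) P = const2 c * P ^ e"
  by (induction e) (simp_all add: monom_0 monom_Suc algebra_simps)

lemma typeII_conditions:
  assumes fR: "in_R R f" and "typeII R f"
  shows "Hgrp R f \<noteq> {id2} \<and> tamely_reduced R f \<and> deg_x1 f \<ge> deg_x2 f \<and> deg_x2 f \<ge> 1"
proof -
  obtain a' h z and e :: nat and g q where
    a': "a' \<noteq> 0" "z \<in> R" "z \<noteq> 1" "e \<ge> 2" "z ^ e = 1" and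
    g: "polyR g" "degree g \<ge> 2" "lead_coeff g \<notin> {(z - 1) * r | r. r \<in> R}" and
    q: "\<forall>i. coeff q i \<in> loc R z" and
    h: "h = ev q ((const2 (z - 1) * X2 + lift1 g) ^ e)" "\<not> (\<exists>c\<in>loc R z. h = const2 c)" and
    f: "f = const2 a' * X1 + h"
    using assms(2) unfolding typeII_def polyR_def by blast
  let ?y = "const2 (z - 1) * X2 + lift1 g"
  define Q where "Q = pcompose q (monom 1 e)"
  have hQ: "h = ev Q ?y"
    unfolding h Q_def ev_pcompose ev_monom by simp
  have "degree q \<noteq> 0"
  proof
    assume "degree q = 0"
    then have "q = [:coeff q 0:]" by (metis degree_eq_zeroE coeff_pCons_0)
    then have "h = const2 (coeff q 0)" unfolding h by (metis add.right_neutral mult_zero_right ev_simps)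
    then show False using h(2) q by blast
  qed
  then have dQ: "1 \<le> degree Q" using a' by (simp add: Q_def degree_pcompose degree_monom_eq)
  then have "Q \<noteq> 0" by auto
  have z1: "z - 1 \<noteq> 0" using a' by simp
  note l = lead_poly_shear[OF z1 g(2) dQ, of a', folded hQ, folded f]
  have "lead_coeff g = (z - 1) * (lead_coeff g / (z - 1))" using z1 by simp
  then have "lead_coeff g / (z - 1) \<notin> R" using g(3) by blast
  note cond = lead_conditions_ge2[OF fR l _ dQ g(2) this]
  \<comment> \<open>This map multiplies y = (z - 1) X2 + g by z, because (z - 1)(z X2 + g) + g = z
    y; the polynomial h in y^e is unchanged as z^e = 1.\<close>
  let ?\<sigma> = "(aff 1 0 0, const2 z * X2 + lift1 g)"
  have "Hgrp R f \<noteq> {id2}"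
  proof (rule Hgrp_nontrivial)
    show "?\<sigma> \<in> tame R"
      using a' g root_of_unity_inverse[of z e]
      by (intro tris_tame trisI[where u' = 1 and v' = "z ^ (e - 1)"]) auto
    have y: "subst2 ?y ?\<sigma> = const2 z * ?y"
      unfolding subst2_tri by (simp add: pcompose_idR algebra_simps)
    have "const2 z ^ e = (1 :: 'a poly poly)" using a'(5) by (simp flip: const2_power)
    then have "subst2 h ?\<sigma> = h" unfolding h subst2_poly_const2 subst2_power y by (simp add: power_mult_distrib)
    then show "subst2 f ?\<sigma> = f" by (simp add: f X1_eq_aff[symmetric])
    have "cf (snd ?\<sigma>) 0 1 = z" by (simp add: cf_const2_mult cf_X2 cf_lift1)
    moreover have "cf (snd id2) 0 1 = (1 :: 'a)" by (simp add: cf_X2)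
    ultimately show "?\<sigma> \<noteq> id2" using a'(3) by metis
  qed
  then show ?thesis using cond \<open>Q \<noteq> 0\<close> z1 by simp
qed

lemma typeIII_conditions:
  assumes fR: "in_R R f" and "typeIII R f"
  shows "Hgrp R f \<noteq> {id2} \<and> tamely_reduced R f \<and> deg_x1 f \<ge> deg_x2 f \<and> deg_x2 f \<ge> 1"
proof -
  obtain a1 a2 b where a: "a1 \<in> R" "a1 \<noteq> 0" "a2 \<in> R" "a2 \<noteq> 0" "b \<in> R" "a1 / a2 \<notin> Vset R"
    and f: "f = aff a1 a2 b" using assms(2) by (auto simp: typeIII_def aff_def)
  have l: "lead 1 1 a2 (a1 / a2) f"
    using lform_eq[OF a(4), of a1] by (simp add: lead_def f wle_aff wcomp_aff)
  note cond = lead_conditions_1[OF fR l a(4) _ _ a(6)]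
  \<comment> \<open>The translation along the kernel of the linear part of f.\<close>
  let ?\<sigma> = "(aff 1 0 a2, aff 0 1 (- a1))"
  have "Hgrp R f \<noteq> {id2}"
  proof (rule Hgrp_nontrivial)
    show "?\<sigma> \<in> tame R" using a by (intro affs_tame affsI[where r = 1]) auto
    show "subst2 f ?\<sigma> = f" unfolding f subst2_aff_aff by simp
    show "?\<sigma> \<noteq> id2" using a by (simp add: id2_eq_aff)
  qed
  then show ?thesis using cond a by simp
qed

lemma typeV_conditions:
  assumes fR: "in_R R f" and "typeV R f"
  shows "Hgrp R f \<noteq> {id2} \<and> tamely_reduced R f \<and> deg_x1 f \<ge> deg_x2 f \<and> deg_x2 f \<ge> 1"
proof -
  obtain \<tau> g' and e' :: nat and \<alpha>0 \<alpha>1 \<alpha>2 \<beta>0 \<beta>1 \<beta>2 z where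
    \<tau>: "is_affine UNIV \<tau>" and g': "degree g' \<ge> 3" "e' \<ge> 2" "\<forall>i. coeff g' i \<noteq> 0 \<longrightarrow> e' dvd i \<and> i > 0" and
    t: "fst \<tau> = const2 \<alpha>1 * X1 + const2 \<alpha>2 * X2 + const2 \<alpha>0"
       "snd \<tau> = const2 \<beta>1 * X1 + const2 \<beta>2 * X2 + const2 \<beta>0" and
    \<alpha>: "\<alpha>1 \<noteq> 0" "\<alpha>2 \<noteq> 0" "\<alpha>1 / \<alpha>2 \<notin> Vset R" and z: "z \<in> R" "z \<noteq> 1" "z ^ e' = 1" and
    c: "\<forall>\<alpha>\<in>{\<alpha>0, \<alpha>1, \<alpha>2}. \<forall>\<beta>\<in>{\<beta>1, \<beta>2}. (z - 1) * \<alpha> * \<beta> / (\<alpha>1 * \<beta>2 - \<alpha>2 * \<beta>1) \<in> R" and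
    f: "f = subst2 (X2 + lift1 g') \<tau>"
    using assms(2) unfolding typeV_def by blast
  have \<tau>': "\<tau> = (aff \<alpha>1 \<alpha>2 \<alpha>0, aff \<beta>1 \<beta>2 \<beta>0)" using t by (simp add: aff_def prod_eq_iff)
  define \<Delta> where "\<Delta> = \<alpha>1 * \<beta>2 - \<alpha>2 * \<beta>1"
  have \<Delta>: "\<Delta> \<noteq> 0" using affine_UNIV[OF \<tau>] unfolding \<tau>' \<Delta>_def by (metis aff_eq_iff prod.inject)
  have g2: "2 \<le> degree g'" using g' by simp
  then have "g' \<noteq> 0" by auto
  have l: "lead 1 (degree g') (lead_coeff g' * \<alpha>2 ^ degree g') (\<alpha>1 / \<alpha>2) f"
    unfolding f \<tau>' by (rule lead_aff_shear[OF g2 \<alpha>(2)])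
  note cond = lead_conditions_1[OF fR l _ _ _ \<alpha>(3)]
  define k where "k = (z - 1) / \<Delta>"
  have k: "k * \<Delta> = z - 1" using \<Delta> by (simp add: k_def)
  have cR: "k * \<alpha> * \<beta> \<in> R" if "\<alpha> \<in> {\<alpha>0, \<alpha>1, \<alpha>2}" "\<beta> \<in> {\<beta>1, \<beta>2}" for \<alpha> \<beta>
    using bspec[OF bspec[OF c that(1)] that(2)] by (simp add: k_def \<Delta>_def)
  \<comment> \<open>With L = \<tau>(x1) this is x1 -> x1 + k \<beta>2 L and x2 -> x2 - k \<beta>1 L:
    it fixes \<tau>(x2) and sends L to (1 + k \<Delta>) L = z L. Condition (c) puts its coefficients
    into R.\<close>
  let ?\<sigma> = "(aff (1 + k * \<alpha>1 * \<beta>2) (k * \<alpha>2 * \<beta>2) (k * \<alpha>0 * \<beta>2),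
             aff (- (k * \<alpha>1 * \<beta>1)) (1 - k * \<alpha>2 * \<beta>1) (- (k * \<alpha>0 * \<beta>1)))"
  have det: "(1 + k * \<alpha>1 * \<beta>2) * (1 - k * \<alpha>2 * \<beta>1) - k * \<alpha>2 * \<beta>2 * - (k * \<alpha>1 * \<beta>1) = z"
    using k unfolding \<Delta>_def by algebra
  have "Hgrp R f \<noteq> {id2}"
  proof (rule Hgrp_nontrivial)
    show "?\<sigma> \<in> tame R"
    proof (intro affs_tame affsI[where r = "z ^ (e' - 1)"])
      show "z ^ (e' - 1) * ((1 + k * \<alpha>1 * \<beta>2) * (1 - k * \<alpha>2 * \<beta>1) - k * \<alpha>2 * \<beta>2 * - (k * \<alpha>1 * \<beta>1)) = 1"
        unfolding det using root_of_unity_inverse[OF z(3)] g' by (simp add: mult.commute)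
    qed (use cR z in auto)
    have 1: "subst2 (aff \<alpha>1 \<alpha>2 \<alpha>0) ?\<sigma> = const2 z * aff \<alpha>1 \<alpha>2 \<alpha>0"
    proof -
      have "subst2 (aff \<alpha>1 \<alpha>2 \<alpha>0) ?\<sigma> = aff (z * \<alpha>1) (z * \<alpha>2) (z * \<alpha>0)"
        unfolding subst2_aff_aff aff_eq_iff using k unfolding \<Delta>_def by - (intro conjI; algebra)
      then show ?thesis by (simp add: aff_def algebra_simps)
    qed
    have 2: "subst2 (aff \<beta>1 \<beta>2 \<beta>0) ?\<sigma> = aff \<beta>1 \<beta>2 \<beta>0"
      unfolding subst2_aff_aff by (simp add: algebra_simps)
    have g'z: "pcompose g' [:0, z:] = g'"
    proof (rule poly_eqI)
      fix i
      have "coeff g' i \<noteq> 0 \<Longrightarrow> z ^ i = 1" using g'(3) z(3) by (metis dvdE power_mult power_one)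
      then show "coeff (pcompose g' [:0, z:]) i = coeff g' i" by (auto simp: coeff_pcompose_linear)
    qed
    have "ev g' (const2 z * W) = ev g' W" for W
      using ev_pcompose[of g' "[:0, z:]" W] unfolding g'z by (simp add: mult.commute)
    then have "ev g' (subst2 (aff \<alpha>1 \<alpha>2 \<alpha>0) ?\<sigma>) = ev g' (aff \<alpha>1 \<alpha>2 \<alpha>0)"
      unfolding 1 .
    then show "subst2 f ?\<sigma> = f" unfolding f \<tau>'
      by (simp only: subst2_add subst2_X2 subst2_lift1 subst2_poly_const2 snd_conv fst_conv 2)
    show "?\<sigma> \<noteq> id2"
    proof
      assume "?\<sigma> = id2"
      then have "k * \<alpha>1 * \<beta>2 = 0" "k * \<alpha>2 * \<beta>1 = 0" by (simp_all add: id2_eq_aff)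
      then have "k * \<Delta> = 0" unfolding \<Delta>_def by algebra
      then show False using k z by simp
    qed
  qed
  then show ?thesis using cond \<open>g' \<noteq> 0\<close> \<alpha> g2 by simp
qed

lemma common_denominator:
  assumes frac: "\<And>k. \<exists>a\<in>R. \<exists>b\<in>R. b \<noteq> 0 \<and> k = a / b" and "finite S"
  shows "\<exists>s\<in>R. s \<noteq> 0 \<and> (\<forall>x\<in>S. s * x \<in> R)"
  using assms(2)
proof (induction S)
  case empty
  show ?case by (rule bexI[of _ 1]) auto
next
  case (insert x S)
  then obtain s where s: "s \<in> R" "s \<noteq> 0" "\<forall>x\<in>S. s * x \<in> R" by blast
  obtain a b where ab: "a \<in> R" "b \<in> R" "b \<noteq> 0" "x = a / b" using frac by blast
  have "s * b * y \<in> R" if "y \<in> S" for y using s that ab by (metis R_mult mult.assoc mult.commute)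
  moreover have "s * b * x \<in> R" using s ab by auto
  ultimately show ?case using s ab by (intro bexI[of _ "s * b"]) auto
qed

lemma typeIV_conditions:
  assumes frac: "\<And>k. \<exists>a\<in>R. \<exists>b\<in>R. b \<noteq> 0 \<and> k = a / b"
    and fR: "in_R R f" and "typeIV R f"
  shows "Hgrp R f \<noteq> {id2} \<and> tamely_reduced R f \<and> deg_x1 f \<ge> deg_x2 f \<and> deg_x2 f \<ge> 1"
proof -
  obtain a \<tau> \<alpha>1 \<alpha>2 where a: "a \<in> R" "a \<noteq> 0" and \<tau>: "is_affine UNIV \<tau>" and
    t: "fst \<tau> = const2 \<alpha>1 * X1 + const2 \<alpha>2 * X2" and
    \<alpha>: "\<alpha>1 \<noteq> 0" "\<alpha>2 \<noteq> 0" "\<alpha>1 / \<alpha>2 \<notin> Vset R" and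
    f: "f = const2 a * (fst \<tau>) ^ 2 + snd \<tau>"
    using assms(3) by (auto simp: typeIV_def)
  have "fst \<tau> = aff \<alpha>1 \<alpha>2 0" using t by (simp add: aff_def)
  then obtain \<beta>1 \<beta>2 \<beta>0 where \<tau>': "\<tau> = (aff \<alpha>1 \<alpha>2 0, aff \<beta>1 \<beta>2 \<beta>0)" and "\<alpha>1 * \<beta>2 - \<alpha>2 * \<beta>1 \<noteq> 0"
    using affine_UNIV[OF \<tau>] by (metis aff_eq_iff fst_conv)
  define \<Delta> where "\<Delta> = \<alpha>1 * \<beta>2 - \<alpha>2 * \<beta>1"
  have \<Delta>: "\<Delta> \<noteq> 0" using \<open>\<alpha>1 * \<beta>2 - \<alpha>2 * \<beta>1 \<noteq> 0\<close> by (simp add: \<Delta>_def)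
  have f': "f = subst2 (X2 + lift1 (monom a 2)) \<tau>" by (simp add: f lift1_monom add.commute)
  have dm: "degree (monom a 2) = 2" using a by (simp add: degree_monom_eq)
  have l: "lead 1 2 (a * \<alpha>2 ^ 2) (\<alpha>1 / \<alpha>2) f"
    using lead_aff_shear[of "monom a 2" \<alpha>2 \<alpha>1 0 \<beta>1 \<beta>2 \<beta>0, unfolded dm] \<alpha> by (simp add: f' \<tau>')
  note cond = lead_conditions_1[OF fR l _ _ _ \<alpha>(3)]
  \<comment> \<open>The map sought sends L = \<tau>(x1) to L + t and \<tau>(x2) to \<tau>(x2) - a t
    (2 L + t), which leaves a L^2 + \<tau>(x2) unchanged. A common denominator t makes its
    coefficients lie in R.\<close>
  obtain t where t: "t \<in> R" "t \<noteq> 0" and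
    tS: "\<forall>x\<in>{2 * a * \<alpha>2 * \<alpha>1 / \<Delta>, 2 * a * \<alpha>2 * \<alpha>2 / \<Delta>, 2 * a * \<alpha>1 * \<alpha>1 / \<Delta>, \<beta>2 / \<Delta>, \<beta>1 / \<Delta>, \<alpha>2 * a / \<Delta>, \<alpha>1 * a / \<Delta>}. t * x \<in> R"
    using common_denominator[OF frac, of "{2 * a * \<alpha>2 * \<alpha>1 / \<Delta>, 2 * a * \<alpha>2 * \<alpha>2 / \<Delta>, 2 * a * \<alpha>1 * \<alpha>1 / \<Delta>, \<beta>2 / \<Delta>, \<beta>1 / \<Delta>, \<alpha>2 * a / \<Delta>, \<alpha>1 * a / \<Delta>}"]
    by blast
  define k where "k = t / \<Delta>"
  have k: "k * \<Delta> = t" using \<Delta> by (simp add: k_def)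
  have kR: "k * (2 * a * \<alpha>2 * \<alpha>1) \<in> R" "k * (2 * a * \<alpha>2 * \<alpha>2) \<in> R" "k * (2 * a * \<alpha>1 * \<alpha>1) \<in> R"
     "k * \<beta>2 \<in> R" "k * \<beta>1 \<in> R" "k * (\<alpha>2 * a) \<in> R" "k * (\<alpha>1 * a) \<in> R"
    using tS by (simp_all add: k_def)
  \<comment> \<open>The solution of these two conditions for x1 and x2 by Cramer's rule: x1 -> x1 +
    k \<beta>2 + k \<alpha>2 a (2 L + t) and x2 -> x2 - k \<beta>1 - k \<alpha>1 a (2 L +
    t).\<close>
  let ?\<sigma> = "(aff (1 + k * (2 * a * \<alpha>2 * \<alpha>1)) (k * (2 * a * \<alpha>2 * \<alpha>2)) (k * \<beta>2 + k * (\<alpha>2 * a) * t),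
             aff (- (k * (2 * a * \<alpha>1 * \<alpha>1))) (1 - k * (2 * a * \<alpha>2 * \<alpha>1)) (- (k * \<beta>1) - k * (\<alpha>1 * a) * t))"
  have "Hgrp R f \<noteq> {id2}"
  proof (rule Hgrp_nontrivial)
    show "?\<sigma> \<in> tame R"
    proof (intro affs_tame affsI[where r = 1])
      show "1 * ((1 + k * (2 * a * \<alpha>2 * \<alpha>1)) * (1 - k * (2 * a * \<alpha>2 * \<alpha>1)) - k * (2 * a * \<alpha>2 * \<alpha>2) * - (k * (2 * a * \<alpha>1 * \<alpha>1))) = 1"
        by algebra
    qed (use kR t in auto)
    have 1: "subst2 (aff \<alpha>1 \<alpha>2 0) ?\<sigma> = aff \<alpha>1 \<alpha>2 t"
      unfolding subst2_aff_aff aff_eq_iff k[symmetric] \<Delta>_def by (simp add: algebra_simps)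
    have 2: "subst2 (aff \<beta>1 \<beta>2 \<beta>0) ?\<sigma> = aff (\<beta>1 - 2 * a * t * \<alpha>1) (\<beta>2 - 2 * a * t * \<alpha>2) (\<beta>0 - a * t * t)"
      unfolding subst2_aff_aff aff_eq_iff k[symmetric] \<Delta>_def by (simp add: algebra_simps)
    have "const2 a * aff \<alpha>1 \<alpha>2 t ^ 2 + aff (\<beta>1 - 2 * a * t * \<alpha>1) (\<beta>2 - 2 * a * t * \<alpha>2) (\<beta>0 - a * t * t)
       = const2 a * aff \<alpha>1 \<alpha>2 0 ^ 2 + aff \<beta>1 \<beta>2 \<beta>0"
    proof -
      have two: "const2 2 = (2 :: 'a poly poly)" by (metis const2_simps(2,3) one_add_one)
      show ?thesis by (simp add: aff_def power2_eq_square algebra_simps two)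
    qed
    then show "subst2 f ?\<sigma> = f" unfolding f \<tau>'
      by (simp only: subst2_add subst2_mult subst2_power subst2_const2 fst_conv snd_conv 1 2)
    show "?\<sigma> \<noteq> id2"
    proof
      assume "?\<sigma> = id2"
      then have "aff \<alpha>1 \<alpha>2 t = aff \<alpha>1 \<alpha>2 0" using 1 by simp
      then show False using t by simp
    qed
  qed
  then show ?thesis using cond \<alpha> a by simp
qed

end

subsection \<open>Coordinates satisfying the conditions are of one of the five types\<close>

lemma root_of_unity_order:
  fixes v :: "'a::idom"
  assumes "v ^ n = 1" "0 < n" "v \<noteq> 1"
  shows "\<exists>e\<ge>2. v ^ e = 1 \<and> (\<forall>i. v ^ i = 1 \<longrightarrow> e dvd i)"
proof -
  define e where "e = (LEAST e. 0 < e \<and> v ^ e = 1)"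
  have e: "0 < e \<and> v ^ e = 1" unfolding e_def by (rule LeastI[of _ n]) (use assms in simp)
  have "e \<noteq> 1" using e assms by auto
  moreover have "e dvd i" if i: "v ^ i = 1" for i
  proof (rule ccontr)
    assume "\<not> e dvd i"
    then have "0 < i mod e" by (simp add: mod_greater_zero_iff_not_dvd)
    moreover have "v ^ (i mod e) = 1"
      using i e power_add[of v "e * (i div e)" "i mod e"] by (simp add: power_mult)
    ultimately have "e \<le> i mod e" unfolding e_def by (intro Least_le) simp
    then show False using e by (meson mod_less_divisor not_le)
  qed
  ultimately show ?thesis using e by (intro exI[of _ e]) auto
qed

text \<open>The factor c serves the change from the monic eigenvector X2 + p / (v - 1) to its
  multiple y2 by v - 1, so that the result is a polynomial in y2^e.\<close>

lemma poly_in_power: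
  fixes h :: "'a::field_char_0 poly"
  assumes "0 < e" and dvd: "\<And>i. coeff h i \<noteq> 0 \<Longrightarrow> e dvd i" and c: "c \<noteq> 0"
  shows "\<exists>q. h = pcompose q (monom c e) \<and> (\<forall>i. coeff q i = coeff h (e * i) / c ^ i)"
proof -
  define q where "q = (\<Sum>i\<le>degree h. monom (coeff h (e * i) / c ^ i) i)"
  have cq: "coeff q i = coeff h (e * i) / c ^ i" for i
  proof (cases "i \<le> degree h")
    case False
    have "i \<le> e * i" using \<open>0 < e\<close> by simp
    then have "degree h < e * i" using False by linarith
    then show ?thesis using False by (simp add: q_def coeff_sum coeff_eq_0)
  qed (simp add: q_def coeff_sum)
  have "pcompose (monom a i) m = smult a (m ^ i)" for a i and m :: "'a poly"
    by (induction i) (simp_all add: monom_0 monom_Suc pcompose_pCons)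
  then have "pcompose q (monom c e) = (\<Sum>i\<le>degree h. monom (coeff h (e * i)) (e * i))"
    unfolding q_def by (simp add: pcompose_sum monom_power smult_monom c mult.commute)
  also have "\<dots> = h"
  proof (rule poly_eqI)
    fix j
    show "coeff (\<Sum>i\<le>degree h. monom (coeff h (e * i)) (e * i)) j = coeff h j"
    proof (cases "coeff h j = 0")
      case True
      then show ?thesis by (auto simp: coeff_sum intro!: sum.neutral)
    next
      case False
      then obtain k where k: "j = e * k" using dvd[OF False] by (elim dvdE)
      have "k \<le> j" using \<open>0 < e\<close> by (simp add: k)
      then have "k \<in> {..degree h}" using le_degree[OF False] by simp
      have "coeff (\<Sum>i\<le>degree h. monom (coeff h (e * i)) (e * i)) j = (\<Sum>i\<le>degree h. if i = k then coeff h j else 0)"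
        unfolding coeff_sum using \<open>0 < e\<close> by (intro sum.cong) (auto simp: k)
      then show ?thesis using \<open>k \<in> {..degree h}\<close> by simp
    qed
  qed
  finally show ?thesis using cq by metis
qed

lemma cf_lform_power_1:
  fixes s t :: "'a::comm_ring_1"
  assumes "0 < n"
  shows "cf (lform s t ^ n) 1 (n - 1) = of_nat n * t ^ (n - 1) * s"
proof -
  have X2n: "X2 ^ n = (monom 1 n :: 'a poly poly)"
    by (induction n) (simp_all add: X2_def monom_Suc)
  have "lform s t ^ n = subst2 (X2 ^ n) (lift1 [:0, 1:], const2 t * X2 + lift1 [:0, s:])"
    by (simp add: lform_def lift1_linear aff_def add.commute)
  moreover have "n \<noteq> n - Suc 0" using assms by simp
  ultimately have "coeff (lform s t ^ n) (n - 1) = smult (t ^ (n - 1)) (of_nat n * [:0, s:])"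
    using shift_coeff[of "X2 ^ n" n "[:0, 1:]" t "[:0, s:]"] assms
      \<open>n \<noteq> n - Suc 0\<close> by (simp add: X2n degree_monom_eq pcompose_1)
  then show ?thesis by (simp add: of_nat_poly algebra_simps)
qed

text \<open>The coefficients at X2^n and X1 * X2^(n - 1) already determine the slope of the linear
  form; division by n is possible in characteristic 0.\<close>

lemma lform_power_eqD:
  fixes s t :: "'a::field_char_0"
  assumes eq: "const2 k * lform s t ^ n = const2 c * lform \<gamma> 1 ^ n" and n: "1 \<le> n" and c: "c \<noteq> 0"
  shows "t \<noteq> 0 \<and> s = \<gamma> * t \<and> k * t ^ n = c"
proof -
  have 0: "k * t ^ n = c"
    using arg_cong[OF eq, of "\<lambda>p. cf p 0 n"] by (simp add: cf_const2_mult cf_lform_power)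
  have "k * (of_nat n * t ^ (n - 1) * s) = c * (of_nat n * \<gamma>)"
  proof -
    have n0: "0 < n" using n by simp
    have "cf (const2 k * lform s t ^ n) 1 (n - 1) = cf (const2 c * lform \<gamma> 1 ^ n) 1 (n - 1)" using eq by simp
    then have "k * (of_nat n * t ^ (n - 1) * s) = c * (of_nat n * 1 ^ (n - 1) * \<gamma>)"
      by (simp only: cf_const2_mult cf_lform_power_1[OF n0])
    then show ?thesis by simp
  qed
  then have "of_nat n * (k * t ^ (n - 1) * s) = of_nat n * (c * \<gamma>)" by (simp add: algebra_simps)
  then have 1: "k * t ^ (n - 1) * s = c * \<gamma>" using n by (subst (asm) mult_cancel_left) auto
  have "t \<noteq> 0" using 0 c n by auto
  have "k * t ^ n * s = c * \<gamma> * t" using 1 n by (cases n) (auto simp: algebra_simps)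
  then have "c * s = c * (\<gamma> * t)" using 0 by simp
  then show ?thesis using 0 c \<open>t \<noteq> 0\<close> by simp
qed

lemma degree_poly_const2_shear:
  fixes h :: "'a::field poly"
  shows "degree (ev h (X2 + lift1 p)) = degree h"
proof -
  have "ev h (X2 + lift1 p) = pcompose (map_poly (\<lambda>c. [:c:]) h) [:p, 1:]"
    by (induction h) (simp_all add: map_poly_pCons pcompose_pCons const2_def X2_def lift1_def)
  then show ?thesis by (simp add: degree_pcompose degree_map_poly)
qed

lemma poly_const2_X2: "cf (ev h X2) i j = (if i = 0 then coeff h j else 0)"
proof -
  have "ev h X2 = map_poly (\<lambda>c. [:c:]) h"
    by (induction h) (simp_all add: map_poly_pCons const2_def X2_def)
  then show ?thesis by (simp add: coeff_map_poly coeff_pCons split: nat.split)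
qed

section \<open>Consequences of reducedness, and types I and II\<close>

context base_ring
begin

lemma loc_base_ring:
  assumes z: "z \<in> R" "z \<noteq> 1"
  shows "base_ring (loc R z)"
proof
  have ex: "r / (z - 1) ^ k \<in> loc R z" if "r \<in> R" for r k using that by (auto simp: loc_def)
  show "0 \<in> loc R z" "1 \<in> loc R z" using ex[of 0 0] ex[of 1 0] by auto
  fix x y assume "x \<in> loc R z" "y \<in> loc R z"
  then obtain r k s l where x: "r \<in> R" "x = r / (z - 1) ^ k" and y: "s \<in> R" "y = s / (z - 1) ^ l"
    by (auto simp: loc_def)
  have z1: "z - 1 \<noteq> 0" "z - 1 \<in> R" using z by auto
  have "x + y = (r * (z - 1) ^ l + s * (z - 1) ^ k) / (z - 1) ^ (k + l)"
    using z1 by (simp add: x y power_add field_simps)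
  then show "x + y \<in> loc R z" using ex[of "r * (z - 1) ^ l + s * (z - 1) ^ k"] x y z1 by auto
  have "x * y = (r * s) / (z - 1) ^ (k + l)" by (simp add: x y power_add)
  then show "x * y \<in> loc R z" using ex[OF R_mult[OF x(1) y(1)], of "k + l"] by simp
  have "- x = (- r) / (z - 1) ^ k" by (simp add: x)
  then show "- x \<in> loc R z" using ex[of "- r"] x by auto
qed

lemma R_subset_loc: "x \<in> R \<Longrightarrow> x \<in> loc R z"
  unfolding loc_def by (intro CollectI exI[of _ x] exI[of _ 0]) simp

lemma reduced_not_in_R:
  assumes red: "tamely_reduced R f" and l: "lead d n c \<gamma> f" and "c \<noteq> 0" "1 \<le> n" "2 \<le> d" "\<gamma> \<noteq> 0"
  shows "\<gamma> \<notin> R"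
proof
  assume \<gamma>: "\<gamma> \<in> R"
  \<comment> \<open>If \<gamma> lies in R, subtracting \<gamma> X1^d from X2 turns the leading form
    into c X2^n: the degree in X2 stays n and the degree in X1 drops below n d.\<close>
  let ?T = "(aff 1 0 0, const2 1 * X2 + lift1 (monom (- \<gamma>) d))"
  have "?T \<in> tris"
    using \<gamma> by (intro trisI[where u' = 1 and v' = 1]) (auto simp: polyR_def)
  then have le: "deg_x1 f + deg_x2 f \<le> deg_x1 (subst2 f ?T) + deg_x2 (subst2 f ?T)"
    using red tris_tame by (simp add: tamely_reduced_def)
  have df: "deg_x1 f = n * d" "deg_x2 f = n" using lead_deg[OF l] assms by auto
  have "lead d n (c * 1 ^ n) ((\<gamma> * 1 ^ d + coeff (monom (- \<gamma>) d) d) / 1) (subst2 f ?T)"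
    using assms by (intro lead_tri[OF l]) (auto simp: degree_monom_le)
  then have l': "lead d n c 0 (subst2 f ?T)" by simp
  have "deg_x2 (subst2 f ?T) = n" using lead_deg(1)[OF l'] assms by simp
  moreover have "deg_x1 (subst2 f ?T) \<le> n * d - 1"
    unfolding deg_x1_le_iff
  proof (intro allI impI)
    fix i j assume nz: "cf (subst2 f ?T) i j \<noteq> 0"
    have le: "i + d * j \<le> n * d" using lead_weight[OF l' nz] .
    have "i \<noteq> n * d"
    proof
      assume "i = n * d"
      then have "j = 0" using le assms by simp
      then show False using nz \<open>i = n * d\<close> lead_cf(2)[OF l'] assms by (simp add: zero_power)
    qed
    then show "i \<le> n * d - 1" using le by linarith
  qed
  moreover have "0 < n * d" using assms by simp
  ultimately show False using le df by linarith
qed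

lemma reduced_not_in_V:
  assumes red: "tamely_reduced R f" and l: "lead 1 n c \<gamma> f" and "c \<noteq> 0" "1 \<le> n" "\<gamma> \<noteq> 0"
  shows "\<gamma> \<notin> Vset R"
proof
  assume "\<gamma> \<in> Vset R"
  then obtain \<alpha> \<beta> s t where ab: "\<gamma> = \<alpha> / \<beta>" "\<alpha> \<in> R" "\<beta> \<in> R" "\<beta> \<noteq> 0" "s \<in> R" "t \<in> R" "\<alpha> * s + \<beta> * t = 1"
    by (auto simp: Vset_def)
  \<comment> \<open>The coprime pair completed to a matrix of determinant 1 that turns X2 + \<gamma>
    X1 into a multiple of X1, so the degree in X2 drops.\<close>
  let ?A = "(aff s (- \<beta>) 0, aff t \<alpha> 0)"
  have "?A \<in> affs" using ab by (intro affsI[where r = 1]) (auto simp: mult.commute add.commute)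
  then have le: "deg_x1 f + deg_x2 f \<le> deg_x1 (subst2 f ?A) + deg_x2 (subst2 f ?A)"
    using red affs_tame by (simp add: tamely_reduced_def)
  have df: "deg_x1 f = n" "deg_x2 f = n" using lead_deg[OF l] assms by auto
  have w: "wle 1 1 (int n) f" and cf: "wcomp 1 1 (int n) f = const2 c * (X2 + const2 \<gamma> * X1) ^ n"
    using l by (simp_all add: lead_def)
  let ?g = "subst2 f ?A"
  have wg: "wle 1 1 (int n) ?g" by (rule wle_subst2[OF w wle_aff wle_aff])
  have "wcomp 1 1 (int n) ?g = subst2 (const2 c * (X2 + const2 \<gamma> * X1) ^ n) (lform s (- \<beta>), lform t \<alpha>)"
    by (simp only: wcomp_subst2[OF w wle_aff wle_aff] cf wcomp_aff)
  also have "\<dots> = const2 c * lform (t + \<gamma> * s) (\<alpha> - \<gamma> * \<beta>) ^ n"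
    by (simp add: lform_def algebra_simps)
  also have "\<alpha> - \<gamma> * \<beta> = 0" using ab by simp
  also have "lform (t + \<gamma> * s) 0 = const2 (t + \<gamma> * s) * X1" by (simp add: lform_def)
  finally have cg: "wcomp 1 1 (int n) ?g = const2 (c * (t + \<gamma> * s) ^ n) * X1 ^ n"
    by (simp add: power_mult_distrib const2_power mult.assoc)
  have b: "i + j \<le> n \<and> j \<noteq> n" if nz: "cf ?g i j \<noteq> 0" for i j
  proof -
    have le: "i + j \<le> n" using wleD[OF wg nz] by simp
    moreover have "j \<noteq> n"
    proof
      assume "j = n"
      then have "i = 0" using le by simp
      have "cf ?g 0 n = cf (wcomp 1 1 (int n) ?g) 0 n" by (simp add: cf_wcomp)
      also have "\<dots> = 0"
        unfolding cg cf_const2_mult using cf_X1_power_X2_power[where ?'a = 'a, of n 0 n 0] \<open>1 \<le> n\<close> by simp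
      finally show False using nz \<open>i = 0\<close> \<open>j = n\<close> by simp
    qed
    ultimately show ?thesis by simp
  qed
  have "deg_x1 ?g \<le> n" unfolding deg_x1_le_iff using b add_leD1 by blast
  moreover have "deg_x2 ?g \<le> n - 1" unfolding deg_x2_le_iff
  proof (intro allI impI)
    fix i j assume "cf ?g i j \<noteq> 0"
    from b[OF this] show "j \<le> n - 1" by linarith
  qed
  ultimately show False using le df \<open>1 \<le> n\<close> by linarith
qed

text \<open>Here n = 1, and \<gamma> is the leading coefficient of h divided by a, so \<gamma>
  outside R is the condition on the leading coefficient.\<close>

lemma linear_shear_is_typeI:
  assumes fR: "in_R R f" and l: "lead d n c \<gamma> f" and c: "c \<noteq> 0" and d: "2 \<le> d" and \<gamma>: "\<gamma> \<notin> R"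
    and a: "a \<noteq> 0" and f: "f = const2 a * X2 + lift1 h"
  shows "typeI R f"
proof -
  have "\<gamma> \<noteq> 0" using \<gamma> by auto
  have df: "deg_x1 f = n * d" "deg_x2 f = n" using lead_deg[OF l] d c \<open>\<gamma> \<noteq> 0\<close> by auto
  have "n = 1" using df(2) a unfolding f pCons_two[symmetric] deg_x2_def by simp
  have cff: "cf f i j = (if i = 0 \<and> j = 1 then a else 0) + (if j = 0 then coeff h i else 0)" for i j
    by (simp add: f cf_const2_mult cf_X2 cf_lift1)
  have "c = a" "coeff h d = c * \<gamma>" using lead_cf[OF l] d \<open>n = 1\<close> by (simp_all add: cff)
  have "degree h \<le> d"
  proof (rule degree_le, intro allI impI)
    fix i assume "d < i"
    then have "cf f i 0 = 0" using cf_le_deg_x1[of f 0 i] df(1) \<open>n = 1\<close> by fastforce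
    then show "coeff h i = 0" by (simp add: cff)
  qed
  moreover have "coeff h d \<noteq> 0" using \<open>coeff h d = c * \<gamma>\<close> c \<open>\<gamma> \<noteq> 0\<close> by simp
  ultimately have dh: "degree h = d" using le_degree[of h d] by simp
  have "cf f i j \<in> R" for i j using fR by (auto simp: in_R_def)
  from this[of 1 0] this[of 0] have "a \<in> R" "\<And>i. coeff h i \<in> R" by (simp_all add: cff)
  moreover have "lead_coeff h \<notin> {a * r | r. r \<in> R}"
    using \<open>coeff h d = c * \<gamma>\<close> \<open>c = a\<close> a \<gamma> by (auto simp: dh)
  ultimately show ?thesis unfolding typeI_def using a d dh f by blast
qed

text \<open>The root of unity is the scaling factor v of the fixing map and g is its shift p.
  Reducedness supplies the condition on the leading coefficient of p, and invariance under z -> v z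
  restricts the exponents of h.\<close>

lemma fixed_shear_is_typeII:
  assumes fR: "in_R R f" and red: "tamely_reduced R f"
    and l: "lead d n c \<gamma> f" and c: "c \<noteq> 0" and n: "1 \<le> n" and d: "2 \<le> d" and \<gamma>: "\<gamma> \<noteq> 0"
    and v: "v \<in> R" "v \<noteq> 1" and p: "polyR p"
    and fixed: "subst2 f (X1, const2 v * X2 + lift1 p) = f"
    and a: "a \<noteq> 0" and f: "f = const2 a * X1 + ev h (X2 + lift1 (smult (1 / (v - 1)) p))"
  shows "typeII R f"
proof -
  define p0 where "p0 = smult (1 / (v - 1)) p"
  have v1: "v - 1 \<noteq> 0" using v by simp
  have p0: "p = smult (v - 1) p0" using v1 by (simp add: p0_def)
  let ?z = "X2 + lift1 p0" and ?y = "const2 (v - 1) * X2 + lift1 p"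
  have f': "f = const2 a * X1 + ev h ?z" using f by (simp add: p0_def)
  have yz: "?y = const2 (v - 1) * ?z" by (simp add: p0 lift1_smult algebra_simps)
  have df: "deg_x1 f = n * d" "deg_x2 f = n" using lead_deg[OF l] d c \<gamma> by auto
  have "degree (const2 a * X1 :: 'a poly poly) = 0" by (simp add: const2_def X1_def)
  then have "degree h \<noteq> 0"
    using degree_add_le[of "const2 a * X1" 0 "ev h ?z"] df n
    unfolding f'[symmetric] degree_poly_const2_shear deg_x2_def by fastforce
  define k where "k = degree h"
  have k: "1 \<le> k" using \<open>degree h \<noteq> 0\<close> by (simp add: k_def)
  have "degree f = degree h"
    unfolding f' using degree_add_eq_right[of "const2 a * X1" "ev h ?z"]
      \<open>degree (const2 a * X1) = 0\<close> \<open>degree h \<noteq> 0\<close> by (simp add: degree_poly_const2_shear)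
  then have kn: "k = n" using df by (simp add: k_def deg_x2_def)
  \<comment> \<open>With p of degree at most 1, f would have total degree at most n, but its degree
    in X1 is n d >= 2 n.\<close>
  have dp: "2 \<le> degree p"
  proof (rule ccontr)
    assume "\<not> 2 \<le> degree p"
    then have "degree p0 \<le> 1" by (simp add: p0_def)
    then have wz: "wle 1 1 1 ?z" using wle_lift1[of 1 p0 1 1] wle_X2[of 1 1] by (intro wle_add) simp_all
    have "wle 1 1 (1 * int k) (ev h ?z)" using wz by (rule wle_poly_const2) (simp_all add: k_def)
    moreover have "wle 1 1 1 (const2 a * X1)" by (intro wle_const2_mult wle_X1)
    ultimately have wf: "wle 1 1 (int k) f"
      unfolding f' using k wle_mono[of 1 1 1 "const2 a * X1" "int k"] by (intro wle_add) simp_all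
    have "deg_x1 f \<le> k" unfolding deg_x1_le_iff using wleD[OF wf] by fastforce
    moreover have "2 * n \<le> n * d" using d by simp
    ultimately show False using df kn n by linarith
  qed
  have lc: "lead_coeff p \<notin> {(v - 1) * r | r. r \<in> R}"
  proof
    assume "lead_coeff p \<in> {(v - 1) * r | r. r \<in> R}"
    then have "lead_coeff p / (v - 1) \<in> R" using v1 by auto
    moreover have "2 \<le> degree p0" using dp v by (simp add: p0_def)
    then have "lead (degree p0) k (lead_coeff h * 1 ^ k) (lead_coeff p0 / 1) f"
      using lead_poly_shear[of 1 p0 h a] k by (simp add: f' k_def)
    then have "lead (degree p) k (lead_coeff h) (lead_coeff p / (v - 1)) f" using v1 by (simp add: p0_def)
    then have "lead_coeff p / (v - 1) \<notin> R"
      by (rule reduced_not_in_R[OF red]) (use k dp v1 in \<open>auto simp: k_def\<close>)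
    ultimately show False by simp
  qed
  \<comment> \<open>Invariance reads h(v z) = h(z); the shear that maps z to X2 allows comparing
    coefficients.\<close>
  have hv: "v ^ i = 1" if "coeff h i \<noteq> 0" for i
  proof -
    have z: "subst2 ?z (X1, const2 v * X2 + lift1 p) = const2 v * ?z"
      by (simp add: subst2_lift1 p0 lift1_smult algebra_simps flip: lift1_eq_poly_X1)
    have "subst2 f (X1, const2 v * X2 + lift1 p) = const2 a * X1 + ev h (const2 v * ?z)"
      unfolding f'
      by (simp only: subst2_add[of "const2 a * X1"] subst2_mult subst2_const2 subst2_X1 fst_conv subst2_poly_const2 z)
    then have "ev h (const2 v * ?z) = ev h ?z"
      using fixed f' by simp
    then have "subst2 (ev h (const2 v * ?z)) (X1, X2 + lift1 (- p0))
        = subst2 (ev h ?z) (X1, X2 + lift1 (- p0))" by simp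
    then have "ev h (const2 v * X2) = ev h X2"
      by (simp add: subst2_lift1 flip: lift1_eq_poly_X1)
    then have "ev (pcompose h [:0, v:]) X2 = ev h X2"
      by (simp add: ev_pcompose mult.commute)
    then have "cf (ev (pcompose h [:0, v:]) X2) 0 i = cf (ev h X2) 0 i" by simp
    then show ?thesis using that by (simp add: poly_const2_X2 coeff_pcompose_linear)
  qed
  have "coeff h k \<noteq> 0" using k by (auto simp: k_def)
  obtain e where e: "2 \<le> e" "v ^ e = 1" "\<And>i. v ^ i = 1 \<Longrightarrow> e dvd i"
    using root_of_unity_order[OF hv[OF \<open>coeff h k \<noteq> 0\<close>]] k v by auto
  obtain q where q: "h = pcompose q (monom ((v - 1) ^ e) e)" "\<And>i. coeff q i = coeff h (e * i) / ((v - 1) ^ e) ^ i"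
    using poly_in_power[of e h "(v - 1) ^ e"] e hv v1 by auto
  have hq: "ev h ?z = ev q (?y ^ e)"
    unfolding yz by (subst q(1)) (simp add: ev_pcompose ev_monom power_mult_distrib const2_power)
  interpret L: base_ring "loc R v" using v by (rule loc_base_ring)
  \<comment> \<open>This substitution, defined over \<open>loc R v\<close>, sends z to X2 / (v - 1).
    Hence F = a X1 + h(X2 / (v - 1)), and its coefficients are a together with the coefficients h_j
    / (v - 1)^j, among which are those of q.\<close>
  define F where "F = subst2 f (X1, const2 (1 / (v - 1)) * X2 + lift1 (- p0))"
  have "1 / (v - 1) \<in> loc R v"
    unfolding loc_def by (intro CollectI exI[of _ 1] exI[of _ "1::nat"]) auto
  moreover have "L.polyR p" "in_R (loc R v) f" using p fR R_subset_loc by (auto simp: polyR_def L.polyR_def in_R_def)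
  moreover from calculation have "L.polyR (- p0)"
    unfolding p0_def by (intro L.polyR_uminus L.polyR_smult)
  then have "in_R (loc R v) (lift1 (- p0))" by (simp only: L.in_R_lift1)
  ultimately have "in_R (loc R v) F"
    unfolding F_def by (intro L.in_R_subst2 L.in_R_add L.in_R_mult) simp_all
  then have FR: "cf F i j \<in> loc R v" for i j by (simp add: in_R_def)
  have "F = const2 a * X1 + ev h (const2 (1 / (v - 1)) * X2)"
    unfolding F_def f' by (simp add: subst2_lift1 flip: lift1_eq_poly_X1)
  also have "ev h (const2 (1 / (v - 1)) * X2) = ev (pcompose h [:0, 1 / (v - 1):]) X2"
    by (simp add: ev_pcompose mult.commute)
  finally have F: "cf F i j = (if i = 1 \<and> j = 0 then a else 0) + (if i = 0 then (1 / (v - 1)) ^ j * coeff h j else 0)" for i j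
    by (simp add: cf_const2_mult cf_X1 poly_const2_X2 coeff_pcompose_linear)
  have "a \<in> loc R v" using FR[of 0 1] by (simp add: F)
  moreover have "coeff q i \<in> loc R v" for i
    using FR[of "e * i" 0] by (simp add: F q(2) power_one_over power_mult field_simps)
  moreover have "\<not> (\<exists>c\<in>loc R v. ev h ?z = const2 c)"
    using degree_poly_const2_shear[of h p0] \<open>degree h \<noteq> 0\<close> by (auto simp: const2_def)
  ultimately show ?thesis
    unfolding typeII_def using a v e dp lc p f' hq unfolding polyR_def
    by (intro exI[of _ a] exI[of _ "ev h ?z"] exI[of _ v] exI[of _ e] exI[of _ p] exI[of _ q]) auto
qed

lemma types_of_lead_ge2:
  assumes fR: "in_R R f" and f: "coordinate f" and red: "tamely_reduced R f"
    and l: "lead d n c \<gamma> f" and c: "c \<noteq> 0" and n: "1 \<le> n" and d: "2 \<le> d" and \<gamma>: "\<gamma> \<noteq> 0"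
    and \<sigma>: "\<sigma> \<in> tame R" "subst2 f \<sigma> = f" "\<sigma> \<noteq> id2"
  shows "typeI R f \<or> typeII R f"
proof -
  have \<gamma>R: "\<gamma> \<notin> R" by (rule reduced_not_in_R[OF red l c n d \<gamma>])
  have "\<sigma> \<in> tris" by (rule lead_tame(2)[OF l d c \<gamma>R n \<sigma>(1,2)])
  then obtain u b v p u' v' where s: "\<sigma> = (aff u 0 b, const2 v * X2 + lift1 p)"
    "u \<in> R" "b \<in> R" "v \<in> R" "polyR p" "u' \<in> R" "u * u' = 1" "v' \<in> R" "v * v' = 1"
    by (rule trisE)
  have nz: "u \<noteq> 0" "v \<noteq> 0" using s by auto
  have df: "deg_x2 f = n" using lead_deg[OF l] d c by auto
  from coordinate_fixed_triangular[OF f nz \<sigma>(2,3)[unfolded s(1)]]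
  consider (a) a h where "a \<noteq> 0" "f = const2 a * X2 + lift1 h"
    | (b) a h where "u = 1" "b = 0" "v \<noteq> 1" "a \<noteq> 0"
        "f = const2 a * X1 + ev h (X2 + lift1 (smult (1 / (v - 1)) p))"
    | (c) a e where "a \<noteq> 0" "f = const2 a * X1 + const2 e" by blast
  then show ?thesis
  proof cases
    case a
    then show ?thesis using linear_shear_is_typeI[OF fR l c d \<gamma>R] by blast
  next
    case b
    have "subst2 f (X1, const2 v * X2 + lift1 p) = f" using \<sigma>(2) b(1,2) by (simp add: s(1) X1_eq_aff)
    then show ?thesis using fixed_shear_is_typeII[OF fR red l c n d \<gamma> s(4) b(3) s(5) _ b(4,5)] by blast
  next
    case c
    then have "deg_x2 f = 0" by (simp add: deg_x2_def const2_def X1_def)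
    then show ?thesis using df n by simp
  qed
qed

end

section \<open>Leading forms with d = 1, and types III to V\<close>

lemma wle_1_eq_aff:
  assumes "wle 1 1 1 f"
  shows "f = aff (cf f 1 0) (cf f 0 1) (cf f 0 0)"
proof (rule poly2_eqI)
  fix i j
  have "cf f i j \<noteq> 0 \<longrightarrow> i + j \<le> 1" using wleD[OF assms, of j i] by auto
  then show "cf f i j = cf (aff (cf f 1 0) (cf f 0 1) (cf f 0 0)) i j"
    by (cases "i = 0"; cases "j = 0"; cases "i = 1"; cases "j = 1") (auto simp: cf_aff)
qed

lemma lead_1_wle: "lead 1 n c \<gamma> f \<Longrightarrow> wle 1 1 (int n) f"
  by (simp add: lead_def)

lemma lead_1_wcomp: "lead 1 n c \<gamma> f \<Longrightarrow> wcomp 1 1 (int n) f = const2 c * lform \<gamma> 1 ^ n"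
  by (simp add: lead_def lform_def add.commute)

lemma lead_1_not_wle:
  assumes "lead 1 n c \<gamma> f" "c \<noteq> 0" "k < n"
  shows "\<not> wle 1 1 (int k) f"
proof
  assume "wle 1 1 (int k) f"
  then have "wcomp 1 1 (int n) f = 0" using \<open>k < n\<close> by (rule_tac wcomp_eq_0_of_wle) auto
  then have "cf (const2 c * lform \<gamma> 1 ^ n) 0 n = 0" using lead_1_wcomp[OF assms(1)] by simp
  then show False using assms(2) by (simp add: cf_const2_mult cf_lform_power)
qed

text \<open>For n >= 2 the top form of f must come from h applied to the inner linear form, so h has
  degree n and this linear form, unless constant, is proportional to \<gamma> X1 + X2.\<close>

lemma lead_1_poly_aff:
  fixes h :: "'a::field_char_0 poly"
  assumes l: "lead 1 n c \<gamma> f" and c: "c \<noteq> 0" and n: "2 \<le> n"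
    and f: "f = subst2 (X2 + lift1 h) (aff s t e, aff s' t' e')"
  shows "degree h = n \<and> (s \<noteq> 0 \<or> t \<noteq> 0 \<longrightarrow> t \<noteq> 0 \<and> s = \<gamma> * t)"
proof -
  have f': "f = aff s' t' e' + ev h (aff s t e)"
    unfolding f by (simp add: subst2_lift1)
  have h2: "2 \<le> degree h"
  proof (rule ccontr)
    assume "\<not> 2 \<le> degree h"
    then have "degree h \<le> 1" by simp
    from wle_poly_const2[OF wle_aff _ this] have "wle 1 1 1 (ev h (aff s t e))" by simp
    then have "wle 1 1 (int 1) f" unfolding f' using wle_add[OF wle_aff] by simp
    then show False using lead_1_not_wle[OF l c, of 1] n by simp
  qed
  define k where "k = degree h"
  note w = wcomp_aff_shear[OF h2, of s t e s' t' e', folded f, folded k_def]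
  have "\<not> k < n" using lead_1_not_wle[OF l c] w(1) by blast
  show ?thesis
  proof (cases "s = 0 \<and> t = 0")
    case True
    then have "f = aff s' t' e' + ev h (const2 e)" unfolding f' by (simp add: aff_def)
    also have "ev h (const2 e) = const2 (poly h e)"
      by (induction h) simp_all
    finally have "wle 1 1 (int 1) f" using wle_add[OF wle_aff wle_const2] by simp
    then show ?thesis using lead_1_not_wle[OF l c, of 1] n by simp
  next
    case False
    have "\<not> n < k"
    proof
      assume "n < k"
      then have "wcomp 1 1 (int k) f = 0" using wcomp_eq_0_of_wle[OF lead_1_wle[OF l]] by simp
      then have z: "const2 (coeff h k) * lform s t ^ k = 0" using w(2) by simp
      have "coeff h k \<noteq> 0" using h2 by (auto simp: k_def)
      then have "lform s t = 0" using z by simp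
      then have "aff s t 0 = aff 0 0 0" by (simp add: lform_def aff_def)
      then show False using False by simp
    qed
    then have "k = n" using \<open>\<not> k < n\<close> by simp
    then have "const2 (coeff h k) * lform s t ^ n = const2 c * lform \<gamma> 1 ^ n"
      using w(2) lead_1_wcomp[OF l] by simp
    from lform_power_eqD[OF this _ c] show ?thesis using n \<open>k = n\<close> k_def by simp
  qed
qed

context base_ring
begin

lemma quadratic_is_typeIV:
  assumes frac: "\<And>k. \<exists>a\<in>R. \<exists>b\<in>R. b \<noteq> 0 \<and> k = a / b"
    and \<gamma>: "\<gamma> \<noteq> 0" "\<gamma> \<notin> Vset R" and a: "a \<noteq> 0" and h: "degree h = 2"
    and f: "f = const2 a * X1 + ev h (aff \<gamma> 1 0)"
  shows "typeIV R f"
proof -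
  obtain h0 h1 h2 where hh: "h = [:h0, h1, h2:]" "h2 \<noteq> 0"
  proof -
    have "h = [:coeff h 0, coeff h 1, coeff h 2:]"
    proof (rule poly_eqI)
      fix i show "coeff h i = coeff [:coeff h 0, coeff h 1, coeff h 2:] i"
        using h by (cases "i \<le> 2") (auto simp: coeff_eq_0 coeff_pCons le_Suc_eq numeral_2_eq_2 split: nat.splits)
    qed
    moreover have "coeff h 2 \<noteq> 0" using h by (metis leading_coeff_0_iff degree_0 zero_neq_numeral)
    ultimately show thesis using that by blast
  qed
  obtain r s where rs: "r \<in> R" "s \<in> R" "s \<noteq> 0" "h2 = r / s" using frac by blast
  have "r \<noteq> 0" using rs hh by auto
  \<comment> \<open>Rescaling the linear form by 1 / s replaces its quadratic coefficient r / s by r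
    s, which lies in R; the linear part of f becomes the second component.\<close>
  let ?\<tau> = "(aff (\<gamma> / s) (1 / s) 0, aff (a + h1 * \<gamma>) h1 h0)"
  have "\<gamma> / s * h1 - 1 / s * (a + h1 * \<gamma>) = - a / s" using rs by (simp add: field_simps)
  then have \<tau>: "is_affine UNIV ?\<tau>" using rs a by (intro affine_UNIV_I) simp
  have l: "aff \<gamma> 1 0 = const2 s * aff (\<gamma> / s) (1 / s) 0"
    using rs by (simp add: aff_def distrib_left mult.assoc[symmetric] flip: const2_simps(4))
  have h2s: "const2 h2 * (const2 s * const2 s) = const2 (r * s)"
    using rs by (simp flip: const2_simps(4))
  have "f = const2 h2 * aff \<gamma> 1 0 ^ 2 + (const2 a * X1 + const2 h1 * aff \<gamma> 1 0 + const2 h0)"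
    unfolding f hh by (simp add: power2_eq_square algebra_simps)
  also have "const2 h2 * aff \<gamma> 1 0 ^ 2 = const2 h2 * (const2 s * const2 s) * aff (\<gamma> / s) (1 / s) 0 ^ 2"
    unfolding l by (simp only: power2_eq_square mult_ac)
  also have "const2 a * X1 + const2 h1 * aff \<gamma> 1 0 + const2 h0 = aff (a + h1 * \<gamma>) h1 h0"
    by (simp add: aff_def algebra_simps)
  finally have f': "f = const2 (r * s) * (fst ?\<tau>) ^ 2 + snd ?\<tau>" unfolding h2s by simp
  have "fst ?\<tau> = const2 (\<gamma> / s) * X1 + const2 (1 / s) * X2" by (simp add: aff_def)
  moreover have "(\<gamma> / s) / (1 / s) \<notin> Vset R" using \<gamma> rs by simp
  moreover have "r * s \<in> R - {0}" using rs \<open>r \<noteq> 0\<close> by auto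
  ultimately show ?thesis unfolding typeIV_def
    using \<tau> f' rs \<gamma> by (intro exI[of _ "r * s"] exI[of _ ?\<tau>] exI[of _ "\<gamma> / s"] exI[of _ "1 / s"]) auto
qed

text \<open>The terms of h of degree at most 1 go into \<tau>(x2), so that only exponents i >= 2
  with u^i = 1 remain. The root of unity is u, and condition (c) holds because its quotients are
  entries of the fixing map up to sign, or differences of such entries with 1 or u.\<close>

lemma fixed_affine_is_typeV:
  assumes \<gamma>: "\<gamma> \<noteq> 0" "\<gamma> \<notin> Vset R" and a: "a \<noteq> 0" and h: "3 \<le> degree h"
    and f: "f = const2 a * X1 + ev h (aff \<gamma> 1 \<alpha>0)"
    and R: "a1 \<in> R" "b1 \<in> R" "c1 \<in> R" "a2 \<in> R" "b2 \<in> R" "c2 \<in> R" and u: "u \<noteq> 1"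
    and e1: "a2 + \<gamma> * a1 = \<gamma> * u" "b2 + \<gamma> * b1 = u" "\<gamma> * c1 + c2 + \<alpha>0 = u * \<alpha>0"
    and v: "a1 - \<gamma> * b1 = 1" and fixed: "smult a [:c1 - b1 * \<alpha>0, b1:] + pcompose h [:0, u:] = h"
  shows "typeV R f"
proof -
  define h0 h1 where "h0 = coeff h 0" and "h1 = coeff h 1"
  define g where "g = h - [:h0, h1:]"
  have cg: "coeff g i = (if i \<le> 1 then 0 else coeff h i)" for i
    by (auto simp: g_def h0_def h1_def coeff_pCons le_Suc_eq split: nat.splits)
  have dg: "degree g = degree h" unfolding g_def diff_conv_add_uminus
    using h by (intro degree_add_eq_left) (auto intro: le_less_trans[OF degree_pCons_le])
  have fx: "a * coeff [:c1 - b1 * \<alpha>0, b1:] i + u ^ i * coeff h i = coeff h i" for i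
    using arg_cong[OF fixed, of "\<lambda>p. coeff p i"] by (simp add: coeff_pcompose_linear del: smult_pCons)
  have ui: "u ^ i = 1" if "coeff h i \<noteq> 0" "2 \<le> i" for i
  proof -
    obtain j where "i = Suc (Suc j)" using \<open>2 \<le> i\<close> by (metis add_2_eq_Suc le_Suc_ex)
    then show ?thesis using fx[of i] that by simp
  qed
  have "lead_coeff h \<noteq> 0" using h by auto
  obtain e where e: "2 \<le> e" "u ^ e = 1" "\<And>i. u ^ i = 1 \<Longrightarrow> e dvd i"
    using root_of_unity_order[OF ui[OF \<open>lead_coeff h \<noteq> 0\<close>]] h u by auto
  have c1: "c1 = b1 * \<alpha>0" using fx[of 0] a by simp
  have h1: "a * b1 + u * h1 = h1" using fx[of 1] by (simp add: h1_def)
  let ?\<tau> = "(aff \<gamma> 1 \<alpha>0, aff (a + h1 * \<gamma>) h1 (h0 + h1 * \<alpha>0))"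
  have \<Delta>: "\<gamma> * h1 - 1 * (a + h1 * \<gamma>) = - a" by simp
  have \<tau>: "is_affine UNIV ?\<tau>" using a by (intro affine_UNIV_I) simp
  \<comment> \<open>As v = 1, the eigenvalue u is the determinant of the fixing map.\<close>
  have uR: "u \<in> R"
  proof -
    have "u = a1 * b2 - a2 * b1" using e1 v by algebra
    then show ?thesis using R by auto
  qed
  have b1: "(u - 1) * h1 / (- a) = b1" using h1 a by (simp add: field_simps)
  have t: "(u - 1) * (a + h1 * \<gamma>) / (- a) = a1 - u"
  proof -
    have "(u - 1) * h1 = - (a * b1)" using h1 by (simp add: algebra_simps eq_neg_iff_add_eq_0)
    then have "(u - 1) * (a + h1 * \<gamma>) = (u - 1) * a - a * (\<gamma> * b1)" by algebra
    also have "\<gamma> * b1 = a1 - 1" using v by (simp add: algebra_simps)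
    finally have "(u - 1) * (a + h1 * \<gamma>) = (a1 - u) * (- a)" by (simp add: algebra_simps)
    then show ?thesis using a by simp
  qed
  have "(u - 1) * \<alpha> * \<beta> / (\<gamma> * h1 - 1 * (a + h1 * \<gamma>)) \<in> R"
    if "\<alpha> \<in> {\<alpha>0, \<gamma>, 1}" "\<beta> \<in> {a + h1 * \<gamma>, h1}" for \<alpha> \<beta>
  proof -
    have "(u - 1) * \<alpha> * h1 / (- a) = \<alpha> * ((u - 1) * h1 / (- a))"
      "(u - 1) * \<alpha> * (a + h1 * \<gamma>) / (- a) = \<alpha> * ((u - 1) * (a + h1 * \<gamma>) / (- a))" by simp_all
    then have 1: "(u - 1) * \<alpha> * h1 / (- a) = \<alpha> * b1" "(u - 1) * \<alpha> * (a + h1 * \<gamma>) / (- a) = \<alpha> * (a1 - u)"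
      unfolding b1 t .
    \<comment> \<open>For \<alpha> = \<alpha>0, \<gamma>, 1 the quotients are c1, a1 - 1, b1 with
      \<beta> = h1, and - c2, - a2, a1 - u with \<beta> = a + h1 * \<gamma>.\<close>
    have "\<alpha>0 * b1 = c1" "\<gamma> * b1 = a1 - 1" "\<gamma> * (a1 - u) = - a2" using c1 v e1(1) by algebra+
    moreover have "\<alpha>0 * (a1 - u) = - c2" using c1 e1(3) v by algebra
    moreover have "a1 - 1 \<in> R" "a1 - u \<in> R" "- a2 \<in> R" "- c2 \<in> R" using R uR by auto
    ultimately have "\<alpha> * b1 \<in> R \<and> \<alpha> * (a1 - u) \<in> R" using that(1) R by (elim insertE emptyE) simp_all
    then show ?thesis unfolding \<Delta> using that(2) 1 by (metis insert_iff singletonD)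
  qed
  moreover have "f = subst2 (X2 + lift1 g) ?\<tau>"
  proof -
    have "h = g + [:h0, h1:]" by (simp add: g_def)
    then have "ev h (aff \<gamma> 1 \<alpha>0)
       = ev g (aff \<gamma> 1 \<alpha>0) + (const2 h0 + aff \<gamma> 1 \<alpha>0 * const2 h1)"
      by (metis ev_add ev_simps add.right_neutral mult_zero_right)
    then have "f = ev g (aff \<gamma> 1 \<alpha>0) + (const2 a * X1 + (const2 h0 + aff \<gamma> 1 \<alpha>0 * const2 h1))"
      by (simp add: f)
    also have "const2 a * X1 + (const2 h0 + aff \<gamma> 1 \<alpha>0 * const2 h1) = aff (a + h1 * \<gamma>) h1 (h0 + h1 * \<alpha>0)"
      by (simp add: aff_def algebra_simps)
    finally show ?thesis by (simp add: subst2_lift1)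
  qed
  moreover have "\<forall>i. coeff g i \<noteq> 0 \<longrightarrow> e dvd i \<and> i > 0"
    using ui e(3) by (auto simp: cg)
  moreover have "3 \<le> degree g" using h dg by simp
  moreover have "\<gamma> / 1 \<notin> Vset R" using \<gamma> by simp
  moreover have "fst ?\<tau> = const2 \<gamma> * X1 + const2 1 * X2 + const2 \<alpha>0"
    "snd ?\<tau> = const2 (a + h1 * \<gamma>) * X1 + const2 h1 * X2 + const2 (h0 + h1 * \<alpha>0)"
    by (simp_all only: aff_def fst_conv snd_conv)
  moreover have "(1 :: 'a) \<noteq> 0" by simp
  ultimately show ?thesis unfolding typeV_def using \<tau> e(1,2) \<gamma>(1) uR u by blast
qed

text \<open>The fixing map is affine and must preserve the direction of \<gamma> X1 + X2. With an
  affine multiple of this form as first coordinate it becomes triangular, and the general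
  classification applies.\<close>

lemma types_of_lead_1:
  assumes frac: "\<And>k. \<exists>a\<in>R. \<exists>b\<in>R. b \<noteq> 0 \<and> k = a / b"
    and fR: "in_R R f" and f: "coordinate f" and red: "tamely_reduced R f"
    and l: "lead 1 n c \<gamma> f" and c: "c \<noteq> 0" and n: "1 \<le> n" and \<gamma>: "\<gamma> \<noteq> 0"
    and \<sigma>: "\<sigma> \<in> tame R" "subst2 f \<sigma> = f" "\<sigma> \<noteq> id2"
  shows "typeIII R f \<or> typeIV R f \<or> typeV R f"
proof (cases "n = 1")
  case True
  have V: "\<gamma> \<notin> Vset R" by (rule reduced_not_in_V[OF red l c n \<gamma>])
  have w: "wle 1 1 1 f" using lead_1_wle[OF l] True by simp
  have "cf f 0 1 = c" "cf f 1 0 = c * \<gamma>" using lead_cf[OF l] True by simp_all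
  then have f': "f = const2 (c * \<gamma>) * X1 + const2 c * X2 + const2 (cf f 0 0)"
    using wle_1_eq_aff[OF w] by (simp only: aff_def)
  have "cf f i j \<in> R" for i j using fR by (auto simp: in_R_def)
  from this[of 1 0] this[of 0 1] this[of 0 0] have "c \<in> R" "c * \<gamma> \<in> R" "cf f 0 0 \<in> R"
    using \<open>cf f 0 1 = c\<close> \<open>cf f 1 0 = c * \<gamma>\<close> by simp_all
  then have "typeIII R f" unfolding typeIII_def using c \<gamma> V f'
    by (intro exI[of _ "c * \<gamma>"] exI[of _ c] exI[of _ "cf f 0 0"]) auto
  then show ?thesis by simp
next
  case False
  then have n2: "2 \<le> n" using n by simp
  have V: "\<gamma> \<notin> Vset R" by (rule reduced_not_in_V[OF red l c n \<gamma>])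
  have "\<sigma> \<in> affs" by (rule lead1_tame(2)[OF l c \<gamma> V n \<sigma>(1,2)])
  then obtain a1 b1 c1 a2 b2 c2 r where s: "\<sigma> = (aff a1 b1 c1, aff a2 b2 c2)"
    "a1 \<in> R" "b1 \<in> R" "c1 \<in> R" "a2 \<in> R" "b2 \<in> R" "c2 \<in> R" "r \<in> R" "r * (a1 * b2 - b1 * a2) = 1"
    by (rule affsE)
  define u where "u = b2 + \<gamma> * b1"
  have "const2 c * lform (a2 + \<gamma> * a1) u ^ n = const2 c * lform \<gamma> 1 ^ n"
  proof -
    have "wcomp 1 1 (int n) (subst2 f \<sigma>) = subst2 (const2 c * lform \<gamma> 1 ^ n) (lform a1 b1, lform a2 b2)"
      unfolding s(1) by (simp only: wcomp_subst2[OF lead_1_wle[OF l] wle_aff wle_aff] lead_1_wcomp[OF l] wcomp_aff)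
    also have "\<dots> = const2 c * lform (a2 + \<gamma> * a1) u ^ n"
      by (simp add: lform_def u_def algebra_simps)
    finally show ?thesis unfolding \<sigma>(2) lead_1_wcomp[OF l] by (rule sym)
  qed
  from lform_power_eqD[OF this n c] have u0: "u \<noteq> 0" and gu: "a2 + \<gamma> * a1 = \<gamma> * u" by auto
  \<comment> \<open>For u not 1 this constant makes \<gamma> X1 + X2 + \<alpha>0 an eigenvector, so
    the translation part b vanishes; for u = 1 no constant can change b.\<close>
  define \<alpha>0 where "\<alpha>0 = (if u = 1 then 0 else (\<gamma> * c1 + c2) / (u - 1))"
  define b where "b = \<gamma> * c1 + c2 + \<alpha>0 - u * \<alpha>0"
  have b0: "b = 0" if "u \<noteq> 1" using that by (simp add: b_def \<alpha>0_def field_simps)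
  define v where "v = a1 - \<gamma> * b1"
  have "u * v = a1 * b2 - b1 * a2" using gu unfolding u_def v_def by algebra
  then have v0: "v \<noteq> 0" using s(9) by auto
  let ?l = "aff \<gamma> 1 \<alpha>0"
  let ?p = "[:c1 - b1 * \<alpha>0, b1:]"
  \<comment> \<open>The new coordinates are l and X1. In them u multiplies l, and v multiplies X1 up
    to the polynomial \<open>?p\<close> in l.\<close>
  define \<chi> \<chi>' :: "'a poly poly \<times> 'a poly poly" where "\<chi> = (?l, X1)" and "\<chi>' = (X2, aff 1 (- \<gamma>) (- \<alpha>0))"
  have inv: "comp2 \<chi> \<chi>' = id2" "comp2 \<chi>' \<chi> = id2"
    by (simp_all add: \<chi>_def \<chi>'_def comp2_def id2_def) (simp_all add: aff_def algebra_simps)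
  then have "aut \<chi>'" by (intro autI[of \<chi>' \<chi>])
  define \<sigma>1 where "\<sigma>1 = comp2 \<chi>' (comp2 \<sigma> \<chi>)"
  have s1: "\<sigma>1 = (aff u 0 b, const2 v * X2 + lift1 ?p)"
  proof -
    have "subst2 ?l \<sigma> = const2 u * ?l + const2 b"
    proof -
      have "subst2 ?l \<sigma> = aff (\<gamma> * a1 + 1 * a2) (\<gamma> * b1 + 1 * b2) (\<gamma> * c1 + 1 * c2 + \<alpha>0)"
        unfolding s(1) subst2_aff_aff ..
      also have "\<dots> = aff (u * \<gamma>) u (u * \<alpha>0 + b)"
        using gu by (simp add: u_def b_def algebra_simps)
      finally show ?thesis by (simp add: aff_def algebra_simps)
    qed
    moreover have "subst2 ?l \<chi>' = X1" using inv(2) by (simp add: prod_eq_iff \<chi>_def)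
    ultimately have "subst2 (subst2 ?l \<sigma>) \<chi>' = const2 u * X1 + const2 b" by simp
    moreover have "subst2 (aff a1 b1 c1) \<chi>' = const2 v * X2 + lift1 ?p"
      unfolding \<chi>'_def by (simp add: lift1_linear v_def) (simp add: aff_def algebra_simps)
    ultimately show ?thesis
      by (simp add: \<sigma>1_def comp2_def \<chi>_def s(1)) (simp add: aff_def)
  qed
  have nid: "\<sigma>1 \<noteq> id2"
  proof
    assume "\<sigma>1 = id2"
    then have "comp2 \<chi> (comp2 \<sigma>1 \<chi>') = id2" using inv by simp
    moreover have "comp2 \<chi> (comp2 \<sigma>1 \<chi>') = \<sigma>"
      unfolding \<sigma>1_def using inv by (metis comp2_assoc comp2_id2)
    ultimately show False using \<sigma>(3) by simp
  qed
  define f1 where "f1 = subst2 f \<chi>'"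
  have f1: "coordinate f1" unfolding f1_def by (intro coordinate_subst2 f \<open>aut \<chi>'\<close>)
  have ff1: "f = subst2 f1 \<chi>" using inv by (simp add: f1_def subst2_subst2)
  have fix1: "subst2 f1 \<sigma>1 = f1"
  proof -
    have "subst2 f1 \<sigma>1 = subst2 (subst2 (subst2 (subst2 f \<chi>') \<chi>) \<sigma>) \<chi>'"
      by (simp add: f1_def \<sigma>1_def subst2_subst2 comp2_assoc)
    also have "subst2 (subst2 f \<chi>') \<chi> = f" using inv by (simp add: subst2_subst2)
    finally show ?thesis using \<sigma>(2) by (simp add: f1_def)
  qed
  from coordinate_fixed_triangular[OF f1 u0 v0 fix1[unfolded s1] nid[unfolded s1]]
  consider (a) a h where "a \<noteq> 0" "f1 = const2 a * X2 + lift1 h"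
    | (b) a h where "a \<noteq> 0" "f1 = const2 a * X1 + ev h (X2 + lift1 (smult (1 / (v - 1)) ?p))"
    | (c) a e where "a \<noteq> 0" "f1 = const2 a * X1 + const2 e" by blast
  then show ?thesis
  proof cases
    case a
    have fa: "f = const2 a * X1 + ev h ?l"
      unfolding ff1 a \<chi>_def by (simp add: subst2_lift1)
    have "f = subst2 (X2 + lift1 h) (?l, aff a 0 0)"
      unfolding fa by (simp add: subst2_lift1) (simp add: aff_def)
    from lead_1_poly_aff[OF l c n2 this] have dh: "degree h = n" by simp
    show ?thesis
    proof (cases "n = 2")
      case True
      have "ev h ?l = ev (pcompose h [:\<alpha>0, 1:]) (aff \<gamma> 1 0)"
        by (simp add: ev_pcompose) (simp add: aff_def algebra_simps)
      then have "typeIV R f"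
        using fa a dh True by (intro quadratic_is_typeIV[OF frac \<gamma> V, of a "pcompose h [:\<alpha>0, 1:]"])
          (simp_all add: degree_pcompose)
      then show ?thesis by simp
    next
      case False
      then have h3: "3 \<le> degree h" using dh n2 by simp
      have "const2 (a * v) * X2 + lift1 (smult a ?p + pcompose h [:b, u:]) = const2 a * X2 + lift1 h"
        using fix1[unfolded s1 a(2) subst2_tri] by (simp add: lift1_smult algebra_simps del: smult_pCons)
      then have "[:smult a ?p + pcompose h [:b, u:], [:a * v:]:] = [:h, [:a:]:]" by (simp only: pCons_two)
      then have e: "a * v = a" "smult a ?p + pcompose h [:b, u:] = h" by (simp_all only: pCons_eq_iff)
      then have "v = 1" using a by simp
      \<comment> \<open>For u = 1 the second derivative of h is invariant under the shift by b and
        is not constant, so b = 0. Then \<open>?p\<close> is 0 and the fixing map is the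
        identity.\<close>
      have "u \<noteq> 1"
      proof
        assume u1: "u = 1"
        have pd: "pderiv (pcompose q [:b, 1:]) = pcompose (pderiv q) [:b, 1:]" for q
          by (simp add: pderiv_pcompose pderiv_pCons)
        have "pderiv (pderiv (smult a ?p + pcompose h [:b, 1:])) = pderiv (pderiv h)" using e(2) u1 by simp
        then have hb: "pcompose (pderiv (pderiv h)) [:b, 1:] = pderiv (pderiv h)"
          by (simp add: pderiv_add pd pderiv_smult pderiv_pCons)
        have "b = 0"
        proof (rule ccontr)
          assume "b \<noteq> 0"
          then obtain k where "pderiv (pderiv h) = [:k:]"
            using shift_invariant_const[of 1 "pderiv (pderiv h)" b] hb by auto
          then have "degree (pderiv (pderiv h)) = 0" by simp
          then show False using h3 by (simp add: degree_pderiv)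
        qed
        then have "smult a ?p = 0" using e(2) u1 by (simp add: pcompose_idR)
        then have "?p = 0" using a by (simp only: smult_eq_0_iff) simp
        then have "\<sigma>1 = id2" using s1 u1 \<open>b = 0\<close> \<open>v = 1\<close> by (simp only: id2_def) (simp add: aff_def)
        then show False using nid by simp
      qed
      then have "b = 0" by (rule b0)
      have e3: "\<gamma> * c1 + c2 + \<alpha>0 = u * \<alpha>0" using \<open>b = 0\<close> by (simp add: b_def)
      have "typeV R f"
        by (rule fixed_affine_is_typeV[OF \<gamma> V a(1) h3 fa s(2-7) \<open>u \<noteq> 1\<close> gu u_def[symmetric] e3])
          (use \<open>v = 1\<close> e(2) \<open>b = 0\<close> in \<open>simp_all add: v_def\<close>)
      then show ?thesis by simp
    qed
  next
    case b
    \<comment> \<open>In this case the inner linear form is (1 + w \<gamma>) X1 + w X2, which is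
      never proportional to \<gamma> X1 + X2; so the case cannot occur.\<close>
    define w where "w = b1 / (v - 1)"
    have "\<exists>k. f = subst2 (X2 + lift1 h) (aff (1 + w * \<gamma>) w k, aff (a * \<gamma>) a (a * \<alpha>0))"
    proof -
      define w0 where "w0 = (c1 - b1 * \<alpha>0) / (v - 1)"
      have p: "smult (1 / (v - 1)) ?p = [:w0, w:]" by (simp add: w_def w0_def)
      have "f = const2 a * ?l + ev h (X1 + ev [:w0, w:] ?l)"
        unfolding ff1 b p \<chi>_def by (simp only: subst2_add subst2_mult subst2_const2 subst2_X1 subst2_X2
            fst_conv snd_conv subst2_poly_const2 subst2_lift1)
      also have "X1 + ev [:w0, w:] ?l = aff (1 + w * \<gamma>) w (w0 + w * \<alpha>0)"
        by (simp add: aff_def algebra_simps)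
      also have "const2 a * ?l = aff (a * \<gamma>) a (a * \<alpha>0)" by (simp add: aff_def algebra_simps)
      finally show ?thesis by (intro exI[of _ "w0 + w * \<alpha>0"]) (simp add: subst2_lift1)
    qed
    then obtain k where "f = subst2 (X2 + lift1 h) (aff (1 + w * \<gamma>) w k, aff (a * \<gamma>) a (a * \<alpha>0))" ..
    from lead_1_poly_aff[OF l c n2 this] have "1 + w * \<gamma> \<noteq> 0 \<or> w \<noteq> 0 \<Longrightarrow> 1 + w * \<gamma> = \<gamma> * w" by blast
    then show ?thesis by (cases "w = 0") (auto simp: mult.commute)
  next
    case c
    have "f = aff (a * \<gamma>) a (a * \<alpha>0 + e)" unfolding ff1 c(2) \<chi>_def by (simp add: aff_def algebra_simps)
    then have "wle 1 1 (int 1) f" using wle_aff by simp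
    then show ?thesis using lead_1_not_wle[OF l \<open>c \<noteq> 0\<close>, of 1] n2 by simp
  qed
qed

end

theorem theorem4p1p3:
  fixes R :: "'a::field_char_0 set" and f :: "'a poly poly"
  assumes subring: "0 \<in> R" "1 \<in> R" "\<And>x y. x \<in> R \<Longrightarrow> y \<in> R \<Longrightarrow> x + y \<in> R"
      "\<And>x. x \<in> R \<Longrightarrow> - x \<in> R" "\<And>x y. x \<in> R \<Longrightarrow> y \<in> R \<Longrightarrow> x * y \<in> R"
    and ints: "\<int> \<subseteq> R"
    and frac: "\<And>k. \<exists>a\<in>R. \<exists>b\<in>R. b \<noteq> 0 \<and> k = a / b"
    and fR: "in_R R f"
    and coord: "coordinate f"
  shows "(typeI R f \<or> typeII R f \<or> typeIII R f \<or> typeIV R f \<or> typeV R f) \<longleftrightarrow>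
         (Hgrp R f \<noteq> {id2} \<and> tamely_reduced R f \<and> deg_x1 f \<ge> deg_x2 f \<and> deg_x2 f \<ge> 1)"
proof -
  interpret base_ring R by unfold_locales (use subring in auto)
  show ?thesis
  proof
    assume "typeI R f \<or> typeII R f \<or> typeIII R f \<or> typeIV R f \<or> typeV R f"
    then show "Hgrp R f \<noteq> {id2} \<and> tamely_reduced R f \<and> deg_x1 f \<ge> deg_x2 f \<and> deg_x2 f \<ge> 1"
      using typeI_conditions[OF fR] typeII_conditions[OF fR] typeIII_conditions[OF fR]
        typeIV_conditions[OF frac fR] typeV_conditions[OF fR] by blast
  next
    assume *: "Hgrp R f \<noteq> {id2} \<and> tamely_reduced R f \<and> deg_x1 f \<ge> deg_x2 f \<and> deg_x2 f \<ge> 1"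
    have "id2 \<in> Hgrp R f" by (simp add: Hgrp_def tame_id)
    then obtain \<sigma> where \<sigma>: "\<sigma> \<in> tame R" "subst2 f \<sigma> = f" "\<sigma> \<noteq> id2"
      using * by (auto simp: Hgrp_def)
    obtain g where "aut (f, g)" using coord by (auto simp: coordinate_iff)
    then obtain d c \<gamma> where l: "0 < d" "c \<noteq> 0" "\<gamma> \<noteq> 0" "lead d (deg_x2 f) c \<gamma> f"
      using coordinate_lead * by blast
    show "typeI R f \<or> typeII R f \<or> typeIII R f \<or> typeIV R f \<or> typeV R f"
    proof (cases "d = 1")
      case True
      then show ?thesis using types_of_lead_1[OF frac fR coord _ _ l(2) _ l(3) \<sigma>] l(4) * by blast
    next
      case False
      then have "2 \<le> d" using l(1) by simp
      then show ?thesis using types_of_lead_ge2[OF fR coord _ l(4) l(2) _ _ l(3) \<sigma>] * by blast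
    qed
  qed
qed

end
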